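(* Let $d\ge 3$ and let $D\subset\mathbb{R}^d$ be a domain in the class $\mathcal{D}$ that contains an unbounded uniform domain. Then the reflecting Brownian motion on $\overline{D}$ is transient; that is, the Dirichlet form $(\tfrac12\mathbf{D},W^{1,2}(D))$ on $L^2(D)$ is transient.
   Context: A domain is a nonempty connected open set. For a domain $D\subset\mathbb{R}^d$, $L^p(D)$ is taken with respect to Lebesgue measure. Let $\mathrm{BL}(D)=\{u\in L^2_{loc}(D):\partial u/\partial x_i\in L^2(D),\ 1\le i\le d\}$ (distributional derivatives), $\mathbf{D}(u,v)=\int_D\nabla u\cdot\nabla v\,dx$ for $u,v\in\mathrm{BL}(D)$, and $W^{1,2}(D)=\mathrm{BL}(D)\cap L^2(D)$ with norm $\|u\|_{1,2}^2=\|u\|_{L^2(D)}^2+\mathbf{D}(u,u)$. Then $(\mathcal{E},\mathcal{F})=(\tfrac12\mathbf{D},W^{1,2}(D))$ is a Dirichlet form on $L^2(D)$. Class $\mathcal{D}$: the domains $D\subset\mathbb{R}^d$ for which this form is regular on $L^2(\overline{D})$ (identified with $L^2(D)$, i.e. $\partial D$ carries no mass), i.e. $W^{1,2}(D)\cap C_c(\overline{D})$ is dense in $(W^{1,2}(D),\|\cdot\|_{1,2})$ and in $(C_\infty(\overline{D}),\|\cdot\|_\infty)$, where $C_c(\overline D)$ (resp. $C_\infty(\overline{D})$) is the space of continuous functions on $\overline{D}$ with compact support (resp. vanishing at infinity). For $D\in\mathcal{D}$ the form is regular and strongly local, and the associated symmetric diffusion $X$ on $\overline{D}$ is called reflecting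 Brownian motion (RBM) on $\overline{D}$. Transience: for a Dirichlet form on $L^2(E;m)$ with $L^2$-semigroup $\{T_t\}$, set $S_tf=\int_0^tT_sf\,ds$ (extended from $L^1\cap L^2$ to $L^1(E;m)$) and, for $f\in L^1_+(E;m)$, $Gf=\lim_{N\to\infty}S_Nf\le\infty$. The form (or its associated process) is transient if $Gf<\infty$ $m$-a.e. for some $f\in L^1_+(E;m)$ with $f>0$ $m$-a.e. Uniform domain: a domain $U\subset\mathbb{R}^d$ for which there is $C>0$ such that for all $x,y\in U$ there is a rectifiable curve $\gamma$ in $U$ connecting $x$ and $y$ with $\mathrm{length}(\gamma)\le C|x-y|$ and $\min\{|x-z|,|z-y|\}\le C\,\mathrm{dist}(z,U^c)$ for every $z\in\gamma$ (with $\mathrm{dist}(z,\emptyset)=\infty$). *)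

theory Defs
  imports "HOL-Analysis.Analysis"
begin

text \<open>
  Elements of \<open>L\<^sup>1\<close> and \<open>L\<^sup>2\<close> are represented by real functions, so identities between them
  are stated almost everywhere or through norms.
\<close>

definition domain_set :: "'a::euclidean_space set \<Rightarrow> bool" where
  "domain_set D \<longleftrightarrow> D \<noteq> {} \<and> open D \<and> connected D"


section \<open>The space \<open>L\<^sup>2\<close>\<close>

definition L2 :: "'a measure \<Rightarrow> ('a \<Rightarrow> real) set" where
  "L2 M = {f \<in> borel_measurable M. integrable M (\<lambda>x. (f x)\<^sup>2)}"

definition L2_inner :: "'a measure \<Rightarrow> ('a \<Rightarrow> real) \<Rightarrow> ('a \<Rightarrow> real) \<Rightarrow> real" where
  "L2_inner M f g = (\<integral>x. f x * g x \<partial>M)"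

definition L2_norm :: "'a measure \<Rightarrow> ('a \<Rightarrow> real) \<Rightarrow> real" where
  "L2_norm M f = sqrt (\<integral>x. (f x)\<^sup>2 \<partial>M)"

definition L2_loc :: "'a::euclidean_space set \<Rightarrow> ('a \<Rightarrow> real) set" where
  "L2_loc D = {u \<in> borel_measurable (lebesgue_on D).
     \<forall>K. compact K \<and> K \<subseteq> D \<longrightarrow> integrable (lebesgue_on K) (\<lambda>x. (u x)\<^sup>2)}"


section \<open>Distributional derivatives and \<open>W\<^sup>1\<^sup>,\<^sup>2\<close>\<close>

primrec iter_pderiv :: "'a list \<Rightarrow> ('a::euclidean_space \<Rightarrow> real) \<Rightarrow> 'a \<Rightarrow> real" where
  "iter_pderiv [] f = f"
| "iter_pderiv (b # bs) f = (\<lambda>x. frechet_derivative (iter_pderiv bs f) (at x) b)"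

text \<open>
  A function is \<open>C\<^sup>\<infinity>\<close> iff all its iterated partial derivatives exist and are
  differentiable (so that they are, in particular, all continuous).
\<close>

definition smooth_fun :: "('a::euclidean_space \<Rightarrow> real) \<Rightarrow> bool" where
  "smooth_fun f \<longleftrightarrow> (\<forall>bs. set bs \<subseteq> Basis \<longrightarrow> (\<forall>x. iter_pderiv bs f differentiable (at x)))"

definition test_fun :: "'a::euclidean_space set \<Rightarrow> ('a \<Rightarrow> real) set" where
  "test_fun D = {\<phi>. smooth_fun \<phi> \<and> compact (closure {x. \<phi> x \<noteq> 0}) \<and> closure {x. \<phi> x \<noteq> 0} \<subseteq> D}"

definition has_weak_pderiv ::
  "'a::euclidean_space set \<Rightarrow> ('a \<Rightarrow> real) \<Rightarrow> 'a \<Rightarrow> ('a \<Rightarrow> real) \<Rightarrow> bool" where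
  "has_weak_pderiv D u i g \<longleftrightarrow>
     (\<forall>\<phi>\<in>test_fun D.
        (\<integral>x. u x * frechet_derivative \<phi> (at x) i \<partial>lebesgue_on D) = - (\<integral>x. g x * \<phi> x \<partial>lebesgue_on D))"

definition BL :: "'a::euclidean_space set \<Rightarrow> ('a \<Rightarrow> real) set" where
  "BL D = {u \<in> L2_loc D. \<forall>i\<in>Basis. \<exists>g\<in>L2 (lebesgue_on D). has_weak_pderiv D u i g}"

text \<open>The choice below is immaterial: weak derivatives are unique up to null sets.\<close>

definition weak_pderiv :: "'a::euclidean_space set \<Rightarrow> ('a \<Rightarrow> real) \<Rightarrow> 'a \<Rightarrow> 'a \<Rightarrow> real" where
  "weak_pderiv D u i = (SOME g. g \<in> L2 (lebesgue_on D) \<and> has_weak_pderiv D u i g)"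

definition Dirichlet_int ::
  "'a::euclidean_space set \<Rightarrow> ('a \<Rightarrow> real) \<Rightarrow> ('a \<Rightarrow> real) \<Rightarrow> real" where
  "Dirichlet_int D u v =
     (\<integral>x. (\<Sum>i\<in>Basis. weak_pderiv D u i x * weak_pderiv D v i x) \<partial>lebesgue_on D)"

definition W12 :: "'a::euclidean_space set \<Rightarrow> ('a \<Rightarrow> real) set" where
  "W12 D = BL D \<inter> L2 (lebesgue_on D)"

definition W12_norm :: "'a::euclidean_space set \<Rightarrow> ('a \<Rightarrow> real) \<Rightarrow> real" where
  "W12_norm D u = sqrt ((L2_norm (lebesgue_on D) u)\<^sup>2 + Dirichlet_int D u u)"


section \<open>The class of domains with regular form\<close>

definition Cc :: "'a::euclidean_space set \<Rightarrow> ('a \<Rightarrow> real) set" where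
  "Cc X = {u. continuous_on X u \<and> (\<exists>K. compact K \<and> K \<subseteq> X \<and> (\<forall>x\<in>X - K. u x = 0))}"

definition C_infty :: "'a::euclidean_space set \<Rightarrow> ('a \<Rightarrow> real) set" where
  "C_infty X = {u. continuous_on X u \<and>
     (\<forall>e>0. \<exists>K. compact K \<and> K \<subseteq> X \<and> (\<forall>x\<in>X - K. \<bar>u x\<bar> < e))}"

text \<open>
  The reference measure on \<open>closure D\<close> is Lebesgue measure on \<open>D\<close>, extended by 0 to the
  boundary; the Lebesgue measure of \<open>frontier D\<close> itself need not vanish.
\<close>

definition class_D :: "'a::euclidean_space set \<Rightarrow> bool" where
  "class_D D \<longleftrightarrow> domain_set D \<and>
     (\<forall>u\<in>W12 D. \<forall>e>0. \<exists>v\<in>W12 D \<inter> Cc (closure D). W12_norm D (\<lambda>x. u x - v x) < e) \<and>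
     (\<forall>u\<in>C_infty (closure D). \<forall>e>0. \<exists>v\<in>W12 D \<inter> Cc (closure D).
        \<forall>x\<in>closure D. \<bar>u x - v x\<bar> < e)"


section \<open>The \<open>L\<^sup>2\<close>-semigroup of a form\<close>

definition L2_semigroup :: "'a measure \<Rightarrow> (real \<Rightarrow> ('a \<Rightarrow> real) \<Rightarrow> 'a \<Rightarrow> real) \<Rightarrow> bool" where
  "L2_semigroup M T \<longleftrightarrow>
     (\<forall>t\<ge>0. \<forall>f\<in>L2 M. T t f \<in> L2 M \<and> L2_norm M (T t f) \<le> L2_norm M f) \<and>
     (\<forall>t\<ge>0. \<forall>f\<in>L2 M. \<forall>g\<in>L2 M. \<forall>a b.
        AE x in M. T t (\<lambda>y. a * f y + b * g y) x = a * T t f x + b * T t g x) \<and>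
     (\<forall>t\<ge>0. \<forall>f\<in>L2 M. \<forall>g\<in>L2 M. L2_inner M (T t f) g = L2_inner M f (T t g)) \<and>
     (\<forall>f\<in>L2 M. AE x in M. T 0 f x = f x) \<and>
     (\<forall>s\<ge>0. \<forall>t\<ge>0. \<forall>f\<in>L2 M. AE x in M. T (s + t) f x = T s (T t f) x) \<and>
     (\<forall>f\<in>L2 M. ((\<lambda>t. L2_norm M (\<lambda>x. T t f x - f x)) \<longlongrightarrow> 0) (at_right 0))"

definition generator_graph ::
  "'a measure \<Rightarrow> (real \<Rightarrow> ('a \<Rightarrow> real) \<Rightarrow> 'a \<Rightarrow> real) \<Rightarrow> (('a \<Rightarrow> real) \<times> ('a \<Rightarrow> real)) set" where
  "generator_graph M T = {(u, w). u \<in> L2 M \<and> w \<in> L2 M \<and>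
     ((\<lambda>t. L2_norm M (\<lambda>x. (T t u x - u x) / t - w x)) \<longlongrightarrow> 0) (at_right 0)}"

text \<open>
  The semigroup of the form \<open>(E, F)\<close> is the one whose generator \<open>A\<close> is the operator associated
  with the form, i.e. \<open>u\<close> lies in the domain of \<open>A\<close> with \<open>A u = w\<close> iff
  \<open>u \<in> F\<close> and \<open>E(u, v) = (-w, v)\<close> for all \<open>v \<in> F\<close>.
\<close>

definition semigroup_of_form ::
  "'a measure \<Rightarrow> (('a \<Rightarrow> real) \<Rightarrow> ('a \<Rightarrow> real) \<Rightarrow> real) \<Rightarrow> ('a \<Rightarrow> real) set \<Rightarrow>
   (real \<Rightarrow> ('a \<Rightarrow> real) \<Rightarrow> 'a \<Rightarrow> real) \<Rightarrow> bool" where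
  "semigroup_of_form M E F T \<longleftrightarrow> L2_semigroup M T \<and>
     generator_graph M T =
       {(u, w). u \<in> F \<and> w \<in> L2 M \<and> (\<forall>v\<in>F. E u v = - L2_inner M w v)}"


section \<open>Transience\<close>

text \<open>
  \<open>h\<close> is a version of the \<open>L\<^sup>2\<close>-valued integral of \<open>s \<mapsto> T\<^sub>s f\<close> over \<open>[0, t]\<close>, as a limit in
  \<open>L\<^sup>2\<close> of Riemann sums.
\<close>

definition semigroup_integral_L2 ::
  "'a measure \<Rightarrow> (real \<Rightarrow> ('a \<Rightarrow> real) \<Rightarrow> 'a \<Rightarrow> real) \<Rightarrow> real \<Rightarrow> ('a \<Rightarrow> real) \<Rightarrow> ('a \<Rightarrow> real) \<Rightarrow> bool" where
  "semigroup_integral_L2 M T t f h \<longleftrightarrow> h \<in> L2 M \<and>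
     (\<forall>e>0. \<exists>\<delta>>0. \<forall>p. p tagged_division_of {0..t} \<and> (\<lambda>s. ball s \<delta>) fine p \<longrightarrow>
        L2_norm M (\<lambda>x. (\<Sum>(s, K)\<in>p. measure lborel K * T s f x) - h x) < e)"

text \<open>
  \<open>h\<close> is a version of \<open>S\<^sub>t f\<close> for \<open>f \<in> L\<^sup>1\<close>, where \<open>S\<^sub>t\<close> is extended continuously from
  \<open>L\<^sup>1 \<inter> L\<^sup>2\<close>. Distances in \<open>L\<^sup>1\<close> are nonnegative integrals, because the Bochner
  integral of a non-integrable function is 0.
\<close>

definition semigroup_integral_L1 ::
  "'a measure \<Rightarrow> (real \<Rightarrow> ('a \<Rightarrow> real) \<Rightarrow> 'a \<Rightarrow> real) \<Rightarrow> real \<Rightarrow> ('a \<Rightarrow> real) \<Rightarrow> ('a \<Rightarrow> real) \<Rightarrow> bool" where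
  "semigroup_integral_L1 M T t f h \<longleftrightarrow> integrable M f \<and> integrable M h \<and>
     (\<exists>k l. (\<forall>n. integrable M (k n) \<and> k n \<in> L2 M \<and> semigroup_integral_L2 M T t (k n) (l n)) \<and>
        (\<lambda>n. \<integral>\<^sup>+x. ennreal \<bar>k n x - f x\<bar> \<partial>M) \<longlonglongrightarrow> 0 \<and>
        (\<lambda>n. \<integral>\<^sup>+x. ennreal \<bar>l n x - h x\<bar> \<partial>M) \<longlonglongrightarrow> 0)"

definition is_potential ::
  "'a measure \<Rightarrow> (real \<Rightarrow> ('a \<Rightarrow> real) \<Rightarrow> 'a \<Rightarrow> real) \<Rightarrow> ('a \<Rightarrow> real) \<Rightarrow> ('a \<Rightarrow> ereal) \<Rightarrow> bool" where
  "is_potential M T f G \<longleftrightarrow>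
     (\<exists>h. (\<forall>N. semigroup_integral_L1 M T (real N) f (h N)) \<and>
        (AE x in M. (\<lambda>N. ereal (h N x)) \<longlonglongrightarrow> G x))"

definition transient_form ::
  "'a measure \<Rightarrow> (('a \<Rightarrow> real) \<Rightarrow> ('a \<Rightarrow> real) \<Rightarrow> real) \<Rightarrow> ('a \<Rightarrow> real) set \<Rightarrow> bool" where
  "transient_form M E F \<longleftrightarrow>
     (\<exists>T. semigroup_of_form M E F T \<and>
        (\<exists>f G. integrable M f \<and> (AE x in M. f x > 0) \<and>
           is_potential M T f G \<and> (AE x in M. G x < \<infinity>)))"


section \<open>Uniform domains\<close>

definition curve_length :: "(real \<Rightarrow> 'a::metric_space) \<Rightarrow> ereal" where
  "curve_length \<gamma> =
     (SUP (n, t) \<in> {(n :: nat, t :: nat \<Rightarrow> real). mono t \<and> range t \<subseteq> {0..1}}.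
        ereal (\<Sum>k<n. dist (\<gamma> (t k)) (\<gamma> (t (Suc k)))))"

text \<open>Unlike \<open>infdist\<close>, the distance to the empty set is \<open>\<infinity>\<close>.\<close>

definition set_distance :: "'a::metric_space \<Rightarrow> 'a set \<Rightarrow> ereal" where
  "set_distance z S = (INF w\<in>S. ereal (dist z w))"

text \<open>The bound on the length makes the curve rectifiable.\<close>

definition uniform_domain :: "'a::euclidean_space set \<Rightarrow> bool" where
  "uniform_domain U \<longleftrightarrow> domain_set U \<and>
     (\<exists>C>0. \<forall>x\<in>U. \<forall>y\<in>U. \<exists>\<gamma>. path \<gamma> \<and> path_image \<gamma> \<subseteq> U \<and> pathstart \<gamma> = x \<and> pathfinish \<gamma> = y \<and>
        curve_length \<gamma> \<le> ereal (C * dist x y) \<and>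
        (\<forall>z\<in>path_image \<gamma>. ereal (min (dist x z) (dist z y)) \<le> ereal C * set_distance z (- U)))"

end

theory Submission
  imports Defs
begin

text \<open>
  Transience follows from an inequality: if \<open>f > 0\<close> is such that \<open>\<integral> u f \<le> c \<E>(u, u)\<^sup>1\<^sup>/\<^sup>2\<close> for all
  nonnegative \<open>u\<close> in the domain of the form, then the partial potentials \<open>S\<^sub>N f\<close> satisfy
  \<open>\<E>(S\<^sub>N f, S\<^sub>N f) = (f - T\<^sub>N f, S\<^sub>N f) \<le> (f, S\<^sub>N f) \<le> c \<E>(S\<^sub>N f, S\<^sub>N f)\<^sup>1\<^sup>/\<^sup>2\<close>, so that \<open>(f, S\<^sub>N f) \<le> c\<^sup>2\<close>, and
  monotone convergence shows that the potential of \<open>f\<close> is finite almost everywhere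
  (\<open>S_pairing_bound\<close>, \<open>transient_if_green_bound\<close>).

  The weight \<open>f\<close> is a weighted sum of bumps whose balls cover \<open>D\<close> (\<open>green_weight\<close>). Hence it is enough to bound a
  smooth average of \<open>u\<close> over a ball by the norm of \<open>\<nabla>u\<close>. When the centre and the radius of the ball
  vary, the kernel of the average changes by the divergence of a vector field, so moving a ball of radius
  at least \<open>\<rho>\<close> by a distance \<open>\<delta>\<close>, or changing its radius by \<open>\<delta>\<close>, changes the average by at most a multiple of
  \<open>\<delta> \<rho>\<^sup>-\<^sup>d\<^sup>/\<^sup>2 \<parallel>\<nabla>u\<parallel>\<close> (\<open>average_along_segment\<close>). An unbounded uniform domain contains a chain of balls that starts
  anywhere, moves to infinity and passes from radius \<open>c 2\<^sup>k\<close> to radius \<open>c 2\<^sup>k\<^sup>+\<^sup>1\<close> over a distance comparable to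
  \<open>2\<^sup>k\<close> (\<open>uniform_domain_chain\<close>). The averages tend to 0 along the chain since \<open>u \<in> L\<^sup>2\<close>. The changes are at most
  multiples of \<open>2\<^sup>k\<^sup>(\<^sup>1\<^sup>-\<^sup>d\<^sup>/\<^sup>2\<^sup>) \<parallel>\<nabla>u\<parallel>\<close>, which is summable exactly for \<open>d \<ge> 3\<close>. This bounds one average
  (\<open>green_bound_in_uniform_domain\<close>), and connectedness of \<open>D\<close> carries the bound to all balls in \<open>D\<close>
  (\<open>green_bound_everywhere\<close>).

  The semigroup of the form is constructed in an abstract Hilbert space by Yosida approximation, starting from the
  graph of a closed operator (locale \<open>closed_form\<close>). The resolvent minimizes a quadratic functional, so closed convex
  sets onto which one can project without increasing the form are preserved by the resolvent and by the semigroup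
  (\<open>J_invariant\<close>, \<open>T_invariant\<close>). Positivity and the Markov property follow because truncation of the values
  does not increase the \<open>L\<^sup>2\<close> norms of increments \<open>u(x - h) - u(x)\<close>, by which weak derivatives in \<open>L\<^sup>2\<close> are
  characterized (\<open>weak_deriv_contraction\<close>, \<open>T_values\<close>). These properties make the partial potentials
  nonnegative, increasing in \<open>N\<close> and integrable.
\<close>

section \<open>Hilbert spaces\<close>

lemma dot_eq_zero_if_minimal:
  fixes a y :: "'a::real_inner"
  assumes "\<And>t. (norm a)\<^sup>2 \<le> (norm (a - t *\<^sub>R y))\<^sup>2"
  shows "a \<bullet> y = 0"
proof (cases "y = 0")
  case False
  define t where "t = (a \<bullet> y) / (y \<bullet> y)"
  have y: "y \<bullet> y > 0" using False by simp
  have "(norm (a - t *\<^sub>R y))\<^sup>2 = (norm a)\<^sup>2 - 2 * t * (a \<bullet> y) + t\<^sup>2 * (y \<bullet> y)"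
    by (simp add: power2_norm_eq_inner inner_diff inner_commute algebra_simps power2_eq_square[of t])
  also have "\<dots> = (norm a)\<^sup>2 - (a \<bullet> y)\<^sup>2 / (y \<bullet> y)"
    using y by (simp add: t_def field_simps power2_eq_square)
  finally have "(a \<bullet> y)\<^sup>2 / (y \<bullet> y) \<le> 0" using assms[of t] by simp
  then have "(a \<bullet> y)\<^sup>2 \<le> 0" using y by (simp add: divide_le_0_iff)
  then show ?thesis by simp
qed simp

text \<open>Points of a minimizing sequence are close to each other by the parallelogram law, so
  the sequence converges, and its limit is the foot of the perpendicular.\<close>

lemma closed_subspace_projection:
  fixes S :: "'a::{real_inner,complete_space} set"
  assumes S: "closed S" "subspace S"
  obtains p where "p \<in> S" "\<And>y. y \<in> S \<Longrightarrow> (x - p) \<bullet> y = 0"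
proof -
  define D where "D = Inf ((\<lambda>y. (norm (x - y))\<^sup>2) ` S)"
  have ne: "(\<lambda>y. (norm (x - y))\<^sup>2) ` S \<noteq> {}" using subspace_0[OF S(2)] by auto
  have bdd: "bdd_below ((\<lambda>y. (norm (x - y))\<^sup>2) ` S)" by (rule bdd_belowI[of _ 0]) auto
  have D_le: "D \<le> (norm (x - y))\<^sup>2" if "y \<in> S" for y
    unfolding D_def using that bdd by (auto intro: cInf_lower)
  have "\<exists>y\<in>S. (norm (x - y))\<^sup>2 < D + inverse (real (Suc n))" for n
  proof -
    have "Inf ((\<lambda>y. (norm (x - y))\<^sup>2) ` S) < D + inverse (real (Suc n))"
      unfolding D_def by simp
    then show ?thesis using cInf_less_iff[OF ne bdd] by auto
  qed
  then obtain y where y: "\<And>n. y n \<in> S" "\<And>n. (norm (x - y n))\<^sup>2 < D + inverse (real (Suc n))"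
    by metis
  have close: "(norm (y m - y n))\<^sup>2 \<le> 2 * inverse (real (Suc m)) + 2 * inverse (real (Suc n))" for m n
  proof -
    have mid: "(1/2) *\<^sub>R (y m + y n) \<in> S"
      using y(1) S(2) by (simp add: subspace_add subspace_scale)
    have "(norm (y m - y n))\<^sup>2 =
        2 * (norm (x - y m))\<^sup>2 + 2 * (norm (x - y n))\<^sup>2 - 4 * (norm (x - (1/2) *\<^sub>R (y m + y n)))\<^sup>2"
      by (simp add: power2_norm_eq_inner inner_diff inner_add inner_commute algebra_simps)
    also have "\<dots> \<le> 2 * inverse (real (Suc m)) + 2 * inverse (real (Suc n))"
      using D_le[OF mid] y(2)[of m] y(2)[of n] by linarith
    finally show ?thesis .
  qed
  have "Cauchy y"
  proof (rule metric_CauchyI)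
    fix e :: real assume "e > 0"
    then obtain N where N: "inverse (real (Suc N)) < e\<^sup>2 / 4"
      using reals_Archimedean[of "e\<^sup>2 / 4"] by auto
    show "\<exists>M. \<forall>m\<ge>M. \<forall>n\<ge>M. dist (y m) (y n) < e"
    proof (intro exI allI impI)
      fix m n assume "m \<ge> N" "n \<ge> N"
      then have "inverse (real (Suc m)) \<le> inverse (real (Suc N))"
        "inverse (real (Suc n)) \<le> inverse (real (Suc N))" by (auto simp: field_simps)
      then have "(norm (y m - y n))\<^sup>2 < e\<^sup>2" using close[of m n] N by linarith
      then show "dist (y m) (y n) < e"
        using \<open>e > 0\<close> by (simp add: dist_norm power_less_imp_less_base)
    qed
  qed
  then obtain p where p: "y \<longlonglongrightarrow> p" using Cauchy_convergent convergent_def by blast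
  have pS: "p \<in> S" using closed_sequentially[OF S(1)] y(1) p by blast
  have "(\<lambda>n. D + inverse (real (Suc n))) \<longlonglongrightarrow> D + 0"
    by (intro tendsto_intros LIMSEQ_inverse_real_of_nat)
  moreover have "(\<lambda>n. (norm (x - y n))\<^sup>2) \<longlonglongrightarrow> (norm (x - p))\<^sup>2"
    by (intro tendsto_intros p)
  ultimately have pD: "(norm (x - p))\<^sup>2 \<le> D"
    using LIMSEQ_le[of _ _ _ "D + 0"] y(2) by (metis (no_types, lifting) add.right_neutral less_imp_le)
  show ?thesis
  proof (rule that[OF pS])
    fix z assume "z \<in> S"
    show "(x - p) \<bullet> z = 0"
    proof (rule dot_eq_zero_if_minimal)
      fix t
      have "p + t *\<^sub>R z \<in> S" using pS \<open>z \<in> S\<close> S(2) by (simp add: subspace_add subspace_scale)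
      then have "(norm (x - p))\<^sup>2 \<le> (norm (x - (p + t *\<^sub>R z)))\<^sup>2"
        using D_le[of "p + t *\<^sub>R z"] pD by linarith
      then show "(norm (x - p))\<^sup>2 \<le> (norm (x - p - t *\<^sub>R z))\<^sup>2"
        by (simp only: diff_diff_eq)
    qed
  qed
qed

lemma subspace_closure:
  fixes S :: "'a::real_normed_vector set"
  assumes "subspace S"
  shows "subspace (closure S)"
proof (rule subspaceI)
  show "0 \<in> closure S" using assms closure_subset subspace_0 by blast
next
  fix x y assume "x \<in> closure S" "y \<in> closure S"
  then obtain a b where "\<And>n. a n \<in> S" "a \<longlonglongrightarrow> x" "\<And>n. b n \<in> S" "b \<longlonglongrightarrow> y"
    unfolding closure_sequential by blast
  then show "x + y \<in> closure S" unfolding closure_sequential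
    by (intro exI[of _ "\<lambda>n. a n + b n"]) (auto intro: tendsto_add subspace_add[OF assms])
next
  fix c x assume "x \<in> closure S"
  then obtain a where "\<And>n. a n \<in> S" "a \<longlonglongrightarrow> x"
    unfolding closure_sequential by blast
  then show "c *\<^sub>R x \<in> closure S" unfolding closure_sequential
    by (intro exI[of _ "\<lambda>n. c *\<^sub>R a n"]) (auto intro: tendsto_scaleR subspace_scale[OF assms])
qed

lemma dense_if_orthogonal_complement_trivial:
  fixes S :: "'a::{real_inner,complete_space} set"
  assumes "subspace S" and "\<And>x. (\<And>y. y \<in> S \<Longrightarrow> x \<bullet> y = 0) \<Longrightarrow> x = 0"
  shows "closure S = UNIV"
proof -
  have "x \<in> closure S" for x
  proof -
    obtain p where p: "p \<in> closure S" "\<And>y. y \<in> closure S \<Longrightarrow> (x - p) \<bullet> y = 0"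
      by (rule closed_subspace_projection[OF closed_closure subspace_closure[OF assms(1)], of x]) blast
    have "x - p = 0" using p(2) closure_subset by (intro assms(2)) blast
    then show ?thesis using p(1) by simp
  qed
  then show ?thesis by auto
qed

text \<open>The Riesz representation theorem for a functional given by its graph \<open>G\<close>, as happens when it is
  defined on representatives of classes. The closure of \<open>G\<close> is a closed subspace of the product with
  \<open>\<real>\<close>, and the representing vector is read off from the projection of \<open>(0, 1)\<close> onto it.\<close>

lemma Riesz_relation:
  fixes G :: "('a::{real_inner,complete_space} \<times> real) set"
  assumes G: "subspace G" and C: "0 \<le> C" and bound: "\<And>x t. (x, t) \<in> G \<Longrightarrow> \<bar>t\<bar> \<le> C * norm x"
  obtains g where "\<And>x t. (x, t) \<in> G \<Longrightarrow> t = g \<bullet> x" "norm g \<le> C"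
proof -
  have bG: "\<bar>snd z\<bar> \<le> C * norm (fst z)" if "z \<in> closure G" for z
  proof -
    have "closed {z :: 'a \<times> real. \<bar>snd z\<bar> \<le> C * norm (fst z)}"
      by (intro closed_Collect_le continuous_intros)
    moreover have "G \<subseteq> {z. \<bar>snd z\<bar> \<le> C * norm (fst z)}" using bound by auto
    ultimately show ?thesis using closure_minimal that by blast
  qed
  obtain p where p: "p \<in> closure G" "\<And>y. y \<in> closure G \<Longrightarrow> ((0, 1) - p) \<bullet> y = 0"
    by (rule closed_subspace_projection[OF closed_closure subspace_closure[OF G], of "(0, 1)"]) blast
  define q where "q = fst p"
  define t where "t = snd p"
  have pqt: "p = (q, t)" by (simp add: q_def t_def)
  have orth: "(1 - t) * s = q \<bullet> x" if "(x, s) \<in> closure G" for x s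
    using p(2)[OF that] by (simp add: pqt inner_Pair inner_diff_left algebra_simps)
  have qq: "q \<bullet> q = (1 - t) * t" using orth[of q t] p(1) by (simp add: pqt)
  have t1: "t \<noteq> 1"
  proof
    assume "t = 1"
    then have "q = 0" using qq by simp
    then show False using bG[OF p(1)] \<open>t = 1\<close> by (simp add: pqt)
  qed
  define g where "g = (1 / (1 - t)) *\<^sub>R q"
  have "s = g \<bullet> x" if "(x, s) \<in> G" for x s
    using orth[OF subsetD[OF closure_subset that]] t1 by (simp add: g_def field_simps)
  moreover have "norm g \<le> C"
  proof (cases "q = 0")
    case False
    have "(norm q)\<^sup>2 = (1 - t) * t" using qq by (simp add: power2_norm_eq_inner)
    then have "(norm q)\<^sup>2 \<le> \<bar>1 - t\<bar> * \<bar>t\<bar>" by (metis abs_ge_self abs_mult)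
    also have "\<dots> \<le> \<bar>1 - t\<bar> * (C * norm q)"
      using bG[OF p(1)] by (intro mult_left_mono) (auto simp: pqt)
    finally have "norm q * norm q \<le> (\<bar>1 - t\<bar> * C) * norm q" by (simp add: power2_eq_square mult.assoc)
    then have "norm q \<le> \<bar>1 - t\<bar> * C" using False by simp
    then show ?thesis using t1 by (simp add: g_def field_simps)
  qed (use C in \<open>simp add: g_def\<close>)
  ultimately show ?thesis by (rule that)
qed

section \<open>The Banach algebra of bounded operators\<close>

text \<open>Bounded operators on a space form a Banach algebra. Making them a type of their own gives
  access to the exponential series and its functional equation.\<close>

typedef (overloaded) 'a endo = "UNIV :: ('a::real_normed_vector \<Rightarrow>\<^sub>L 'a) set" by simp

setup_lifting type_definition_endo

lift_definition app :: "'a::real_normed_vector endo \<Rightarrow> 'a \<Rightarrow> 'a" is blinfun_apply .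

instantiation endo :: ("{real_normed_vector,perfect_space}") real_normed_algebra_1
begin

lift_definition zero_endo :: "'a endo" is 0 .
lift_definition one_endo :: "'a endo" is id_blinfun .
lift_definition plus_endo :: "'a endo \<Rightarrow> 'a endo \<Rightarrow> 'a endo" is "(+)" .
lift_definition minus_endo :: "'a endo \<Rightarrow> 'a endo \<Rightarrow> 'a endo" is "(-)" .
lift_definition uminus_endo :: "'a endo \<Rightarrow> 'a endo" is uminus .
lift_definition times_endo :: "'a endo \<Rightarrow> 'a endo \<Rightarrow> 'a endo" is "(o\<^sub>L)" .
lift_definition scaleR_endo :: "real \<Rightarrow> 'a endo \<Rightarrow> 'a endo" is "(*\<^sub>R)" .
lift_definition norm_endo :: "'a endo \<Rightarrow> real" is norm .
lift_definition dist_endo :: "'a endo \<Rightarrow> 'a endo \<Rightarrow> real" is dist .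

definition sgn_endo :: "'a endo \<Rightarrow> 'a endo" where "sgn_endo x = scaleR (inverse (norm x)) x"
definition uniformity_endo :: "('a endo \<times> 'a endo) filter" where
  "uniformity_endo = (INF e\<in>{0<..}. principal {(x, y). dist x y < e})"
definition open_endo :: "'a endo set \<Rightarrow> bool" where
  "open_endo S = (\<forall>x\<in>S. \<forall>\<^sub>F (x', y) in uniformity. x' = x \<longrightarrow> y \<in> S)"

instance
proof
  fix a b c :: "'a endo" and r s :: real
  show "a + b + c = a + (b + c)" by transfer simp
  show "a + b = b + a" by transfer simp
  show "0 + a = a" by transfer simp
  show "- a + a = 0" by transfer simp
  show "a - b = a + - b" by transfer simp
  show "r *\<^sub>R (a + b) = r *\<^sub>R a + r *\<^sub>R b" by transfer (rule scaleR_add_right)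
  show "(r + s) *\<^sub>R a = r *\<^sub>R a + s *\<^sub>R a" by transfer (rule scaleR_add_left)
  show "r *\<^sub>R s *\<^sub>R a = (r * s) *\<^sub>R a" by transfer simp
  show "1 *\<^sub>R a = a" by transfer simp
  show "a * b * c = a * (b * c)" by transfer (auto intro!: blinfun_eqI)
  show "(a + b) * c = a * c + b * c" by transfer (auto intro!: blinfun_eqI simp: blinfun.bilinear_simps)
  show "a * (b + c) = a * b + a * c" by transfer (auto intro!: blinfun_eqI simp: blinfun.bilinear_simps)
  show "r *\<^sub>R a * b = r *\<^sub>R (a * b)" by transfer (auto intro!: blinfun_eqI simp: blinfun.bilinear_simps)
  show "a * r *\<^sub>R b = r *\<^sub>R (a * b)" by transfer (auto intro!: blinfun_eqI simp: blinfun.bilinear_simps)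
  show "1 * a = a" by transfer (auto intro!: blinfun_eqI)
  show "a * 1 = a" by transfer (auto intro!: blinfun_eqI)
  show "(0::'a endo) \<noteq> 1"
  proof transfer
    show "(0::'a \<Rightarrow>\<^sub>L 'a) \<noteq> id_blinfun"
      using norm_blinfun_id[where 'a='a] by (metis norm_zero zero_neq_one)
  qed
  show "dist a b = norm (a - b)" by transfer (rule dist_norm)
  show "norm a = 0 \<longleftrightarrow> a = 0" by transfer simp
  show "norm (a + b) \<le> norm a + norm b" by transfer (rule norm_triangle_ineq)
  show "norm (r *\<^sub>R a) = \<bar>r\<bar> * norm a" by transfer simp
  show "norm (a * b) \<le> norm a * norm b" by transfer (rule norm_blinfun_compose)
  show "norm (1::'a endo) = 1" by transfer simp
  show "sgn a = inverse (norm a) *\<^sub>R a" by (rule sgn_endo_def)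
  show "uniformity = (INF e\<in>{0<..}. principal {(x, y::'a endo). dist x y < e})"
    by (rule uniformity_endo_def)
  show "open S = (\<forall>x\<in>S. \<forall>\<^sub>F (x', y) in uniformity. x' = x \<longrightarrow> y \<in> S)" for S :: "'a endo set"
    by (rule open_endo_def)
qed

end

instance endo :: ("{banach,perfect_space}") banach
proof
  fix X :: "nat \<Rightarrow> 'a endo" assume "Cauchy X"
  then have "Cauchy (\<lambda>n. Rep_endo (X n))"
    unfolding Cauchy_def by (simp add: dist_endo.rep_eq)
  then obtain l where "(\<lambda>n. Rep_endo (X n)) \<longlonglongrightarrow> l"
    using Cauchy_convergent convergent_def by blast
  then have "X \<longlonglongrightarrow> Abs_endo l"
    unfolding lim_sequentially by (simp add: dist_endo.rep_eq Abs_endo_inverse)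
  then show "convergent X" unfolding convergent_def by blast
qed

lemma app_simps [simp]:
  fixes A B :: "'a::{real_normed_vector,perfect_space} endo"
  shows "app 1 f = f" "app 0 f = 0" "app (A * B) f = app A (app B f)"
    "app (A + B) f = app A f + app B f" "app (A - B) f = app A f - app B f" "app (- A) f = - app A f"
    "app (r *\<^sub>R A) f = r *\<^sub>R app A f"
  by (transfer; simp add: blinfun.bilinear_simps)+

lemma norm_app: "norm (app A f) \<le> norm A * norm f"
  for A :: "'a::{real_normed_vector,perfect_space} endo"
  by transfer (rule norm_blinfun)

lemma app_bounded_linear: "bounded_linear (app A)"
  for A :: "'a::{real_normed_vector,perfect_space} endo"
  by transfer (rule blinfun.bounded_linear_right)

lemma bounded_linear_app_left: "bounded_linear (\<lambda>A :: 'a::{real_normed_vector,perfect_space} endo. app A f)"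
  by (rule bounded_linear_intro[of _ "norm f"]) (auto simp: norm_app mult.commute[of "norm f"])

lemma endo_eqI: "(\<And>f. app A f = app B f) \<Longrightarrow> A = B"
  by transfer (rule blinfun_eqI)

lemma endo_of_bounded_linear:
  fixes F :: "'a::{real_normed_vector,perfect_space} \<Rightarrow> 'a"
  assumes "linear F" "\<And>x. norm (F x) \<le> norm x"
  obtains A where "\<And>f. app A f = F f" "norm A \<le> 1"
proof -
  have bl: "bounded_linear F"
    using assms by (intro bounded_linear_intro[of _ 1]) (auto simp: linear_add linear_scale)
  define A where "A = Abs_endo (Blinfun F)"
  have "app A f = F f" for f
    unfolding A_def app.rep_eq Abs_endo_inverse[OF UNIV_I] using bl by (simp add: bounded_linear_Blinfun_apply)
  moreover have "norm A \<le> 1"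
    unfolding A_def norm_endo.rep_eq Abs_endo_inverse[OF UNIV_I]
    by (rule norm_blinfun_bound) (use bl assms in \<open>auto simp: bounded_linear_Blinfun_apply\<close>)
  ultimately show ?thesis using that by blast
qed

lemma app_exp_sums:
  fixes A :: "'a::{banach,perfect_space} endo"
  shows "(\<lambda>n. (s ^ n / fact n) *\<^sub>R app (A ^ n) f) sums app (exp (s *\<^sub>R A)) f"
  using bounded_linear.sums[OF bounded_linear_app_left[of f] exp_converges[of "s *\<^sub>R A"]]
  by (simp add: scaleR_power divide_inverse mult.commute)

lemma exp_commute:
  fixes A B :: "'a::{real_normed_algebra_1,banach}"
  assumes "A * B = B * A" shows "exp A * B = B * exp A"
proof -
  have "(\<lambda>n. (A ^ n /\<^sub>R fact n) * B) sums (exp A * B)"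
    by (rule sums_mult2[OF exp_converges])
  moreover have "(\<lambda>n. B * (A ^ n /\<^sub>R fact n)) sums (B * exp A)"
    by (rule sums_mult[OF exp_converges])
  moreover have "(A ^ n /\<^sub>R fact n) * B = B * (A ^ n /\<^sub>R fact n)" for n
    using power_commuting_commutes[OF assms, of n] by simp
  ultimately show ?thesis using sums_unique2 by fastforce
qed

lemma norm_diff_le_if_vector_derivative_bounded:
  fixes f :: "real \<Rightarrow> 'a::real_normed_vector"
  assumes "a \<le> b" and D: "\<And>x. x \<in> {a..b} \<Longrightarrow> (f has_vector_derivative f' x) (at x within {a..b})"
    and B: "\<And>x. x \<in> {a..b} \<Longrightarrow> norm (f' x) \<le> B"
  shows "norm (f b - f a) \<le> B * (b - a)"
proof -
  have "norm (f b - f a) \<le> B * norm (b - a)"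
  proof (rule differentiable_bound[of "{a..b}"])
    show "(f has_derivative (\<lambda>h. h *\<^sub>R f' x)) (at x within {a..b})" if "x \<in> {a..b}" for x
      using D[OF that] by (simp add: has_vector_derivative_def)
    show "onorm (\<lambda>h. h *\<^sub>R f' x) \<le> B" if "x \<in> {a..b}" for x
      using B[OF that] by (intro onorm_le) (simp add: mult.commute[of B] mult_left_mono)
  qed (use assms in auto)
  then show ?thesis using assms(1) by simp
qed

text \<open>Interpolating between two commuting semigroups compares them through their generators.\<close>

lemma commuting_exp_compare:
  fixes X Y :: "'a::{banach,perfect_space} endo"
  assumes XY: "X * Y = Y * X" and t: "0 \<le> t"
    and nX: "\<And>s. 0 \<le> s \<Longrightarrow> norm (exp (s *\<^sub>R X)) \<le> 1" and nY: "\<And>s. 0 \<le> s \<Longrightarrow> norm (exp (s *\<^sub>R Y)) \<le> 1"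
  shows "norm (app (exp (t *\<^sub>R X)) f - app (exp (t *\<^sub>R Y)) f) \<le> t * norm (app X f - app Y f)"
proof -
  define g where "g r = app (exp (r *\<^sub>R (X - Y)) * exp (t *\<^sub>R Y)) f" for r
  define g' where "g' r = app (exp (r *\<^sub>R (X - Y)) * (X - Y) * exp (t *\<^sub>R Y)) f" for r
  have split: "exp (r *\<^sub>R (X - Y)) * exp (t *\<^sub>R Y) = exp (r *\<^sub>R X) * exp ((t - r) *\<^sub>R Y)" for r
  proof -
    have "exp (r *\<^sub>R (X - Y)) * exp (t *\<^sub>R Y) = exp (r *\<^sub>R (X - Y) + t *\<^sub>R Y)"
      by (rule exp_add_commuting[symmetric]) (simp add: algebra_simps XY)
    also have "\<dots> = exp (r *\<^sub>R X + (t - r) *\<^sub>R Y)" by (simp add: algebra_simps)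
    also have "\<dots> = exp (r *\<^sub>R X) * exp ((t - r) *\<^sub>R Y)"
      by (rule exp_add_commuting) (simp add: XY)
    finally show ?thesis .
  qed
  have "norm (g t - g 0) \<le> norm (app X f - app Y f) * (t - 0)"
  proof (rule norm_diff_le_if_vector_derivative_bounded[OF t])
    fix r assume r: "r \<in> {0..t}"
    have "((\<lambda>r. exp (r *\<^sub>R (X - Y)) * exp (t *\<^sub>R Y)) has_vector_derivative
        (exp (r *\<^sub>R (X - Y)) * (X - Y)) * exp (t *\<^sub>R Y)) (at r within {0..t})"
      by (rule bounded_linear.has_vector_derivative[OF bounded_linear_mult_left
            exp_scaleR_has_vector_derivative_right])
    then show "(g has_vector_derivative g' r) (at r within {0..t})"
      unfolding g_def g'_def
      by (rule bounded_linear.has_vector_derivative[OF bounded_linear_app_left])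
    have "exp (t *\<^sub>R Y) * (X - Y) = (X - Y) * exp (t *\<^sub>R Y)"
      by (rule exp_commute) (simp add: algebra_simps XY)
    then have "g' r = app (exp (r *\<^sub>R X) * exp ((t - r) *\<^sub>R Y)) (app X f - app Y f)"
      unfolding g'_def split[symmetric] by (metis app_simps(3) app_simps(5) mult.assoc)
    also have "norm \<dots> \<le> norm (exp (r *\<^sub>R X) * exp ((t - r) *\<^sub>R Y)) * norm (app X f - app Y f)"
      by (rule norm_app)
    also have "\<dots> \<le> 1 * norm (app X f - app Y f)"
    proof (rule mult_right_mono)
      have "norm (exp (r *\<^sub>R X) * exp ((t - r) *\<^sub>R Y)) \<le>
          norm (exp (r *\<^sub>R X)) * norm (exp ((t - r) *\<^sub>R Y))" by (rule norm_mult_ineq)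
      also have "\<dots> \<le> 1 * 1" by (rule mult_mono) (use r nX nY in auto)
      finally show "norm (exp (r *\<^sub>R X) * exp ((t - r) *\<^sub>R Y)) \<le> 1" by simp
    qed simp
    finally show "norm (g' r) \<le> norm (app X f - app Y f)" by simp
  qed
  moreover have "g t = app (exp (t *\<^sub>R X)) f" unfolding g_def split by simp
  moreover have "g 0 = app (exp (t *\<^sub>R Y)) f" unfolding g_def by simp
  ultimately show ?thesis by (simp add: mult.commute)
qed

section \<open>The semigroup of a closed form\<close>

lemma divide_times_le_self:
  fixes c x :: real
  assumes "0 \<le> c" "0 \<le> x" shows "c / (x + 1) * x \<le> c"
proof -
  have "c * (x / (x + 1)) \<le> c * 1" using assms by (intro mult_left_mono) auto
  then show ?thesis by simp
qed

text \<open>A closed operator \<open>B\<close> enters through its graph \<open>\<Gamma>\<close>; the form is \<open>\<langle>Bu, Bv\<rangle>\<close>. With the form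
  written in this way, its resolvent is an orthogonal projection in the product space.\<close>

locale closed_form =
  fixes \<Gamma> :: "('h::{real_inner,banach,perfect_space} \<times> 'k::{real_inner,complete_space}) set"
  assumes closed_graph: "closed \<Gamma>" and subspace_graph: "subspace \<Gamma>"
    and dense_domain: "closure (fst ` \<Gamma>) = UNIV"
begin

text \<open>The graph of the nonnegative operator \<open>L = B\<^sup>*B\<close>: here \<open>w = Bu\<close> and \<open>p = Lu\<close>.\<close>

definition L_rel :: "'h \<Rightarrow> 'h \<Rightarrow> bool" where
  "L_rel u p \<longleftrightarrow> (\<exists>w. (u, w) \<in> \<Gamma> \<and> (\<forall>(v, z)\<in>\<Gamma>. w \<bullet> z = p \<bullet> v))"

lemma graph_add: "(u, w) \<in> \<Gamma> \<Longrightarrow> (v, z) \<in> \<Gamma> \<Longrightarrow> (u + v, w + z) \<in> \<Gamma>"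
  using subspace_add[OF subspace_graph, of "(u, w)" "(v, z)"] by simp

lemma graph_scale: "(u, w) \<in> \<Gamma> \<Longrightarrow> (c *\<^sub>R u, c *\<^sub>R w) \<in> \<Gamma>"
  using subspace_scale[OF subspace_graph, of "(u, w)" c] by simp

lemma L_relI:
  assumes "(u, w) \<in> \<Gamma>" "\<And>v z. (v, z) \<in> \<Gamma> \<Longrightarrow> w \<bullet> z = p \<bullet> v" shows "L_rel u p"
  unfolding L_rel_def using assms by blast

lemma L_relE:
  assumes "L_rel u p"
  obtains w where "(u, w) \<in> \<Gamma>" "\<And>v z. (v, z) \<in> \<Gamma> \<Longrightarrow> w \<bullet> z = p \<bullet> v"
  using assms unfolding L_rel_def by blast

lemma L_rel_add: assumes "L_rel u p" "L_rel v q" shows "L_rel (u + v) (p + q)"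
proof (rule L_relE[OF assms(1)], rule L_relE[OF assms(2)])
  fix w z assume *: "(u, w) \<in> \<Gamma>" "\<And>v z. (v, z) \<in> \<Gamma> \<Longrightarrow> w \<bullet> z = p \<bullet> v"
    "(v, z) \<in> \<Gamma>" "\<And>x y. (x, y) \<in> \<Gamma> \<Longrightarrow> z \<bullet> y = q \<bullet> x"
  show ?thesis
    by (rule L_relI[OF graph_add[OF *(1,3)]]) (simp add: inner_add_left *(2,4))
qed

lemma L_rel_scale: assumes "L_rel u p" shows "L_rel (c *\<^sub>R u) (c *\<^sub>R p)"
proof (rule L_relE[OF assms])
  fix w assume *: "(u, w) \<in> \<Gamma>" "\<And>v z. (v, z) \<in> \<Gamma> \<Longrightarrow> w \<bullet> z = p \<bullet> v"
  show ?thesis by (rule L_relI[OF graph_scale[OF *(1)]]) (simp add: *(2))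
qed

lemma L_rel_diff: assumes "L_rel u p" "L_rel v q" shows "L_rel (u - v) (p - q)"
  using L_rel_add[OF assms(1) L_rel_scale[OF assms(2), of "-1"]] by simp

lemma L_rel_nonneg: "L_rel u p \<Longrightarrow> 0 \<le> p \<bullet> u"
proof -
  assume "L_rel u p"
  then obtain w where "(u, w) \<in> \<Gamma>" "\<And>v z. (v, z) \<in> \<Gamma> \<Longrightarrow> w \<bullet> z = p \<bullet> v"
    by (rule L_relE) blast
  then show ?thesis by (metis inner_ge_zero)
qed

lemma L_rel_sym: "L_rel u p \<Longrightarrow> L_rel v q \<Longrightarrow> p \<bullet> v = u \<bullet> q"
proof -
  assume "L_rel u p" "L_rel v q"
  then obtain w z where "(u, w) \<in> \<Gamma>" "\<And>v z. (v, z) \<in> \<Gamma> \<Longrightarrow> w \<bullet> z = p \<bullet> v"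
    "(v, z) \<in> \<Gamma>" "\<And>u w. (u, w) \<in> \<Gamma> \<Longrightarrow> z \<bullet> w = q \<bullet> u"
    by (meson L_relE)
  then show ?thesis by (metis inner_commute)
qed

text \<open>Rescaling the second component turns \<open>\<Gamma>\<close> into a closed subspace onto which \<open>(f, 0)\<close> is projected;
  the orthogonality relation of the projection is the resolvent equation for its first component.\<close>

lemma resolvent_exists:
  assumes a: "a > 0"
  shows "\<exists>u p. L_rel u p \<and> u + a *\<^sub>R p = f"
proof -
  define S where "S = (\<lambda>(x, y). (x, (1 / sqrt a) *\<^sub>R y)) -` \<Gamma>"
  have sa: "sqrt a > 0" using a by simp
  have "closed S" unfolding S_def
    by (intro closed_vimage closed_graph) (auto simp: case_prod_beta intro!: continuous_intros)
  moreover have "subspace S"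
  proof (rule subspaceI)
    show "0 \<in> S" using subspace_0[OF subspace_graph] by (simp add: S_def zero_prod_def)
    show "x + y \<in> S" if "x \<in> S" "y \<in> S" for x y
      using that graph_add by (auto simp: S_def case_prod_beta scaleR_add_right)
    show "c *\<^sub>R x \<in> S" if "x \<in> S" for c x
      using that graph_scale[of "fst x" "(1 / sqrt a) *\<^sub>R snd x" c]
      by (simp add: S_def case_prod_beta)
  qed
  ultimately obtain x where x: "x \<in> S" "\<And>y. y \<in> S \<Longrightarrow> ((f, 0) - x) \<bullet> y = 0"
    by (rule closed_subspace_projection[of S "(f, 0)"]) blast
  define u where "u = fst x"
  define w where "w = (1 / sqrt a) *\<^sub>R snd x"
  have uw: "(u, w) \<in> \<Gamma>" using x(1) by (auto simp: S_def u_def w_def case_prod_beta)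
  have sx: "snd x = sqrt a *\<^sub>R w" using sa by (simp add: w_def)
  have "w \<bullet> z = ((1 / a) *\<^sub>R (f - u)) \<bullet> v" if "(v, z) \<in> \<Gamma>" for v z
  proof -
    have "(v, sqrt a *\<^sub>R z) \<in> S" using that sa by (simp add: S_def)
    from x(2)[OF this] have "(f - u) \<bullet> v - sqrt a * (sqrt a * (w \<bullet> z)) = 0"
      by (simp add: inner_prod_def u_def sx)
    moreover have "sqrt a * (sqrt a * (w \<bullet> z)) = a * (w \<bullet> z)"
      using a by (metis mult.assoc real_sqrt_mult_self abs_of_pos)
    ultimately have "w \<bullet> z = (1 / a) * ((f - u) \<bullet> v)" using a by (simp add: field_simps)
    then show ?thesis by (simp only: inner_scaleR_left)
  qed
  then have "L_rel u ((1 / a) *\<^sub>R (f - u))" by (rule L_relI[OF uw])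
  moreover have "u + a *\<^sub>R ((1 / a) *\<^sub>R (f - u)) = f" using a by simp
  ultimately show ?thesis by blast
qed

lemma resolvent_unique_0:
  assumes "a > 0" "L_rel u p" "u + a *\<^sub>R p = 0"
  shows "u = 0"
proof -
  have "u \<bullet> u + a * (p \<bullet> u) = 0"
    using arg_cong[OF assms(3), of "\<lambda>x. x \<bullet> u"] by (simp add: inner_add_left)
  moreover have "0 \<le> a * (p \<bullet> u)" using L_rel_nonneg[OF assms(2)] assms(1) by simp
  ultimately show ?thesis using inner_ge_zero[of u] by (metis add_nonneg_eq_0_iff inner_eq_zero_iff)
qed

text \<open>\<open>J a\<close> is the resolvent \<open>(1 + a L)\<^sup>-\<^sup>1\<close>.\<close>

definition J :: "real \<Rightarrow> 'h \<Rightarrow> 'h" where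
  "J a f = (SOME u. \<exists>p. L_rel u p \<and> u + a *\<^sub>R p = f)"

lemma J_rel: assumes "a > 0" obtains p where "L_rel (J a f) p" "J a f + a *\<^sub>R p = f"
  using someI_ex[OF resolvent_exists[OF assms, of f]] unfolding J_def by blast

lemma J_unique:
  assumes "a > 0" "L_rel u p" "u + a *\<^sub>R p = f" shows "J a f = u"
proof -
  obtain q where q: "L_rel (J a f) q" "J a f + a *\<^sub>R q = f" using J_rel[OF assms(1)] .
  have "J a f - u = 0"
  proof (rule resolvent_unique_0[OF assms(1) L_rel_diff[OF q(1) assms(2)]])
    have "J a f - u + a *\<^sub>R (q - p) = (J a f + a *\<^sub>R q) - (u + a *\<^sub>R p)"
      by (simp add: algebra_simps)
    then show "J a f - u + a *\<^sub>R (q - p) = 0" by (simp only: q(2) assms(3) diff_self)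
  qed
  then show ?thesis by simp
qed

lemma J_linear: "a > 0 \<Longrightarrow> linear (J a)"
proof (rule linearI)
  fix f g assume a: "a > 0"
  obtain p where p: "L_rel (J a f) p" "J a f + a *\<^sub>R p = f" using J_rel[OF a] .
  obtain q where q: "L_rel (J a g) q" "J a g + a *\<^sub>R q = g" using J_rel[OF a] .
  show "J a (f + g) = J a f + J a g"
  proof (rule J_unique[OF a L_rel_add[OF p(1) q(1)]])
    have "J a f + J a g + a *\<^sub>R (p + q) = (J a f + a *\<^sub>R p) + (J a g + a *\<^sub>R q)"
      by (simp add: algebra_simps)
    then show "J a f + J a g + a *\<^sub>R (p + q) = f + g" by (simp only: p(2) q(2))
  qed
next
  fix c f assume a: "a > 0"
  obtain p where p: "L_rel (J a f) p" "J a f + a *\<^sub>R p = f" using J_rel[OF a] .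
  show "J a (c *\<^sub>R f) = c *\<^sub>R J a f"
    by (rule J_unique[OF a L_rel_scale[OF p(1)]])
      (metis p(2) scaleR_add_right scaleR_left_commute)
qed

lemma J_contraction: assumes a: "a > 0" shows "norm (J a f) \<le> norm f"
proof -
  obtain p where p: "L_rel (J a f) p" "J a f + a *\<^sub>R p = f" using J_rel[OF a] .
  have "J a f \<bullet> J a f + a * (p \<bullet> J a f) = f \<bullet> J a f"
    using arg_cong[OF p(2), of "\<lambda>x. x \<bullet> J a f"] by (simp add: inner_add_left)
  moreover have "0 \<le> a * (p \<bullet> J a f)" using L_rel_nonneg[OF p(1)] a by simp
  ultimately have "J a f \<bullet> J a f \<le> f \<bullet> J a f" by linarith
  also have "\<dots> \<le> norm f * norm (J a f)" by (rule norm_cauchy_schwarz)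
  finally show ?thesis
    by (cases "norm (J a f) = 0") (auto simp: power2_norm_eq_inner[symmetric] power2_eq_square)
qed

lemma J_sym: assumes a: "a > 0" shows "J a f \<bullet> g = f \<bullet> J a g"
proof -
  obtain p where p: "L_rel (J a f) p" "J a f + a *\<^sub>R p = f" using J_rel[OF a] .
  obtain q where q: "L_rel (J a g) q" "J a g + a *\<^sub>R q = g" using J_rel[OF a] .
  have "J a f \<bullet> (J a g + a *\<^sub>R q) = (J a f + a *\<^sub>R p) \<bullet> J a g"
    using L_rel_sym[OF p(1) q(1)] by (simp add: inner_add)
  then show ?thesis by (simp only: p(2) q(2))
qed

lemma J_of_range: assumes "a > 0" "L_rel f p" shows "J a f = f - a *\<^sub>R J a p"
proof -
  have "J a (f + a *\<^sub>R p) = f" by (rule J_unique[OF assms]) simp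
  then show ?thesis by (simp add: linear_add[OF J_linear] linear_scale[OF J_linear] assms(1) algebra_simps)
qed

text \<open>Both sides solve \<open>(1 + a L) (1 + b L) u = f\<close>.\<close>

lemma J_commute: assumes a: "a > 0" "b > 0" shows "J a (J b f) = J b (J a f)"
proof -
  define u where "u = J b (J a f)"
  obtain p where p: "L_rel (J a f) p" "J a f + a *\<^sub>R p = f" using J_rel[OF a(1)] .
  obtain q where q: "L_rel u q" "u + b *\<^sub>R q = J a f" using J_rel[OF a(2)] unfolding u_def by blast
  have "L_rel ((1 / b) *\<^sub>R (J a f - u)) ((1 / b) *\<^sub>R (p - q))"
    by (intro L_rel_scale L_rel_diff p(1) q(1))
  moreover have "(1 / b) *\<^sub>R (J a f - u) = q" using a by (simp add: q(2)[symmetric])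
  ultimately have r: "L_rel q ((1 / b) *\<^sub>R (p - q))" by simp
  have "J b f = u + a *\<^sub>R q"
  proof (rule J_unique[OF a(2)])
    show "L_rel (u + a *\<^sub>R q) (q + a *\<^sub>R ((1 / b) *\<^sub>R (p - q)))"
      by (intro L_rel_add L_rel_scale q(1) r)
    have "u + a *\<^sub>R q + b *\<^sub>R (q + a *\<^sub>R ((1 / b) *\<^sub>R (p - q))) = (u + b *\<^sub>R q) + a *\<^sub>R p"
      using a by (simp add: algebra_simps)
    then show "u + a *\<^sub>R q + b *\<^sub>R (q + a *\<^sub>R ((1 / b) *\<^sub>R (p - q))) = f" by (simp only: q(2) p(2))
  qed
  then have "J a (J b f) = u" using J_unique[OF a(1) q(1)] by simp
  then show ?thesis by (simp add: u_def)
qed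

text \<open>The resolvent is the minimizer of \<open>\<parallel>v - f\<parallel>\<^sup>2 + a \<parallel>Bv\<parallel>\<^sup>2\<close>, by Pythagoras.\<close>

lemma J_minimizes:
  assumes a: "a > 0"
  obtains w where "(J a f, w) \<in> \<Gamma>" and
    "\<And>v z. (v, z) \<in> \<Gamma> \<Longrightarrow> (norm (v - f))\<^sup>2 + a * (norm z)\<^sup>2 =
      (norm (J a f - f))\<^sup>2 + a * (norm w)\<^sup>2 + (norm (v - J a f))\<^sup>2 + a * (norm (z - w))\<^sup>2"
proof -
  obtain p where p: "L_rel (J a f) p" "J a f + a *\<^sub>R p = f" using J_rel[OF a] .
  from p(1) obtain w where w: "(J a f, w) \<in> \<Gamma>" "\<And>v z. (v, z) \<in> \<Gamma> \<Longrightarrow> w \<bullet> z = p \<bullet> v"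
    by (rule L_relE) blast
  show ?thesis
  proof (rule that[OF w(1)])
    fix v z assume vz: "(v, z) \<in> \<Gamma>"
    define u where "u = J a f"
    have f: "f = u + a *\<^sub>R p" using p(2) by (simp add: u_def)
    have 1: "w \<bullet> z = p \<bullet> v" "w \<bullet> w = p \<bullet> u" using w vz by (auto simp: u_def)
    have "(norm (v - f))\<^sup>2 = (norm (v - u))\<^sup>2 - 2 * (a * (p \<bullet> v)) + 2 * (a * (p \<bullet> u)) + (norm (u - f))\<^sup>2"
      unfolding f power2_norm_eq_inner
      by (simp add: inner_diff_left inner_diff_right inner_add_left inner_add_right inner_commute algebra_simps)
    moreover have "a * (norm z)\<^sup>2 = a * (norm (z - w))\<^sup>2 + 2 * (a * (p \<bullet> v)) - a * (p \<bullet> u)"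
      unfolding power2_norm_eq_inner using 1
      by (simp add: inner_diff_left inner_diff_right inner_commute algebra_simps)
    moreover have "a * (norm w)\<^sup>2 = a * (p \<bullet> u)" using 1 by (simp add: power2_norm_eq_inner)
    ultimately show "(norm (v - f))\<^sup>2 + a * (norm z)\<^sup>2 =
      (norm (J a f - f))\<^sup>2 + a * (norm w)\<^sup>2 + (norm (v - J a f))\<^sup>2 + a * (norm (z - w))\<^sup>2"
      unfolding u_def[symmetric] by linarith
  qed
qed

text \<open>Invariant convex sets of Beurling and Deny: replacing the minimizer \<open>J a f\<close> by its image under \<open>P\<close>
  increases neither term of the functional that it minimizes, so the two are equal.\<close>

lemma J_invariant:
  assumes a: "a > 0" and f: "f \<in> C"
    and P: "\<And>u w. (u, w) \<in> \<Gamma> \<Longrightarrow> P u \<in> C \<and> (\<exists>z. (P u, z) \<in> \<Gamma> \<and> norm z \<le> norm w)"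
    and near: "\<And>u f. f \<in> C \<Longrightarrow> norm (P u - f) \<le> norm (u - f)"
  shows "J a f \<in> C"
proof -
  obtain w where w: "(J a f, w) \<in> \<Gamma>"
    "\<And>v z. (v, z) \<in> \<Gamma> \<Longrightarrow> (norm (v - f))\<^sup>2 + a * (norm z)\<^sup>2 =
      (norm (J a f - f))\<^sup>2 + a * (norm w)\<^sup>2 + (norm (v - J a f))\<^sup>2 + a * (norm (z - w))\<^sup>2"
    by (rule J_minimizes[OF a, of f]) blast
  obtain z where z: "(P (J a f), z) \<in> \<Gamma>" "norm z \<le> norm w" and PC: "P (J a f) \<in> C"
    using P[OF w(1)] by blast
  have "(norm (P (J a f) - f))\<^sup>2 \<le> (norm (J a f - f))\<^sup>2"
    by (rule power_mono[OF near[OF f]]) simp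
  moreover have "a * (norm z)\<^sup>2 \<le> a * (norm w)\<^sup>2"
    using a by (intro mult_left_mono power_mono z(2)) auto
  moreover have "0 \<le> a * (norm (z - w))\<^sup>2" using a by simp
  ultimately have "(norm (P (J a f) - J a f))\<^sup>2 \<le> 0" using w(2)[OF z(1)] by linarith
  then show ?thesis using PC by simp
qed

definition a_seq :: "nat \<Rightarrow> real" where "a_seq n = inverse (real (Suc n))"

lemma a_seq_pos [simp]: "a_seq n > 0" by (simp add: a_seq_def)

text \<open>For \<open>g\<close> in the domain of \<open>B\<close>, taking \<open>g\<close> itself as a competitor in the minimization gives
  \<open>\<parallel>J a g - g\<parallel>\<^sup>2 \<le> a \<parallel>Bg\<parallel>\<^sup>2\<close>. Contractivity and density extend the convergence to all vectors.\<close>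

lemma J_tendsto: "(\<lambda>n. J (a_seq n) f) \<longlonglongrightarrow> f"
proof (rule LIMSEQ_I)
  fix e :: real assume e: "e > 0"
  have "f \<in> closure (fst ` \<Gamma>)" using dense_domain by simp
  then obtain g w where g: "(g, w) \<in> \<Gamma>" "dist g f < e / 3"
    unfolding closure_approachable using e by (auto dest!: spec[of _ "e / 3"])
  have "(\<lambda>n. a_seq n * (norm w)\<^sup>2) \<longlonglongrightarrow> 0"
    using tendsto_mult_left_zero[OF LIMSEQ_inverse_real_of_nat] unfolding a_seq_def .
  then have "\<forall>\<^sub>F n in sequentially. a_seq n * (norm w)\<^sup>2 < (e / 3)\<^sup>2"
    by (rule order_tendstoD(2)) (use e in simp)
  then obtain N where N: "\<And>n. n \<ge> N \<Longrightarrow> a_seq n * (norm w)\<^sup>2 < (e / 3)\<^sup>2"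
    unfolding eventually_sequentially by blast
  have "norm (J (a_seq n) f - f) < e" if "n \<ge> N" for n
  proof -
    obtain w' where w': "\<And>v z. (v, z) \<in> \<Gamma> \<Longrightarrow> (norm (v - g))\<^sup>2 + a_seq n * (norm z)\<^sup>2 =
      (norm (J (a_seq n) g - g))\<^sup>2 + a_seq n * (norm w')\<^sup>2 + (norm (v - J (a_seq n) g))\<^sup>2 + a_seq n * (norm (z - w'))\<^sup>2"
      by (rule J_minimizes[OF a_seq_pos[of n], of g]) blast
    have "0 \<le> a_seq n * (norm w')\<^sup>2" "0 \<le> a_seq n * (norm (w - w'))\<^sup>2"
            by (rule mult_nonneg_nonneg[OF less_imp_le[OF a_seq_pos] zero_le_power2])+
    then have "(norm (J (a_seq n) g - g))\<^sup>2 \<le> a_seq n * (norm w)\<^sup>2"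
      using w'[OF g(1)] by simp
    also have "\<dots> < (e / 3)\<^sup>2" using N[OF that] .
    finally have 1: "norm (J (a_seq n) g - g) < e / 3"
      by (rule power_less_imp_less_base) (use e in simp)
    have "J (a_seq n) f - f = J (a_seq n) (f - g) + (J (a_seq n) g - g) + (g - f)"
      by (simp add: linear_diff[OF J_linear])
    also have "norm \<dots> \<le> norm (J (a_seq n) (f - g)) + norm (J (a_seq n) g - g) + norm (g - f)"
      by (meson norm_triangle_ineq norm_triangle_mono order_refl)
    also have "\<dots> < e / 3 + e / 3 + e / 3"
      using J_contraction[OF a_seq_pos, of n "f - g"] 1 g(2) by (simp add: dist_norm norm_minus_commute)
    finally show ?thesis by simp
  qed
  then show "\<exists>N. \<forall>n\<ge>N. norm (J (a_seq n) f - f) < e" by blast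
qed

lemma L_domain_dense: assumes "e > 0" obtains u p where "L_rel u p" "norm (u - f) < e"
proof -
  obtain n where "norm (J (a_seq n) f - f) < e" using LIMSEQ_D[OF J_tendsto assms] by blast
  moreover obtain p where "L_rel (J (a_seq n) f) p" by (rule J_rel[OF a_seq_pos])
  ultimately show ?thesis using that by blast
qed

text \<open>Yosida approximation: the bounded operators \<open>X n = (J a - 1) / a\<close> with \<open>a = 1 / (n + 1)\<close> approximate
  \<open>- L\<close>, because \<open>X n u = - J a (L u)\<close> on the domain of \<open>L\<close>, and their exponentials are contractions.\<close>

definition JJ :: "nat \<Rightarrow> 'h endo" where
  "JJ n = (SOME A. (\<forall>f. app A f = J (a_seq n) f) \<and> norm A \<le> 1)"

definition X :: "nat \<Rightarrow> 'h endo" where "X n = (1 / a_seq n) *\<^sub>R (JJ n - 1)"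

definition Y :: "nat \<Rightarrow> real \<Rightarrow> 'h endo" where "Y n t = exp (t *\<^sub>R X n)"

lemma JJ: "app (JJ n) f = J (a_seq n) f" "norm (JJ n) \<le> 1"
proof -
  obtain A where "\<And>f. app A f = J (a_seq n) f" "norm A \<le> 1"
    by (rule endo_of_bounded_linear[OF J_linear[OF a_seq_pos[of n]] J_contraction[OF a_seq_pos[of n]]]) blast
  then have "\<exists>A. (\<forall>f. app A f = J (a_seq n) f) \<and> norm A \<le> 1" by blast
  from someI_ex[OF this] show "app (JJ n) f = J (a_seq n) f" "norm (JJ n) \<le> 1"
    unfolding JJ_def by blast+
qed

lemma JJ_commute: "JJ m * JJ n = JJ n * JJ m"
  by (rule endo_eqI) (simp add: JJ J_commute)

lemma X_commute: "X m * X n = X n * X m"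
  by (simp add: X_def algebra_simps JJ_commute)

lemma X_of_range: assumes "L_rel f p" shows "app (X n) f = - J (a_seq n) p"
  using J_of_range[OF a_seq_pos assms, of n] a_seq_pos[of n] by (simp add: X_def JJ del: a_seq_pos)

lemma Y_eq: "Y n t = exp (- (t / a_seq n)) *\<^sub>R exp ((t / a_seq n) *\<^sub>R JJ n)"
proof -
  define s where "s = t / a_seq n"
  have "Y n t = exp (of_real (- s) + s *\<^sub>R JJ n)"
    by (simp add: Y_def X_def s_def of_real_def scaleR_diff_right)
  also have "\<dots> = exp (of_real (- s)) * exp (s *\<^sub>R JJ n)"
    by (rule exp_add_commuting) (simp add: of_real_def)
  also have "exp (of_real (- s)) = (of_real (exp (- s)) :: 'h endo)" by (rule exp_of_real)
  finally show ?thesis by (simp add: s_def of_real_def)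
qed

lemma Y_norm: assumes "t \<ge> 0" shows "norm (Y n t) \<le> 1"
proof -
  define s where "s = t / a_seq n"
  have s: "s \<ge> 0" using assms a_seq_pos[of n] by (simp add: s_def del: a_seq_pos)
  have "norm (s *\<^sub>R JJ n) \<le> s" using s JJ(2)[of n] by (simp add: mult_left_le)
  then have "norm (exp (s *\<^sub>R JJ n)) \<le> exp s" using norm_exp[of "s *\<^sub>R JJ n"] by (meson exp_le_cancel_iff order_trans)
  then have "norm (Y n t) \<le> exp (- s) * exp s"
    unfolding Y_eq s_def[symmetric] by simp
  then show ?thesis by (simp add: mult_exp_exp)
qed

lemma Y_contraction: "t \<ge> 0 \<Longrightarrow> norm (app (Y n t) f) \<le> norm f"
  using order_trans[OF norm_app mult_right_mono[OF Y_norm norm_ge_zero]] by simp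

lemma Y_sym: "app (Y n t) f \<bullet> g = f \<bullet> app (Y n t) g"
proof -
  have pow: "app (JJ n ^ k) f \<bullet> g = f \<bullet> app (JJ n ^ k) g" for k f g
  proof (induction k arbitrary: f)
    case (Suc k)
    have "app (JJ n ^ Suc k) f \<bullet> g = app (JJ n ^ k) (app (JJ n) f) \<bullet> g"
      by (simp only: power_Suc2 app_simps)
    also have "\<dots> = app (JJ n) f \<bullet> app (JJ n ^ k) g" by (rule Suc.IH)
    also have "\<dots> = f \<bullet> app (JJ n ^ Suc k) g" by (simp add: JJ J_sym)
    finally show ?case .
  qed simp
  define s where "s = t / a_seq n"
  have "(\<lambda>k. (s ^ k / fact k) *\<^sub>R app (JJ n ^ k) f \<bullet> g) sums (app (exp (s *\<^sub>R JJ n)) f \<bullet> g)"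
    by (rule bounded_linear.sums[OF bounded_linear_inner_left app_exp_sums])
  moreover have "(\<lambda>k. f \<bullet> (s ^ k / fact k) *\<^sub>R app (JJ n ^ k) g) sums (f \<bullet> app (exp (s *\<^sub>R JJ n)) g)"
    by (rule bounded_linear.sums[OF bounded_linear_inner_right app_exp_sums])
  ultimately have "app (exp (s *\<^sub>R JJ n)) f \<bullet> g = f \<bullet> app (exp (s *\<^sub>R JJ n)) g"
    using sums_unique2 by (fastforce simp: pow)
  then show ?thesis by (simp add: Y_eq s_def)
qed

lemma Y_add: "Y n (s + t) = Y n s * Y n t"
  unfolding Y_def by (simp add: scaleR_add_left exp_add_commuting)

lemma Y_compare: "t \<ge> 0 \<Longrightarrow> norm (app (Y m t) f - app (Y n t) f) \<le> t * norm (app (X m) f - app (X n) f)"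
  unfolding Y_def by (rule commuting_exp_compare[OF X_commute]) (use Y_norm in \<open>auto simp: Y_def\<close>)

lemma Y_compare_id: "t \<ge> 0 \<Longrightarrow> norm (app (Y n t) f - f) \<le> t * norm (app (X n) f)"
  using commuting_exp_compare[of "X n" 0 t f] Y_norm by (simp add: Y_def)

definition T :: "real \<Rightarrow> 'h \<Rightarrow> 'h" where "T t f = lim (\<lambda>n. app (Y n t) f)"

text \<open>On the domain of \<open>L\<close> the sequence is Cauchy: the commuting semigroups with generators \<open>X m\<close> and \<open>X n\<close>
  differ by at most \<open>t \<parallel>X m f - X n f\<parallel>\<close>. Contractivity and density give the rest.\<close>

lemma T_lim: assumes t: "t \<ge> 0" shows "(\<lambda>n. app (Y n t) f) \<longlonglongrightarrow> T t f"
proof -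
  have "Cauchy (\<lambda>n. app (Y n t) f)"
  proof (rule CauchyI)
    fix e :: real assume e: "e > 0"
    obtain g p where g: "L_rel g p" "norm (g - f) < e / 3" using L_domain_dense[of "e / 3" f] e by auto
    have "Cauchy (\<lambda>n. J (a_seq n) p)" using J_tendsto LIMSEQ_imp_Cauchy by blast
    moreover have "e / 3 / (t + 1) > 0" using e t by simp
    ultimately obtain M where M: "\<And>m n. m \<ge> M \<Longrightarrow> n \<ge> M \<Longrightarrow> norm (J (a_seq m) p - J (a_seq n) p) < e / 3 / (t + 1)"
      unfolding Cauchy_iff by metis
    have "norm (app (Y m t) f - app (Y n t) f) < e" if "m \<ge> M" "n \<ge> M" for m n
    proof -
      have "norm (app (Y m t) g - app (Y n t) g) \<le> t * norm (J (a_seq m) p - J (a_seq n) p)"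
        using Y_compare[OF t, of m g n] by (simp add: X_of_range[OF g(1)] norm_minus_commute)
      also have "\<dots> \<le> t * (e / 3 / (t + 1))" using M[OF that] t by (intro mult_left_mono) auto
      also have "\<dots> \<le> e / 3" using t e by (simp add: field_simps)
      finally have 1: "norm (app (Y m t) g - app (Y n t) g) \<le> e / 3" .
      have lin: "app (Y k t) (f - g) = app (Y k t) f - app (Y k t) g" for k
        using linear_diff[OF bounded_linear.linear[OF app_bounded_linear]] by blast
      have "app (Y m t) f - app (Y n t) f =
          app (Y m t) (f - g) + (app (Y m t) g - app (Y n t) g) - app (Y n t) (f - g)"
        by (simp add: lin)
      also have "norm \<dots> \<le> norm (app (Y m t) (f - g)) + norm (app (Y m t) g - app (Y n t) g) + norm (app (Y n t) (f - g))"
        by (meson norm_triangle_ineq norm_triangle_ineq4 norm_triangle_mono order_refl order_trans add_mono)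
      also have "\<dots> < e / 3 + e / 3 + e / 3"
        using Y_contraction[OF t, of m "f - g"] Y_contraction[OF t, of n "f - g"] 1 g(2)
        by (simp add: norm_minus_commute)
      finally show ?thesis by simp
    qed
    then show "\<exists>M. \<forall>m\<ge>M. \<forall>n\<ge>M. norm (app (Y m t) f - app (Y n t) f) < e" by blast
  qed
  then show ?thesis unfolding T_def using Cauchy_convergent_iff convergent_LIMSEQ_iff by blast
qed


lemma T_unique: "t \<ge> 0 \<Longrightarrow> (\<lambda>n. app (Y n t) f) \<longlonglongrightarrow> g \<Longrightarrow> T t f = g"
  using T_lim LIMSEQ_unique by blast

lemma T_add: "t \<ge> 0 \<Longrightarrow> T t (f + g) = T t f + T t g"
  by (rule T_unique) (auto intro!: tendsto_intros T_lim
      simp: linear_add[OF bounded_linear.linear[OF app_bounded_linear]])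

lemma T_scale: "t \<ge> 0 \<Longrightarrow> T t (c *\<^sub>R f) = c *\<^sub>R T t f"
  by (rule T_unique) (auto intro!: tendsto_intros T_lim
      simp: linear_scale[OF bounded_linear.linear[OF app_bounded_linear]])

lemma T_diff: "t \<ge> 0 \<Longrightarrow> T t (f - g) = T t f - T t g"
  using T_add[of t f "-1 *\<^sub>R g"] T_scale[of t "-1" g] by simp

lemma T_contraction: "t \<ge> 0 \<Longrightarrow> norm (T t f) \<le> norm f"
  by (rule LIMSEQ_le_const2[OF tendsto_norm[OF T_lim]]) (auto intro: Y_contraction)

lemma T_sym: assumes "t \<ge> 0" shows "T t f \<bullet> g = f \<bullet> T t g"
proof (rule LIMSEQ_unique)
  show "(\<lambda>n. app (Y n t) f \<bullet> g) \<longlonglongrightarrow> T t f \<bullet> g" by (intro tendsto_intros T_lim assms)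
  show "(\<lambda>n. app (Y n t) f \<bullet> g) \<longlonglongrightarrow> f \<bullet> T t g"
    unfolding Y_sym by (intro tendsto_intros T_lim assms)
qed

lemma T_0: "T 0 f = f"
  by (rule T_unique) (auto simp: Y_def)

lemma T_semigroup: assumes "s \<ge> 0" "t \<ge> 0" shows "T (s + t) f = T s (T t f)"
proof (rule T_unique)
  have "(\<lambda>n. app (Y n t) f - T t f) \<longlonglongrightarrow> 0"
    using T_lim[OF assms(2), of f] by (simp add: LIM_zero_iff)
  from tendsto_norm_zero[OF this]
  have "(\<lambda>n. app (Y n s) (app (Y n t) f - T t f)) \<longlonglongrightarrow> 0"
    by (rule Lim_null_comparison[OF always_eventually, rotated]) (auto intro: Y_contraction assms)
  from tendsto_add[OF this T_lim[OF assms(1), of "T t f"]]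
  show "(\<lambda>n. app (Y n (s + t)) f) \<longlonglongrightarrow> T s (T t f)"
    by (simp add: Y_add linear_diff[OF bounded_linear.linear[OF app_bounded_linear]])
qed (use assms in auto)

lemma T_close: assumes "L_rel f p" "t \<ge> 0" shows "norm (T t f - f) \<le> t * norm p"
proof (rule LIMSEQ_le_const2)
  show "(\<lambda>n. norm (app (Y n t) f - f)) \<longlonglongrightarrow> norm (T t f - f)"
    by (intro tendsto_intros T_lim assms)
  have "norm (app (Y n t) f - f) \<le> t * norm p" for n
    using Y_compare_id[OF assms(2), of n f] mult_left_mono[OF J_contraction[OF a_seq_pos, of n p] assms(2)]
    by (simp add: X_of_range[OF assms(1)])
  then show "\<exists>N. \<forall>n\<ge>N. norm (app (Y n t) f - f) \<le> t * norm p" by blast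
qed

lemma T_strongly_continuous: "((\<lambda>t. T t f) \<longlongrightarrow> f) (at_right 0)"
proof (rule tendstoI)
  fix e :: real assume e: "e > 0"
  obtain g p where g: "L_rel g p" "norm (g - f) < e / 3" by (rule L_domain_dense[of "e / 3" f]) (use e in auto)
  have small: "norm (T t f - f) < e" if t: "t > 0" "t < e / 3 / (norm p + 1)" for t
  proof -
    have t0: "t \<ge> 0" using t by simp
    have "t * norm p \<le> e / 3 / (norm p + 1) * norm p" using t by (intro mult_right_mono) auto
    also have "\<dots> \<le> e / 3" by (rule divide_times_le_self) (use e in auto)
    finally have 1: "norm (T t g - g) \<le> e / 3" using T_close[OF g(1) t0] by linarith
    have "T t f - f = T t (f - g) + (T t g - g) + (g - f)" by (simp add: T_diff t0)
    also have "norm \<dots> \<le> norm (T t (f - g)) + norm (T t g - g) + norm (g - f)"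
      by (meson norm_triangle_ineq norm_triangle_mono order_refl)
    also have "\<dots> < e / 3 + e / 3 + e / 3"
      using T_contraction[OF t0, of "f - g"] 1 g(2) by (simp add: norm_minus_commute)
    finally show ?thesis by simp
  qed
  show "\<forall>\<^sub>F t in at_right 0. dist (T t f) f < e"
    unfolding eventually_at_right_field dist_norm
    by (rule exI[of _ "e / 3 / (norm p + 1)"]) (use small e in \<open>auto intro!: divide_pos_pos add_nonneg_pos\<close>)
qed

lemma T_difference: assumes "0 \<le> s" "s \<le> t" shows "norm (T t f - T s f) \<le> norm (T (t - s) f - f)"
proof -
  have "T t f - T s f = T s (T (t - s) f - f)"
    using T_semigroup[of s "t - s" f] assms by (simp add: T_diff)
  then show ?thesis using T_contraction[of s] assms by simp
qed

lemma T_continuous: "continuous_on {0..} (\<lambda>t. T t f)"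
proof (rule continuous_onI)
  fix t e :: real assume t: "t \<in> {0..}" and e: "e > 0"
  have "\<forall>\<^sub>F h in at_right 0. dist (T h f) f < e" by (rule tendstoD[OF T_strongly_continuous e])
  then obtain d where d: "d > 0" "\<And>h. h > 0 \<Longrightarrow> h < d \<Longrightarrow> norm (T h f - f) < e"
    unfolding eventually_at_right_field dist_norm by blast
  then have d': "norm (T h f - f) < e" if "h \<ge> 0" "h < d" for h
    using that e by (cases "h = 0") (auto simp: T_0)
  have "dist (T s f) (T t f) \<le> e" if "s \<in> {0..}" "dist s t < d" for s
  proof (cases "s \<le> t")
    case True
    then show ?thesis using T_difference[of s t f] d'[of "t - s"] that t
      by (simp add: dist_norm norm_minus_commute)
  next
    case False
    then show ?thesis using T_difference[of t s f] d'[of "s - t"] that t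
      by (simp add: dist_norm)
  qed
  then show "\<exists>d>0. \<forall>x'\<in>{0..}. dist x' t < d \<longrightarrow> dist (T x' f) (T t f) \<le> e" using d(1) by blast
qed

text \<open>On the domain of \<open>L\<close> the difference quotients of the approximating semigroups converge
  uniformly in \<open>n\<close>. The vector \<open>p'\<close> is meant to approximate \<open>p = L f\<close> from within the domain of \<open>L\<close>, where the
  modulus of continuity of the semigroup at 0 is explicit.\<close>

lemma T_difference_quotient_bound:
  assumes f: "L_rel f p" and p': "L_rel p' q'" and t: "t \<ge> 0"
  shows "norm (T t f - f + t *\<^sub>R p) \<le> t * (2 * norm (p - p') + t * norm q')"
proof (rule LIMSEQ_le_const2)
  show "(\<lambda>n. norm (app (Y n t) f - f + t *\<^sub>R J (a_seq n) p)) \<longlonglongrightarrow> norm (T t f - f + t *\<^sub>R p)"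
    by (intro tendsto_intros T_lim J_tendsto t)
  have "norm (app (Y n t) f - f + t *\<^sub>R J (a_seq n) p) \<le> t * (2 * norm (p - p') + t * norm q')" for n
  proof -
    define g where "g r = app (Y n r) f - r *\<^sub>R app (X n) f" for r
    have commute: "app (Y n r) (J (a_seq n) h) = J (a_seq n) (app (Y n r) h)" for r h
    proof -
      have "(r *\<^sub>R X n) * JJ n = JJ n * (r *\<^sub>R X n)" by (simp add: X_def algebra_simps)
      from exp_commute[OF this] show ?thesis unfolding Y_def by (metis JJ(1) app_simps(3))
    qed
    have lin: "app (Y k r) (h - g) = app (Y k r) h - app (Y k r) g" for k r h g
      using linear_diff[OF bounded_linear.linear[OF app_bounded_linear]] by blast
    have "norm (g t - g 0) \<le> (2 * norm (p - p') + t * norm q') * (t - 0)"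
    proof (rule norm_diff_le_if_vector_derivative_bounded[OF t])
      fix r assume r: "r \<in> {0..t}"
      have "((\<lambda>r. app (Y n r) f) has_vector_derivative app (exp (r *\<^sub>R X n) * X n) f) (at r within {0..t})"
        unfolding Y_def
        by (rule bounded_linear.has_vector_derivative[OF bounded_linear_app_left
              exp_scaleR_has_vector_derivative_right])
      moreover have "((\<lambda>r. r *\<^sub>R app (X n) f) has_vector_derivative app (X n) f) (at r within {0..t})"
        by (auto intro!: derivative_eq_intros simp: has_vector_derivative_def)
      ultimately show "(g has_vector_derivative (app (Y n r) (app (X n) f) - app (X n) f)) (at r within {0..t})"
        unfolding g_def Y_def by (auto intro: has_vector_derivative_diff)
      have "app (Y n r) (app (X n) f) - app (X n) f =
          - (J (a_seq n) (app (Y n r) p - p))"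
        unfolding X_of_range[OF f] using J_linear[OF a_seq_pos[of n]]
        by (simp add: commute linear_diff linear_neg[OF bounded_linear.linear[OF app_bounded_linear]])
      then have "norm (app (Y n r) (app (X n) f) - app (X n) f) \<le> norm (app (Y n r) p - p)"
        using J_contraction[OF a_seq_pos, of n "app (Y n r) p - p"] by simp
      also have "app (Y n r) p - p = app (Y n r) (p - p') + (app (Y n r) p' - p') - (p - p')"
        by (simp add: lin)
      also have "norm \<dots> \<le> norm (app (Y n r) (p - p')) + norm (app (Y n r) p' - p') + norm (p - p')"
        by (meson norm_triangle_ineq norm_triangle_ineq4 norm_triangle_mono order_refl order_trans add_mono)
      also have "norm (app (Y n r) (p - p')) \<le> norm (p - p')" using Y_contraction r by simp
      also have "norm (app (Y n r) p' - p') \<le> t * norm q'"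
      proof -
        have "norm (app (Y n r) p' - p') \<le> r * norm (J (a_seq n) q')"
          using Y_compare_id[of r n p'] r by (simp add: X_of_range[OF p'])
        also have "\<dots> \<le> t * norm q'"
          using r J_contraction[OF a_seq_pos, of n q'] by (intro mult_mono) auto
        finally show ?thesis .
      qed
      finally show "norm (app (Y n r) (app (X n) f) - app (X n) f) \<le> 2 * norm (p - p') + t * norm q'"
        by simp
    qed
    moreover have "g t - g 0 = app (Y n t) f - f + t *\<^sub>R J (a_seq n) p"
      unfolding g_def X_of_range[OF f] by (simp add: Y_def)
    ultimately show ?thesis by (simp add: mult.commute)
  qed
  then show "\<exists>N. \<forall>n\<ge>N. norm (app (Y n t) f - f + t *\<^sub>R J (a_seq n) p) \<le> t * (2 * norm (p - p') + t * norm q')"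
    by blast
qed

lemma generator_if_L_rel:
  assumes f: "L_rel f p"
  shows "((\<lambda>t. (1 / t) *\<^sub>R (T t f - f)) \<longlongrightarrow> - p) (at_right 0)"
proof (rule tendstoI)
  fix e :: real assume e: "e > 0"
  obtain p' q' where p': "L_rel p' q'" "norm (p' - p) < e / 4"
    by (rule L_domain_dense[of "e / 4" p]) (use e in auto)
  have small: "norm ((1 / t) *\<^sub>R (T t f - f) - (- p)) < e" if t: "t > 0" "t < e / 2 / (norm q' + 1)" for t
  proof -
    have "t * norm q' \<le> e / 2 / (norm q' + 1) * norm q'" using t by (intro mult_right_mono) auto
    also have "\<dots> \<le> e / 2" by (rule divide_times_le_self) (use e in auto)
    finally have 1: "2 * norm (p - p') + t * norm q' < e" using p'(2) by (simp add: norm_minus_commute)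
    have "(1 / t) *\<^sub>R (T t f - f) - (- p) = (1 / t) *\<^sub>R (T t f - f + t *\<^sub>R p)"
      using t by (simp add: scaleR_add_right)
    also have "norm \<dots> = (1 / t) * norm (T t f - f + t *\<^sub>R p)" using t by simp
    also have "\<dots> \<le> (1 / t) * (t * (2 * norm (p - p') + t * norm q'))"
      using t by (intro mult_left_mono T_difference_quotient_bound f p'(1)) auto
    also have "\<dots> = 2 * norm (p - p') + t * norm q'" using t by simp
    finally show ?thesis using 1 by simp
  qed
  show "\<forall>\<^sub>F t in at_right 0. dist ((1 / t) *\<^sub>R (T t f - f)) (- p) < e"
    unfolding eventually_at_right_field dist_norm
    by (rule exI[of _ "e / 2 / (norm q' + 1)"]) (use small e in \<open>auto intro!: divide_pos_pos add_nonneg_pos\<close>)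
qed

text \<open>The generator extends \<open>- L\<close> and is dissipative. Such an extension is not proper because \<open>1 + L\<close>
  is onto: the difference \<open>d\<close> of \<open>u\<close> and a solution of the resolvent equation satisfies
  \<open>\<langle>d, d\<rangle> \<le> 0\<close>.\<close>

lemma L_rel_if_generator:
  assumes u: "((\<lambda>t. (1 / t) *\<^sub>R (T t u - u)) \<longlongrightarrow> w) (at_right 0)"
  shows "L_rel u (- w)"
proof -
  obtain p where p: "L_rel (J 1 (u - w)) p" "J 1 (u - w) + 1 *\<^sub>R p = u - w"
    by (rule J_rel[of 1 "u - w"]) auto
  define v where "v = J 1 (u - w)"
  define d where "d = u - v"
  have wp: "w + p = d" using p(2) by (simp add: v_def d_def algebra_simps)
  have "((\<lambda>t. (1 / t) *\<^sub>R (T t u - u) - (1 / t) *\<^sub>R (T t v - v)) \<longlongrightarrow> w - (- p)) (at_right 0)"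
    unfolding v_def by (rule tendsto_diff[OF u generator_if_L_rel[OF p(1)]])
  then have "((\<lambda>t. ((1 / t) *\<^sub>R (T t u - u) - (1 / t) *\<^sub>R (T t v - v)) \<bullet> d) \<longlongrightarrow> d \<bullet> d) (at_right 0)"
    using wp by (intro tendsto_inner tendsto_const) simp
  moreover have "\<forall>\<^sub>F t in at_right 0. ((1 / t) *\<^sub>R (T t u - u) - (1 / t) *\<^sub>R (T t v - v)) \<bullet> d \<le> 0"
    unfolding eventually_at_right_field
  proof (intro exI[of _ 1] conjI allI impI)
    fix t :: real assume t: "0 < t" "t < 1"
    have "(T t d - d) \<bullet> d \<le> 0"
    proof -
      have "T t d \<bullet> d \<le> norm (T t d) * norm d" by (rule norm_cauchy_schwarz)
      also have "\<dots> \<le> norm d * norm d" using t T_contraction[of t d] by (intro mult_right_mono) auto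
      finally show ?thesis by (simp add: inner_diff_left dot_square_norm power2_eq_square)
    qed
    moreover have "(1 / t) *\<^sub>R (T t u - u) - (1 / t) *\<^sub>R (T t v - v) = (1 / t) *\<^sub>R (T t d - d)"
      using t by (simp add: d_def T_diff algebra_simps)
    ultimately show "((1 / t) *\<^sub>R (T t u - u) - (1 / t) *\<^sub>R (T t v - v)) \<bullet> d \<le> 0"
      using t by (simp add: divide_nonpos_pos)
  qed simp
  ultimately have "d \<bullet> d \<le> 0" by (intro tendsto_upperbound[of _ "d \<bullet> d" "at_right 0"]) auto
  then have "d = 0" using inner_ge_zero[of d] by (metis inner_eq_zero_iff order_antisym)
  then have "p = - w" "J 1 (u - w) = u"
    using wp by (simp_all add: d_def v_def eq_neg_iff_add_eq_0 add.commute)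
  then show ?thesis using p(1) by simp
qed

text \<open>The approximating semigroups are convex combinations of powers of the resolvent, so closed
  convex sets that the resolvent preserves are preserved by the semigroup.\<close>

lemma T_invariant:
  assumes C: "closed C" "convex C" "0 \<in> C" and J: "\<And>a f. a > 0 \<Longrightarrow> f \<in> C \<Longrightarrow> J a f \<in> C"
    and f: "f \<in> C" and t: "t \<ge> 0"
  shows "T t f \<in> C"
proof (rule closed_sequentially[OF C(1) _ T_lim[OF t]])
  fix n
  define s where "s = t / a_seq n"
  have s: "s \<ge> 0" using t a_seq_pos[of n] by (simp add: s_def del: a_seq_pos)
  have pow: "app (JJ n ^ k) f \<in> C" for k
    by (induction k) (auto simp: f JJ J)
  have "(\<lambda>k. exp (- s) *\<^sub>R ((s ^ k / fact k) *\<^sub>R app (JJ n ^ k) f)) sums app (Y n t) f"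
    unfolding Y_eq s_def[symmetric] app_simps
    by (rule bounded_linear.sums[OF bounded_linear_scaleR_right app_exp_sums])
  then have lim: "(\<lambda>N. \<Sum>k<N. exp (- s) *\<^sub>R ((s ^ k / fact k) *\<^sub>R app (JJ n ^ k) f)) \<longlonglongrightarrow> app (Y n t) f"
    by (simp add: sums_def)
  show "app (Y n t) f \<in> C"
  proof (rule closed_sequentially[OF C(1) _ lim])
    fix N
    define c where "c k = (if k < N then exp (- s) * (s ^ k / fact k) else 1 - (\<Sum>k<N. exp (- s) * (s ^ k / fact k)))" for k
    have "(\<lambda>k. exp (- s) * (s ^ k / fact k)) sums (exp (- s) * exp s)"
      using sums_mult[OF exp_converges[of s], of "exp (- s)"] by (simp add: divide_inverse mult.commute)
    then have "(\<Sum>k<N. exp (- s) * (s ^ k / fact k)) \<le> 1"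
      using sum_le_suminf[of "\<lambda>k. exp (- s) * (s ^ k / fact k)" "{..<N}"] s
      by (simp add: sums_iff mult_exp_exp)
    then have cpos: "c k \<ge> 0" for k using s by (simp add: c_def)
    have "(\<Sum>k\<in>{..N}. c k *\<^sub>R (if k < N then app (JJ n ^ k) f else 0)) \<in> C"
    proof (rule convex_sum[OF _ C(2)])
      show "sum c {..N} = 1" by (simp add: lessThan_Suc_atMost[symmetric] c_def)
    qed (use cpos pow C(3) in auto)
    also have "(\<Sum>k\<in>{..N}. c k *\<^sub>R (if k < N then app (JJ n ^ k) f else 0)) =
        (\<Sum>k<N. exp (- s) *\<^sub>R ((s ^ k / fact k) *\<^sub>R app (JJ n ^ k) f))"
      by (simp add: lessThan_Suc_atMost[symmetric] c_def)
    finally show "(\<Sum>k<N. exp (- s) *\<^sub>R ((s ^ k / fact k) *\<^sub>R app (JJ n ^ k) f)) \<in> C" .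
  qed
qed


text \<open>Partial potentials. As \<open>N\<close> tends to infinity, they exhaust the potential \<open>G f\<close>.\<close>

definition S :: "real \<Rightarrow> 'h \<Rightarrow> 'h" where "S N f = integral {0..N} (\<lambda>s. T s f)"

lemma T_integrable: "0 \<le> a \<Longrightarrow> (\<lambda>s. T s f) integrable_on {a..b}"
  by (rule integrable_continuous_real[OF continuous_on_subset[OF T_continuous]]) auto

lemma S_inner: "0 \<le> N \<Longrightarrow> S N f \<bullet> g = integral {0..N} (\<lambda>s. T s f \<bullet> g)"
  using integral_linear[OF T_integrable[of 0 f N] bounded_linear_inner_left[of g]]
  by (simp add: S_def o_def)

lemma T_inner_integrable: "0 \<le> a \<Longrightarrow> (\<lambda>s. T s f \<bullet> g) integrable_on {a..b}"
  using integrable_linear[OF T_integrable[of a f b] bounded_linear_inner_left[of g]]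
  by (simp add: o_def)

lemma S_split: assumes "0 \<le> M" "M \<le> N" shows "S N f = S M f + integral {M..N} (\<lambda>s. T s f)"
  unfolding S_def using assms by (intro Henstock_Kurzweil_Integration.integral_combine[symmetric] T_integrable) auto

lemma T_of_S: assumes "0 \<le> N" "0 \<le> t" shows "T t (S N f) = S (N + t) f - S t f"
proof -
  have bl: "bounded_linear (T t)"
    by (rule bounded_linear_intro[of _ 1]) (use assms in \<open>auto simp: T_add T_scale T_contraction\<close>)
  have "T t (S N f) = integral {0..N} (\<lambda>s. T t (T s f))"
    unfolding S_def using integral_linear[OF T_integrable[of 0 f N] bl] by (simp add: o_def)
  also have "\<dots> = integral {0..N} ((\<lambda>s. T s f) \<circ> ((+) t))"
    by (rule integral_cong) (use assms in \<open>simp add: T_semigroup\<close>)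
  also have "\<dots> = integral {t..N + t} (\<lambda>s. T s f)"
    using integral_shift_Icc_real[of 0 N "\<lambda>s. T s f" t] by (simp add: add.commute)
  also have "\<dots> = S (N + t) f - S t f" using S_split[of t "N + t" f] assms by simp
  finally show ?thesis .
qed

lemma S_right_derivative:
  assumes "0 \<le> N"
  shows "((\<lambda>t. (1 / t) *\<^sub>R (S (N + t) f - S N f)) \<longlongrightarrow> T N f) (at_right 0)"
proof -
  have "((\<lambda>u. integral {0..u} (\<lambda>s. T s f)) has_vector_derivative T N f) (at N within {0..N + 1})"
    by (rule integral_has_vector_derivative[OF continuous_on_subset[OF T_continuous]]) (use assms in auto)
  then have "((\<lambda>u. S u f) has_vector_derivative T N f) (at N within {N..N + 1})"
    unfolding S_def by (rule has_vector_derivative_within_subset) (use assms in auto)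
  then have "((\<lambda>u. (1 / norm (u - N)) *\<^sub>R (S u f - (S N f + (u - N) *\<^sub>R T N f))) \<longlongrightarrow> 0) (at_right N)"
    unfolding has_vector_derivative_def has_derivative_within by (simp add: at_within_Icc_at_right)
  then have "((\<lambda>t. (1 / norm t) *\<^sub>R (S (N + t) f - (S N f + t *\<^sub>R T N f))) \<longlongrightarrow> 0) (at_right 0)"
    by (subst (asm) filterlim_at_right_to_0) (simp add: add.commute)
  from tendsto_add[OF this tendsto_const[of "T N f"]]
  have "((\<lambda>t. (1 / norm t) *\<^sub>R (S (N + t) f - (S N f + t *\<^sub>R T N f)) + T N f) \<longlongrightarrow> T N f) (at_right 0)"
    by simp
  then show ?thesis
  proof (rule Lim_transform_eventually)
    show "\<forall>\<^sub>F t in at_right 0. (1 / norm t) *\<^sub>R (S (N + t) f - (S N f + t *\<^sub>R T N f)) + T N f =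
        (1 / t) *\<^sub>R (S (N + t) f - S N f)"
      unfolding eventually_at_right_field by (intro exI[of _ 1]) (auto simp: algebra_simps)
  qed
qed

text \<open>By the semigroup property \<open>T t\<close> shifts the interval of integration, so only its two ends
  contribute to the difference quotient.\<close>

lemma L_rel_S: assumes "0 \<le> N" shows "L_rel (S N f) (f - T N f)"
proof -
  have 0: "S 0 f = 0" by (simp add: S_def)
  have "((\<lambda>t. (1 / t) *\<^sub>R (S (N + t) f - S N f) - (1 / t) *\<^sub>R (S (0 + t) f - S 0 f)) \<longlongrightarrow> T N f - T 0 f) (at_right 0)"
    by (intro tendsto_diff S_right_derivative assms order_refl)
  then have "((\<lambda>t. (1 / t) *\<^sub>R (T t (S N f) - S N f)) \<longlongrightarrow> T N f - T 0 f) (at_right 0)"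
  proof (rule Lim_transform_eventually)
    show "\<forall>\<^sub>F t in at_right 0. (1 / t) *\<^sub>R (S (N + t) f - S N f) - (1 / t) *\<^sub>R (S (0 + t) f - S 0 f) =
        (1 / t) *\<^sub>R (T t (S N f) - S N f)"
      unfolding eventually_at_right_field
      by (intro exI[of _ 1]) (auto simp: T_of_S assms 0 algebra_simps)
  qed
  from L_rel_if_generator[OF this] show ?thesis by (simp add: T_0)
qed

text \<open>The equation \<open>L (S N f) = f - T N f\<close>, tested with \<open>S N f\<close> itself.\<close>

lemma S_energy:
  assumes "0 \<le> N"
  obtains w where "(S N f, w) \<in> \<Gamma>" "(norm w)\<^sup>2 = (f - T N f) \<bullet> S N f"
proof (rule L_relE[OF L_rel_S[OF assms, of f]])
  fix w assume "(S N f, w) \<in> \<Gamma>" "\<And>v z. (v, z) \<in> \<Gamma> \<Longrightarrow> w \<bullet> z = (f - T N f) \<bullet> v"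
  then show ?thesis using that by (simp add: power2_norm_eq_inner)
qed

lemma Riemann_sums_S:
  assumes "0 \<le> N" "e > 0"
  obtains d where "d > 0" "\<And>p. p tagged_division_of {0..N} \<Longrightarrow> (\<lambda>s. ball s d) fine p \<Longrightarrow>
    norm ((\<Sum>(s, K)\<in>p. measure lborel K *\<^sub>R T s f) - S N f) < e"
proof -
  define e' where "e' = e / (N + 1)"
  have e': "e' > 0" using assms by (simp add: e'_def)
  have "uniformly_continuous_on {0..N} (\<lambda>s. T s f)"
    by (rule compact_uniformly_continuous[OF continuous_on_subset[OF T_continuous]]) auto
  then obtain d where d: "d > 0" "\<And>s t. s \<in> {0..N} \<Longrightarrow> t \<in> {0..N} \<Longrightarrow> dist t s < d \<Longrightarrow> dist (T t f) (T s f) < e'"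
    unfolding uniformly_continuous_on_def using e' by metis
  show ?thesis
  proof (rule that[OF d(1)])
    fix p assume p: "p tagged_division_of {0..N}" and fine: "(\<lambda>s. ball s d) fine p"
    have p': "p tagged_division_of cbox 0 N" using p by simp
    have "S N f = (\<Sum>(s, K)\<in>p. integral K (\<lambda>s. T s f))"
      unfolding S_def
      using integral_combine_tagged_division_topdown[OF _ p', of "\<lambda>s. T s f"] T_integrable[of 0 f N] by simp
    then have "(\<Sum>(s, K)\<in>p. measure lborel K *\<^sub>R T s f) - S N f =
        (\<Sum>(s, K)\<in>p. measure lborel K *\<^sub>R T s f - integral K (\<lambda>s. T s f))"
      by (simp add: sum_subtractf case_prod_beta)
    also have "norm \<dots> \<le> (\<Sum>(s, K)\<in>p. measure lborel K * e')"
    proof (rule sum_norm_le, clarify)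
      fix s K assume sK: "(s, K) \<in> p"
      obtain a b where K: "K = cbox a b" using tagged_division_ofD(4)[OF p sK] by blast
      have sub: "K \<subseteq> {0..N}" "s \<in> K" using tagged_division_ofD(2,3)[OF p sK] by auto
      have near: "K \<subseteq> ball s d" using fine sK unfolding fine_def by auto
      have "a \<le> b" using sub(2) K by auto
      have a0: "0 \<le> a" using sub K \<open>a \<le> b\<close> by auto
      have "integral {a..b} (\<lambda>r. T s f - T r f) = integral {a..b} (\<lambda>r. T s f) - integral {a..b} (\<lambda>r. T r f)"
        by (rule Henstock_Kurzweil_Integration.integral_diff[OF integrable_const_ivl T_integrable[OF a0]])
      then have "measure lborel K *\<^sub>R T s f - integral K (\<lambda>s. T s f) = integral K (\<lambda>r. T s f - T r f)"
        using K \<open>a \<le> b\<close> by simp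
      also have "norm \<dots> \<le> e' * measure lborel (cbox a b)"
        unfolding K
      proof (rule has_integral_bound[OF _ integrable_integral])
        show "0 \<le> e'" using e' by simp
        show "(\<lambda>r. T s f - T r f) integrable_on cbox a b"
          using T_integrable[OF a0, of f b] by (auto intro: integrable_diff)
        show "norm (T s f - T r f) \<le> e'" if "r \<in> cbox a b" for r
        proof -
          have "r \<in> {0..N}" "s \<in> {0..N}" "dist s r < d" using that sub near K by auto
          then show ?thesis using d(2)[of r s] by (simp add: dist_norm)
        qed
      qed
      finally show "norm (measure lborel K *\<^sub>R T s f - integral K (\<lambda>s. T s f)) \<le> measure lborel K * e'"
        by (simp add: K mult.commute)
    qed
    also have "\<dots> = (\<Sum>(s, K)\<in>p. measure lborel K) * e'"
      by (simp add: sum_distrib_right case_prod_beta)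
    also have "(\<Sum>(s, K)\<in>p. measure lborel K) = N"
      using additive_content_tagged_division[OF p'] assms by simp
    also have "N * e' < e" using assms by (simp add: e'_def field_simps)
    finally show "norm ((\<Sum>(s, K)\<in>p. measure lborel K *\<^sub>R T s f) - S N f) < e" .
  qed
qed

end

section \<open>Square integrable functions as a Hilbert space\<close>

definition sq_integrable :: "('a::euclidean_space \<Rightarrow> 'b::euclidean_space) \<Rightarrow> bool" where
  "sq_integrable f \<longleftrightarrow> f \<in> borel_measurable lebesgue \<and> integrable lebesgue (\<lambda>x. (norm (f x))\<^sup>2)"

lemma sq_integrableD [measurable_dest]: "sq_integrable f \<Longrightarrow> f \<in> borel_measurable lebesgue"
  by (simp add: sq_integrable_def)

lemma sq_integrable_bound:
  assumes "f \<in> borel_measurable lebesgue" "integrable lebesgue h" "\<And>x. (norm (f x))\<^sup>2 \<le> h x"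
  shows "sq_integrable f"
  unfolding sq_integrable_def
proof
  show "integrable lebesgue (\<lambda>x. (norm (f x))\<^sup>2)"
    by (rule Bochner_Integration.integrable_bound[OF assms(2)])
      (use assms(1,3) in \<open>auto intro!: measurable_compose[OF _ borel_measurable_norm] order_trans[OF assms(3) abs_ge_self] borel_measurable_power\<close>)
qed (rule assms)

lemma sq_integrable_0: "sq_integrable (\<lambda>_. 0)"
  by (simp add: sq_integrable_def)

lemma sq_integrable_add:
  assumes "sq_integrable f" "sq_integrable g" shows "sq_integrable (\<lambda>x. f x + g x)"
proof (rule sq_integrable_bound)
  show "integrable lebesgue (\<lambda>x. 2 * (norm (f x))\<^sup>2 + 2 * (norm (g x))\<^sup>2)"
    using assms by (auto simp: sq_integrable_def)
  show "(norm (f x + g x))\<^sup>2 \<le> 2 * (norm (f x))\<^sup>2 + 2 * (norm (g x))\<^sup>2" for x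
  proof -
    have "(norm (f x + g x))\<^sup>2 \<le> (norm (f x) + norm (g x))\<^sup>2"
      by (intro power_mono norm_triangle_ineq) simp
    also have "\<dots> \<le> 2 * (norm (f x))\<^sup>2 + 2 * (norm (g x))\<^sup>2"
      using sum_squares_bound[of "norm (f x)" "norm (g x)"] by (simp add: power2_sum)
    finally show ?thesis .
  qed
qed (use assms in \<open>auto simp: sq_integrable_def\<close>)

lemma sq_integrable_scale: "sq_integrable f \<Longrightarrow> sq_integrable (\<lambda>x. c *\<^sub>R f x)"
  by (auto simp: sq_integrable_def power_mult_distrib)

lemma sq_integrable_minus: "sq_integrable f \<Longrightarrow> sq_integrable (\<lambda>x. - f x)"
  using sq_integrable_scale[of f "-1"] by simp

lemma sq_integrable_diff: "sq_integrable f \<Longrightarrow> sq_integrable g \<Longrightarrow> sq_integrable (\<lambda>x. f x - g x)"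
  using sq_integrable_add[OF _ sq_integrable_minus, of f g] by simp

lemma sq_integrable_inner:
  assumes "sq_integrable f" "sq_integrable g" shows "integrable lebesgue (\<lambda>x. f x \<bullet> g x)"
proof (rule Bochner_Integration.integrable_bound)
  show "integrable lebesgue (\<lambda>x. (norm (f x))\<^sup>2 + (norm (g x))\<^sup>2)"
    using assms by (auto simp: sq_integrable_def)
  have "\<bar>f x \<bullet> g x\<bar> \<le> (norm (f x))\<^sup>2 + (norm (g x))\<^sup>2" for x
  proof -
    have "\<bar>f x \<bullet> g x\<bar> \<le> norm (f x) * norm (g x)" by (rule Cauchy_Schwarz_ineq2)
    moreover have "2 * (norm (f x) * norm (g x)) \<le> (norm (f x))\<^sup>2 + (norm (g x))\<^sup>2"
      using sum_squares_bound[of "norm (f x)" "norm (g x)"] by simp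
    moreover have "0 \<le> norm (f x) * norm (g x)" by simp
    ultimately show ?thesis by linarith
  qed
  then show "AE x in lebesgue. norm (f x \<bullet> g x) \<le> norm ((norm (f x))\<^sup>2 + (norm (g x))\<^sup>2)"
    by (auto intro!: AE_I2 order_trans[OF _ abs_ge_self])
qed (use assms in \<open>auto simp: sq_integrable_def\<close>)

definition l2_rel :: "('a::euclidean_space \<Rightarrow> 'b::euclidean_space) \<Rightarrow> ('a \<Rightarrow> 'b) \<Rightarrow> bool" where
  "l2_rel f g \<longleftrightarrow> sq_integrable f \<and> sq_integrable g \<and> (AE x in lebesgue. f x = g x)"

text \<open>Classes modulo equality almost everywhere on the whole space. A type cannot depend on the domain
  \<open>D\<close>; functions on \<open>D\<close> will be functions that vanish outside \<open>D\<close>. Vector values accommodate gradients.\<close>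

quotient_type (overloaded) ('a, 'b) l2 = "'a::euclidean_space \<Rightarrow> 'b::euclidean_space" / partial: l2_rel
proof (rule part_equivpI)
  show "\<exists>x :: 'a \<Rightarrow> 'b. l2_rel x x" by (rule exI[of _ "\<lambda>_. 0"]) (simp add: l2_rel_def sq_integrable_0)
  show "symp (l2_rel :: ('a \<Rightarrow> 'b) \<Rightarrow> _)" by (auto simp: symp_def l2_rel_def elim: AE_mp)
  show "transp (l2_rel :: ('a \<Rightarrow> 'b) \<Rightarrow> _)" by (auto simp: transp_def l2_rel_def elim: AE_mp)
qed

instantiation l2 :: (euclidean_space, euclidean_space) real_inner
begin

lift_definition zero_l2 :: "('a, 'b) l2" is "\<lambda>_. 0" by (simp add: l2_rel_def sq_integrable_0)
lift_definition plus_l2 :: "('a, 'b) l2 \<Rightarrow> ('a, 'b) l2 \<Rightarrow> ('a, 'b) l2" is "\<lambda>f g x. f x + g x"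
  by (auto simp: l2_rel_def intro: sq_integrable_add)
lift_definition minus_l2 :: "('a, 'b) l2 \<Rightarrow> ('a, 'b) l2 \<Rightarrow> ('a, 'b) l2" is "\<lambda>f g x. f x - g x"
  by (auto simp: l2_rel_def intro: sq_integrable_diff)
lift_definition uminus_l2 :: "('a, 'b) l2 \<Rightarrow> ('a, 'b) l2" is "\<lambda>f x. - f x"
  by (auto simp: l2_rel_def intro: sq_integrable_minus)
lift_definition scaleR_l2 :: "real \<Rightarrow> ('a, 'b) l2 \<Rightarrow> ('a, 'b) l2" is "\<lambda>c f x. c *\<^sub>R f x"
  by (auto simp: l2_rel_def intro: sq_integrable_scale)
lift_definition inner_l2 :: "('a, 'b) l2 \<Rightarrow> ('a, 'b) l2 \<Rightarrow> real" is "\<lambda>f g. \<integral>x. f x \<bullet> g x \<partial>lebesgue"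
proof -
  fix f f' g g' :: "'a \<Rightarrow> 'b" assume *: "l2_rel f f'" "l2_rel g g'"
  show "(\<integral>x. f x \<bullet> g x \<partial>lebesgue) = (\<integral>x. f' x \<bullet> g' x \<partial>lebesgue)"
  proof (rule integral_cong_AE)
    show "AE x in lebesgue. f x \<bullet> g x = f' x \<bullet> g' x" using * by (auto simp: l2_rel_def)
  qed (use * in \<open>auto simp: l2_rel_def sq_integrable_def\<close>)
qed

definition norm_l2 :: "('a, 'b) l2 \<Rightarrow> real" where "norm_l2 f = sqrt (f \<bullet> f)"
definition dist_l2 :: "('a, 'b) l2 \<Rightarrow> ('a, 'b) l2 \<Rightarrow> real" where "dist_l2 f g = norm (f - g)"
definition sgn_l2 :: "('a, 'b) l2 \<Rightarrow> ('a, 'b) l2" where "sgn_l2 f = inverse (norm f) *\<^sub>R f"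
definition uniformity_l2 :: "(('a, 'b) l2 \<times> ('a, 'b) l2) filter" where
  "uniformity_l2 = (INF e\<in>{0<..}. principal {(x, y). dist x y < e})"
definition open_l2 :: "('a, 'b) l2 set \<Rightarrow> bool" where
  "open_l2 S = (\<forall>x\<in>S. \<forall>\<^sub>F (x', y) in uniformity. x' = x \<longrightarrow> y \<in> S)"

instance
proof
  fix a b c :: "('a, 'b) l2" and r s :: real
  show "a + b + c = a + (b + c)" by transfer (auto simp: l2_rel_def add.assoc intro!: sq_integrable_add)
  show "a + b = b + a" by transfer (auto simp: l2_rel_def add.commute intro!: sq_integrable_add)
  show "0 + a = a" by transfer (auto simp: l2_rel_def)
  show "- a + a = 0" by transfer (auto simp: l2_rel_def sq_integrable_0)
  show "a - b = a + - b" by transfer (auto simp: l2_rel_def intro!: sq_integrable_diff)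
  show "r *\<^sub>R (a + b) = r *\<^sub>R a + r *\<^sub>R b"
    by transfer (auto simp: l2_rel_def scaleR_add_right[symmetric] intro!: sq_integrable_add sq_integrable_scale)
  show "(r + s) *\<^sub>R a = r *\<^sub>R a + s *\<^sub>R a"
    by transfer (auto simp: l2_rel_def scaleR_add_left[symmetric] intro!: sq_integrable_scale)
  show "r *\<^sub>R s *\<^sub>R a = (r * s) *\<^sub>R a" by transfer (auto simp: l2_rel_def intro!: sq_integrable_scale)
  show "1 *\<^sub>R a = a" by transfer (auto simp: l2_rel_def)
  show "a \<bullet> b = b \<bullet> a" by transfer (simp add: inner_commute)
  show "(a + b) \<bullet> c = a \<bullet> c + b \<bullet> c"
    by transfer (auto simp: l2_rel_def inner_add_left sq_integrable_inner)
  show "r *\<^sub>R a \<bullet> b = r * (a \<bullet> b)" by transfer simp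
  show "0 \<le> a \<bullet> a" by transfer simp
  show "a \<bullet> a = 0 \<longleftrightarrow> a = 0"
  proof transfer
    fix f :: "'a \<Rightarrow> 'b" assume f: "l2_rel f f"
    have "(\<integral>x. f x \<bullet> f x \<partial>lebesgue) = 0 \<longleftrightarrow> (AE x in lebesgue. f x \<bullet> f x = 0)"
      using f by (intro integral_nonneg_eq_0_iff_AE) (auto simp: l2_rel_def intro!: sq_integrable_inner)
    then show "(\<integral>x. f x \<bullet> f x \<partial>lebesgue) = 0 \<longleftrightarrow> l2_rel f (\<lambda>_. 0)"
      using f by (simp add: l2_rel_def sq_integrable_0)
  qed
  show "norm a = sqrt (a \<bullet> a)" by (rule norm_l2_def)
  show "dist a b = norm (a - b)" by (rule dist_l2_def)
  show "sgn a = inverse (norm a) *\<^sub>R a" by (rule sgn_l2_def)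
  show "uniformity = (INF e\<in>{0<..}. principal {(x, y::('a, 'b) l2). dist x y < e})"
    by (rule uniformity_l2_def)
  show "open S = (\<forall>x\<in>S. \<forall>\<^sub>F (x', y) in uniformity. x' = x \<longrightarrow> y \<in> S)" for S :: "('a, 'b) l2 set"
    by (rule open_l2_def)
qed

end

abbreviation cls :: "('a::euclidean_space \<Rightarrow> 'b::euclidean_space) \<Rightarrow> ('a, 'b) l2" where
  "cls \<equiv> abs_l2"

abbreviation rep :: "('a::euclidean_space, 'b::euclidean_space) l2 \<Rightarrow> 'a \<Rightarrow> 'b" where
  "rep \<equiv> rep_l2"

lemma rep_sq_integrable [simp, intro]: "sq_integrable (rep f)"
  using Quotient3_rel_rep[OF Quotient3_l2, of f f] by (simp add: l2_rel_def)

lemma rep_measurable [measurable]: "rep f \<in> borel_measurable lebesgue"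
  by (simp add: sq_integrableD)

lemma cls_rep [simp]: "cls (rep f) = f"
  by (rule Quotient3_abs_rep[OF Quotient3_l2])

lemma cls_eq_iff: "sq_integrable f \<Longrightarrow> sq_integrable g \<Longrightarrow> cls f = cls g \<longleftrightarrow> (AE x in lebesgue. f x = g x)"
  using Quotient3_rel[OF Quotient3_l2, of f g] by (simp add: l2_rel_def)

lemma rep_cls: "sq_integrable f \<Longrightarrow> AE x in lebesgue. rep (cls f) x = f x"
  using cls_eq_iff[of "rep (cls f)" f] by simp

lemma l2_eqI: "(AE x in lebesgue. rep f x = rep g x) \<Longrightarrow> f = g"
  using cls_eq_iff[of "rep f" "rep g"] by simp

lemma cls_add: "sq_integrable f \<Longrightarrow> sq_integrable g \<Longrightarrow> cls f + cls g = cls (\<lambda>x. f x + g x)"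
  by (simp add: plus_l2.abs_eq l2_rel_def)

lemma cls_diff: "sq_integrable f \<Longrightarrow> sq_integrable g \<Longrightarrow> cls f - cls g = cls (\<lambda>x. f x - g x)"
  by (simp add: minus_l2.abs_eq l2_rel_def)

lemma cls_scale: "sq_integrable f \<Longrightarrow> c *\<^sub>R cls f = cls (\<lambda>x. c *\<^sub>R f x)"
  by (simp add: scaleR_l2.abs_eq l2_rel_def)

lemma cls_zero: "cls (\<lambda>_. 0) = 0"
  by (simp add: zero_l2_def)

lemma cls_inner: "sq_integrable f \<Longrightarrow> sq_integrable g \<Longrightarrow> cls f \<bullet> cls g = (\<integral>x. f x \<bullet> g x \<partial>lebesgue)"
  by (simp add: inner_l2.abs_eq l2_rel_def)

lemma l2_inner_rep: "f \<bullet> g = (\<integral>x. rep f x \<bullet> rep g x \<partial>lebesgue)"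
  using cls_inner[of "rep f" "rep g"] by simp

lemma l2_inner_cls: "sq_integrable g \<Longrightarrow> f \<bullet> cls g = (\<integral>x. rep f x \<bullet> g x \<partial>lebesgue)"
  using cls_inner[of "rep f" g] by simp

lemma l2_norm_cls: "sq_integrable f \<Longrightarrow> (norm (cls f))\<^sup>2 = (\<integral>x. (norm (f x))\<^sup>2 \<partial>lebesgue)"
  by (simp add: power2_norm_eq_inner cls_inner)

lemma rep_add: "AE x in lebesgue. rep (f + g) x = rep f x + rep g x"
  using rep_cls[OF sq_integrable_add[OF rep_sq_integrable[of f] rep_sq_integrable[of g]]]
  by (simp flip: cls_add)

lemma rep_diff: "AE x in lebesgue. rep (f - g) x = rep f x - rep g x"
  using rep_cls[OF sq_integrable_diff[OF rep_sq_integrable[of f] rep_sq_integrable[of g]]]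
  by (simp flip: cls_diff)

lemma rep_scale: "AE x in lebesgue. rep (c *\<^sub>R f) x = c *\<^sub>R rep f x"
  using rep_cls[OF sq_integrable_scale[OF rep_sq_integrable[of f]]]
  by (simp flip: cls_scale)

lemma nn_integral_norm_rep: "(\<integral>\<^sup>+x. ennreal ((norm (rep f x))\<^sup>2) \<partial>lebesgue) = ennreal ((norm f)\<^sup>2)"
proof -
  have "(\<integral>\<^sup>+x. ennreal ((norm (rep f x))\<^sup>2) \<partial>lebesgue) = ennreal (\<integral>x. (norm (rep f x))\<^sup>2 \<partial>lebesgue)"
    using rep_sq_integrable[of f] by (intro nn_integral_eq_integral) (auto simp: sq_integrable_def)
  also have "(\<integral>x. (norm (rep f x))\<^sup>2 \<partial>lebesgue) = (norm f)\<^sup>2"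
    using l2_norm_cls[OF rep_sq_integrable, of f] by simp
  finally show ?thesis .
qed

lemma summable_if_weighted_squares_bounded:
  fixes c :: "nat \<Rightarrow> real"
  assumes "\<And>n. 0 \<le> c n" "\<And>n. 2 ^ n * (c n)\<^sup>2 \<le> M"
  shows "summable c"
proof (rule summable_comparison_test'[of "\<lambda>n. sqrt M * (1 / sqrt 2) ^ n"])
  show "summable (\<lambda>n. sqrt M * (1 / sqrt 2) ^ n)"
    by (intro summable_mult summable_geometric) simp
  fix n :: nat
  have "(c n)\<^sup>2 \<le> M / 2 ^ n" using assms(2)[of n] by (simp add: field_simps)
  then have "c n \<le> sqrt (M / 2 ^ n)" using assms(1) by (simp add: real_le_rsqrt)
  also have "\<dots> = sqrt M * (1 / sqrt 2) ^ n" by (simp add: real_sqrt_divide real_sqrt_power power_one_over)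
  finally show "norm (c n) \<le> sqrt M * (1 / sqrt 2) ^ n" using assms(1) by simp
qed

text \<open>Along a subsequence with increments of norm at most \<open>2\<^sup>-\<^sup>n\<close>, the sum of the squared pointwise
  increments with weights \<open>2\<^sup>n\<close> has a finite integral, so the subsequence converges almost everywhere.
  Fatou's lemma turns this into convergence in norm.\<close>

instance l2 :: (euclidean_space, euclidean_space) complete_space
proof
  fix X :: "nat \<Rightarrow> ('a, 'b) l2" assume X: "Cauchy X"
  have "\<exists>r. strict_mono r \<and> (\<forall>n. norm (X (r (Suc n)) - X (r n)) < (1/2) ^ n)"
  proof -
    have "\<exists>r. \<forall>n. (\<forall>i\<ge>r n. \<forall>j\<ge>r n. norm (X i - X j) < (1/2) ^ n) \<and> r n < r (Suc n)"
    proof (intro dependent_nat_choice)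
      show "\<exists>x. \<forall>i\<ge>x. \<forall>j\<ge>x. norm (X i - X j) < (1/2) ^ 0" using X unfolding Cauchy_iff by simp
      fix x n
      obtain N where N: "\<And>i j. i \<ge> N \<Longrightarrow> j \<ge> N \<Longrightarrow> norm (X i - X j) < (1/2) ^ Suc n"
        using X unfolding Cauchy_iff by (metis half_gt_zero zero_less_one zero_less_power)
      show "\<exists>y. (\<forall>i\<ge>y. \<forall>j\<ge>y. norm (X i - X j) < (1/2) ^ Suc n) \<and> x < y"
        by (rule exI[of _ "max N (Suc x)"]) (use N in auto)
    qed
    then obtain r where r: "\<forall>n. (\<forall>i\<ge>r n. \<forall>j\<ge>r n. norm (X i - X j) < (1/2) ^ n) \<and> r n < r (Suc n)"
      by (rule exE)
    have "norm (X (r (Suc n)) - X (r n)) < (1/2) ^ n" for n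
      using r[rule_format, of n] less_imp_le[of "r n" "r (Suc n)"] order_refl[of "r n"] by metis
    moreover have "strict_mono r" unfolding strict_mono_Suc_iff using r by simp
    ultimately show ?thesis by (intro exI[of _ r] conjI allI)
  qed
  then obtain r where r: "strict_mono r \<and> (\<forall>n. norm (X (r (Suc n)) - X (r n)) < (1/2) ^ n)"
    by (rule exE)
  note r = conjunct1[OF r] spec[OF conjunct2[OF r]]
  define f where "f n = rep (X (r n))" for n
  have [measurable]: "f n \<in> borel_measurable lebesgue" for n by (simp add: f_def)
  define g where "g n x = norm (f (Suc n) x - f n x)" for n x
  have g_int: "(\<integral>\<^sup>+x. ennreal (2 ^ n * (g n x)\<^sup>2) \<partial>lebesgue) \<le> ennreal ((1/2) ^ n)" for n
  proof -
    have "(\<integral>\<^sup>+x. ennreal (2 ^ n * (g n x)\<^sup>2) \<partial>lebesgue) = ennreal (2 ^ n) * (\<integral>\<^sup>+x. ennreal ((g n x)\<^sup>2) \<partial>lebesgue)"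
      by (subst nn_integral_cmult[symmetric]) (auto simp: g_def ennreal_mult')
    also have "(\<integral>\<^sup>+x. ennreal ((g n x)\<^sup>2) \<partial>lebesgue) = (\<integral>\<^sup>+x. ennreal ((norm (rep (X (r (Suc n)) - X (r n)) x))\<^sup>2) \<partial>lebesgue)"
      using rep_diff[of "X (r (Suc n))" "X (r n)"] by (intro nn_integral_cong_AE) (auto simp: g_def f_def)
    also have "\<dots> = ennreal ((norm (X (r (Suc n)) - X (r n)))\<^sup>2)" by (rule nn_integral_norm_rep)
    also have "ennreal (2 ^ n) * \<dots> \<le> ennreal (2 ^ n) * ennreal (((1/2) ^ n)\<^sup>2)"
      using r(2)[of n] by (intro mult_left_mono ennreal_leI power_mono) auto
    also have "\<dots> = ennreal ((1/2) ^ n)"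
      by (simp add: ennreal_mult[symmetric] power2_eq_square power_one_over)
    finally show ?thesis .
  qed
  have "(\<integral>\<^sup>+x. (\<Sum>n. ennreal (2 ^ n * (g n x)\<^sup>2)) \<partial>lebesgue) = (\<Sum>n. \<integral>\<^sup>+x. ennreal (2 ^ n * (g n x)\<^sup>2) \<partial>lebesgue)"
    by (rule nn_integral_suminf) (auto simp: g_def)
  also have "\<dots> \<le> (\<Sum>n. ennreal ((1/2) ^ n))" by (intro suminf_le g_int) auto
  also have "\<dots> = ennreal (\<Sum>n. (1/2) ^ n)" by (rule suminf_ennreal2) auto
  also have "\<dots> < \<infinity>" by simp
  finally have fin: "(\<integral>\<^sup>+x. (\<Sum>n. ennreal (2 ^ n * (g n x)\<^sup>2)) \<partial>lebesgue) < \<infinity>" .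
  have "AE x in lebesgue. (\<Sum>n. ennreal (2 ^ n * (g n x)\<^sup>2)) \<noteq> \<infinity>"
  proof (rule nn_integral_PInf_AE)
    show "(\<lambda>x. \<Sum>n. ennreal (2 ^ n * (g n x)\<^sup>2)) \<in> borel_measurable lebesgue"
      unfolding g_def by measurable
  qed (rule less_imp_neq[OF fin])
  then have conv: "AE x in lebesgue. convergent (\<lambda>n. f n x)"
  proof eventually_elim
    fix x assume fin: "(\<Sum>n. ennreal (2 ^ n * (g n x)\<^sup>2)) \<noteq> \<infinity>"
    define c where "c n = 2 ^ n * (g n x)\<^sup>2" for n
    define M where "M = enn2real (\<Sum>n. ennreal (c n))"
    have M: "(\<Sum>n. ennreal (c n)) = ennreal M"
      using fin by (simp add: M_def c_def ennreal_enn2real less_top)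
    have "c n \<le> M" for n
    proof -
      have "ennreal (c n) \<le> (\<Sum>n. ennreal (c n))"
        using sum_le_suminf[of "\<lambda>n. ennreal (c n)" "{n}"] by simp
      then show ?thesis unfolding M by (simp add: ennreal_le_iff M_def)
    qed
    then have "\<And>n. 2 ^ n * (g n x)\<^sup>2 \<le> M" by (simp add: c_def)
    then have "summable (\<lambda>n. g n x)"
      by (intro summable_if_weighted_squares_bounded[of _ M]) (auto simp: g_def)
    then have "summable (\<lambda>n. f (Suc n) x - f n x)" unfolding g_def by (rule summable_norm_cancel)
    then have "convergent (\<lambda>n. f n x - f 0 x)"
      by (simp only: summable_iff_convergent sum_lessThan_telescope[of "\<lambda>n. f n x"])
    from convergent_add[OF this convergent_const[of "f 0 x"]]
    show "convergent (\<lambda>n. f n x)" by simp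
  qed
  define h where "h x = lim (\<lambda>n. f n x)" for x
  have [measurable]: "h \<in> borel_measurable lebesgue"
    unfolding h_def by (rule borel_measurable_lim_metric) simp
  have lim: "AE x in lebesgue. (\<lambda>n. f n x) \<longlonglongrightarrow> h x"
    using conv by eventually_elim (simp add: h_def convergent_LIMSEQ_iff)
  have key: "sq_integrable h \<and> norm (X n - cls h) \<le> e"
    if e: "e > 0" and N: "\<And>m n. m \<ge> N \<Longrightarrow> n \<ge> N \<Longrightarrow> norm (X m - X n) < e" and n: "n \<ge> N" for e N n
  proof -
    have meas: "(\<lambda>x. ennreal ((norm (f m x - rep (X n) x))\<^sup>2)) \<in> borel_measurable lebesgue" for m
      by measurable
    have "(\<integral>\<^sup>+x. ennreal ((norm (h x - rep (X n) x))\<^sup>2) \<partial>lebesgue) =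
        (\<integral>\<^sup>+x. liminf (\<lambda>m. ennreal ((norm (f m x - rep (X n) x))\<^sup>2)) \<partial>lebesgue)"
    proof (rule nn_integral_cong_AE)
      show "AE x in lebesgue. ennreal ((norm (h x - rep (X n) x))\<^sup>2) =
          liminf (\<lambda>m. ennreal ((norm (f m x - rep (X n) x))\<^sup>2))"
        using lim
      proof eventually_elim
        fix x assume "(\<lambda>n. f n x) \<longlonglongrightarrow> h x"
        then have "(\<lambda>m. ennreal ((norm (f m x - rep (X n) x))\<^sup>2)) \<longlonglongrightarrow> ennreal ((norm (h x - rep (X n) x))\<^sup>2)"
          by (intro tendsto_ennrealI tendsto_intros)
        then show "ennreal ((norm (h x - rep (X n) x))\<^sup>2) = liminf (\<lambda>m. ennreal ((norm (f m x - rep (X n) x))\<^sup>2))"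
          by (rule lim_imp_Liminf[OF trivial_limit_sequentially, symmetric])
      qed
    qed
    also have "\<dots> \<le> liminf (\<lambda>m. \<integral>\<^sup>+x. ennreal ((norm (f m x - rep (X n) x))\<^sup>2) \<partial>lebesgue)"
      by (rule nn_integral_liminf[OF meas])
    also have "\<dots> \<le> ennreal (e\<^sup>2)"
    proof (rule Liminf_le)
      show "\<forall>\<^sub>F m in sequentially. (\<integral>\<^sup>+x. ennreal ((norm (f m x - rep (X n) x))\<^sup>2) \<partial>lebesgue) \<le> ennreal (e\<^sup>2)"
        unfolding eventually_sequentially
      proof (intro exI[of _ N] allI impI)
        fix m assume "m \<ge> N"
        then have rm: "r m \<ge> N" using seq_suble[OF r(1), of m] by simp
        have "(\<integral>\<^sup>+x. ennreal ((norm (f m x - rep (X n) x))\<^sup>2) \<partial>lebesgue) =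
            (\<integral>\<^sup>+x. ennreal ((norm (rep (X (r m) - X n) x))\<^sup>2) \<partial>lebesgue)"
          using rep_diff[of "X (r m)" "X n"] by (intro nn_integral_cong_AE) (auto simp: f_def)
        also have "\<dots> = ennreal ((norm (X (r m) - X n))\<^sup>2)" by (rule nn_integral_norm_rep)
        also have "\<dots> \<le> ennreal (e\<^sup>2)"
          using N[OF rm n] by (intro ennreal_leI power_mono) auto
        finally show "(\<integral>\<^sup>+x. ennreal ((norm (f m x - rep (X n) x))\<^sup>2) \<partial>lebesgue) \<le> ennreal (e\<^sup>2)" .
      qed
    qed simp
    finally have bnd: "(\<integral>\<^sup>+x. ennreal ((norm (h x - rep (X n) x))\<^sup>2) \<partial>lebesgue) \<le> ennreal (e\<^sup>2)" .
    have sq: "sq_integrable (\<lambda>x. h x - rep (X n) x)"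
      unfolding sq_integrable_def
    proof
      show "integrable lebesgue (\<lambda>x. (norm (h x - rep (X n) x))\<^sup>2)"
        using bnd by (intro integrableI_nonneg) (auto simp: less_top[symmetric] top_unique)
    qed measurable
    then have h: "sq_integrable h" using sq_integrable_add[OF sq rep_sq_integrable[of "X n"]] by simp
    have "(norm (cls h - X n))\<^sup>2 = (\<integral>x. (norm (h x - rep (X n) x))\<^sup>2 \<partial>lebesgue)"
      using l2_norm_cls[OF sq] cls_diff[OF h rep_sq_integrable[of "X n"]] by simp
    also have "ennreal \<dots> \<le> ennreal (e\<^sup>2)"
      using sq bnd by (subst nn_integral_eq_integral[symmetric]) (auto simp: sq_integrable_def)
    finally have "(norm (cls h - X n))\<^sup>2 \<le> e\<^sup>2" by (simp add: ennreal_le_iff)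
    then have "norm (cls h - X n) \<le> e" by (rule power2_le_imp_le) (use e in simp)
    with h show ?thesis unfolding norm_minus_commute[of "X n"] by blast
  qed
  have "X \<longlonglongrightarrow> cls h"
  proof (rule LIMSEQ_I)
    fix e :: real assume e: "e > 0"
    then have e2: "e / 2 > 0" by simp
    obtain N where "\<forall>m\<ge>N. \<forall>n\<ge>N. norm (X m - X n) < e / 2"
      using CauchyD[OF X e2] by (rule exE)
    then have N: "\<And>m n. m \<ge> N \<Longrightarrow> n \<ge> N \<Longrightarrow> norm (X m - X n) < e / 2" by simp
    have "norm (X n - cls h) < e" if "n \<ge> N" for n
      using key[OF e2 N that] e by simp
    then show "\<exists>N. \<forall>n\<ge>N. norm (X n - cls h) < e" by blast
  qed
  then show "convergent X" unfolding convergent_def by blast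
qed

instance l2 :: (euclidean_space, euclidean_space) banach ..

lemma l2_nontrivial: "\<exists>v :: ('a::euclidean_space, 'b::euclidean_space) l2. v \<noteq> 0"
proof -
  obtain b :: 'b where b: "b \<in> Basis" using nonempty_Basis by blast
  define f :: "'a \<Rightarrow> 'b" where "f x = indicator (cball 0 1) x *\<^sub>R b" for x
  have "integrable lebesgue (indicator (cball 0 1) :: 'a \<Rightarrow> real)"
    by (rule integrable_real_indicator) (use emeasure_lborel_cball_finite in simp_all)
  moreover have "f \<in> borel_measurable lebesgue"
    unfolding f_def[abs_def] by (intro borel_measurable_scaleR borel_measurable_indicator) auto
  moreover have n2: "(norm (f x))\<^sup>2 = indicator (cball 0 1) x" for x using b by (simp add: f_def indicator_def)
  ultimately have f: "sq_integrable f"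
    by (simp add: sq_integrable_def)
  have "(norm (cls f))\<^sup>2 = measure lebesgue (cball (0::'a) 1)"
    using l2_norm_cls[OF f] by (simp add: n2)
  also have "\<dots> > 0" by (simp add: content_cball_pos)
  finally show ?thesis by force
qed

instance l2 :: (euclidean_space, euclidean_space) perfect_space
proof
  fix x :: "('a, 'b) l2"
  show "\<not> open {x}"
  proof
    assume "open {x}"
    then obtain e where e: "e > 0" "ball x e \<subseteq> {x}" unfolding open_contains_ball by blast
    obtain v :: "('a, 'b) l2" where v: "v \<noteq> 0" using l2_nontrivial by blast
    have "x + (e / 2 / norm v) *\<^sub>R v \<in> ball x e" using e v by (simp add: dist_norm)
    then have "(e / 2 / norm v) *\<^sub>R v = 0" using e(2) by auto
    then show False using e(1) v by simp
  qed
qed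

section \<open>Smooth functions\<close>

text \<open>\<open>flat 0\<close> is the classical smooth function that vanishes on the negative half line;
  the span of the family \<open>flat k\<close> is closed under differentiation.\<close>

definition flat :: "nat \<Rightarrow> real \<Rightarrow> real" where
  "flat k t = (if t > 0 then exp (- 1 / t) / t ^ k else 0)"

lemma flat_nonneg: "0 \<le> flat k t" by (simp add: flat_def)

lemma flat_0_pos: "t > 0 \<Longrightarrow> 0 < flat 0 t" by (simp add: flat_def)

lemma flat_0_le_1: "flat 0 t \<le> 1" by (simp add: flat_def)

lemma flat_tendsto_0: "(flat k \<longlongrightarrow> 0) (at 0)"
proof (rule filterlim_split_at)
  have "\<forall>\<^sub>F t in at_left 0. 0 = flat k t"
    unfolding eventually_at_left_field by (intro exI[of _ "-1"]) (simp add: flat_def)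
  then show "(flat k \<longlongrightarrow> 0) (at_left 0)" by (rule Lim_transform_eventually[OF tendsto_const])
  have "((\<lambda>t. (inverse t) ^ k / exp (inverse t)) \<longlongrightarrow> 0) (at_right (0::real))"
    by (rule filterlim_compose[OF tendsto_power_div_exp_0 filterlim_inverse_at_top_right])
  moreover have "\<forall>\<^sub>F t in at_right 0. (inverse t) ^ k / exp (inverse t) = flat k t"
    unfolding eventually_at_right_field
    by (intro exI[of _ 1]) (auto simp: flat_def exp_minus field_simps)
  ultimately show "(flat k \<longlongrightarrow> 0) (at_right 0)" by (rule Lim_transform_eventually)
qed

lemma flat_derivative: "(flat k has_real_derivative (flat (k + 2) t - real k * flat (k + 1) t)) (at t)"
proof (cases t "0 :: real" rule: linorder_cases)
  case less
  have "((\<lambda>_. 0 :: real) has_real_derivative 0) (at t)" by simp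
  then have "(flat k has_real_derivative 0) (at t)"
    by (rule has_field_derivative_transform_within_open[of _ _ _ "{..<0}"]) (use less in \<open>auto simp: flat_def\<close>)
  then show ?thesis using less by (simp add: flat_def)
next
  case equal
  have "(\<lambda>h. (flat k (0 + h) - flat k 0) / h) = flat (k + 1)"
    by (auto simp: flat_def fun_eq_iff)
  then have "(flat k has_real_derivative 0) (at 0)" using flat_tendsto_0[of "k + 1"] by (simp add: DERIV_def)
  then show ?thesis using equal by (simp add: flat_def)
next
  case greater
  have "((\<lambda>t. exp (- 1 / t) / t ^ k) has_real_derivative (flat (k + 2) t - real k * flat (k + 1) t)) (at t)"
  proof -
    have "((\<lambda>t. exp (- 1 / t) / t ^ k) has_real_derivative
        (exp (- 1 / t) * (1 / t\<^sup>2) * t ^ k - exp (- 1 / t) * (real k * t ^ (k - 1))) / (t ^ k * t ^ k)) (at t)"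
      using greater by (auto intro!: derivative_eq_intros simp: power2_eq_square)
    moreover have "(exp (- 1 / t) * (1 / t\<^sup>2) * t ^ k - exp (- 1 / t) * (real k * t ^ (k - 1))) / (t ^ k * t ^ k) =
        flat (k + 2) t - real k * flat (k + 1) t"
      using greater by (cases k) (auto simp: flat_def field_simps power2_eq_square)
    ultimately show ?thesis by simp
  qed
  then show ?thesis
    by (rule has_field_derivative_transform_within_open[of _ _ _ "{0<..}"]) (use greater in \<open>auto simp: flat_def\<close>)
qed

text \<open>A class of functions that contains bumps and is closed under partial derivatives, so that
  its members are smooth.\<close>

inductive tame :: "('a::euclidean_space \<Rightarrow> real) \<Rightarrow> bool" where
  tame_const: "tame (\<lambda>x. c)"
| tame_inner: "tame (\<lambda>x. x \<bullet> a)"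
| tame_add: "tame f \<Longrightarrow> tame g \<Longrightarrow> tame (\<lambda>x. f x + g x)"
| tame_mult: "tame f \<Longrightarrow> tame g \<Longrightarrow> tame (\<lambda>x. f x * g x)"
| tame_flat: "tame f \<Longrightarrow> tame (\<lambda>x. flat k (f x))"

lemma tame_derivative:
  assumes "tame f"
  shows "\<exists>f'. (\<forall>x. (f has_derivative f' x) (at x)) \<and> (\<forall>b. tame (\<lambda>x. f' x b))"
  using assms
proof induction
  case (tame_const c)
  show ?case by (rule exI[of _ "\<lambda>x h. 0"]) (auto intro: tame.tame_const)
next
  case (tame_inner a)
  show ?case by (rule exI[of _ "\<lambda>x h. h \<bullet> a"]) (auto intro!: derivative_eq_intros tame.tame_const)
next
  case (tame_add f g)
  then obtain f' g' where "\<forall>x. (f has_derivative f' x) (at x)" "\<forall>b. tame (\<lambda>x. f' x b)"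
    "\<forall>x. (g has_derivative g' x) (at x)" "\<forall>b. tame (\<lambda>x. g' x b)" by blast
  then show ?case
    by (intro exI[of _ "\<lambda>x h. f' x h + g' x h"]) (auto intro: has_derivative_add tame.tame_add)
next
  case (tame_mult f g)
  then obtain f' g' where "\<forall>x. (f has_derivative f' x) (at x)" "\<forall>b. tame (\<lambda>x. f' x b)"
    "\<forall>x. (g has_derivative g' x) (at x)" "\<forall>b. tame (\<lambda>x. g' x b)" by blast
  then show ?case
    by (intro exI[of _ "\<lambda>x h. f x * g' x h + f' x h * g x"] conjI allI has_derivative_mult
        tame.tame_add tame.tame_mult[OF tame_mult.hyps(1)] tame.tame_mult[OF _ tame_mult.hyps(2)]) blast+
next
  case (tame_flat f k)
  then obtain f' where f': "\<forall>x. (f has_derivative f' x) (at x)" "\<forall>b. tame (\<lambda>x. f' x b)" by blast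
  show ?case
  proof (intro exI[of _ "\<lambda>x h. (flat (k + 2) (f x) + (- real k) * flat (k + 1) (f x)) * f' x h"] conjI allI)
    fix x
    have "(flat k has_derivative (\<lambda>h. (flat (k + 2) (f x) - real k * flat (k + 1) (f x)) * h)) (at (f x))"
      using flat_derivative[of k "f x"] by (simp add: has_field_derivative_def)
    from has_derivative_compose[OF spec[OF f'(1)] this]
    show "((\<lambda>x. flat k (f x)) has_derivative
        (\<lambda>h. (flat (k + 2) (f x) + (- real k) * flat (k + 1) (f x)) * f' x h)) (at x)" by simp
  next
    fix b
    show "tame (\<lambda>x. (flat (k + 2) (f x) + (- real k) * flat (k + 1) (f x)) * f' x b)"
      by (intro tame.intros tame_flat.hyps f'(2)[rule_format])
  qed
qed

lemma tame_differentiable: "tame f \<Longrightarrow> f differentiable (at x)"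
  using tame_derivative[of f] by (auto simp: differentiable_def)

lemma tame_pderiv:
  assumes "tame f" shows "tame (\<lambda>x. frechet_derivative f (at x) b)"
proof -
  obtain f' where f': "\<And>x. (f has_derivative f' x) (at x)" "\<And>b. tame (\<lambda>x. f' x b)"
    using tame_derivative[OF assms] by blast
  have "frechet_derivative f (at x) = f' x" for x
    by (rule frechet_derivative_at[OF f'(1), symmetric])
  then show ?thesis using f'(2) by simp
qed

lemma tame_smooth: assumes "tame f" shows "smooth_fun f"
proof -
  have "tame (iter_pderiv bs f)" for bs
    by (induction bs) (auto intro: assms tame_pderiv)
  then show ?thesis unfolding smooth_fun_def using tame_differentiable by blast
qed

lemma tame_continuous: "tame f \<Longrightarrow> continuous_on UNIV f"
  by (simp add: continuous_at_imp_continuous_on differentiable_imp_continuous_within tame_differentiable)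

lemma tame_prod: "finite I \<Longrightarrow> (\<And>i. i \<in> I \<Longrightarrow> tame (f i)) \<Longrightarrow> tame (\<lambda>x. \<Prod>i\<in>I. f i x)"
  by (induction I rule: finite_induct) (auto intro: tame.intros)

lemma tame_sum: "finite I \<Longrightarrow> (\<And>i. i \<in> I \<Longrightarrow> tame (f i)) \<Longrightarrow> tame (\<lambda>x. \<Sum>i\<in>I. f i x)"
  by (induction I rule: finite_induct) (auto intro: tame.intros)

lemma tame_affine: "tame (\<lambda>x. c + d * (x \<bullet> a))"
  by (intro tame.intros)

lemma iter_pderiv_differentiable:
  "smooth_fun f \<Longrightarrow> set bs \<subseteq> Basis \<Longrightarrow> iter_pderiv bs f differentiable (at x)"
  unfolding smooth_fun_def by blast

lemma iter_pderiv_has_derivative: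
  "smooth_fun f \<Longrightarrow> set bs \<subseteq> Basis \<Longrightarrow>
    (iter_pderiv bs f has_derivative frechet_derivative (iter_pderiv bs f) (at x)) (at x)"
  using iter_pderiv_differentiable frechet_derivative_works by blast

lemma smooth_fun_differentiable: "smooth_fun f \<Longrightarrow> f differentiable (at x)"
  using iter_pderiv_differentiable[of f "[]"] by simp

lemma smooth_fun_pderiv_continuous:
  assumes "smooth_fun f" "i \<in> Basis"
  shows "continuous_on UNIV (\<lambda>x. frechet_derivative f (at x) i)"
  using iter_pderiv_differentiable[of f "[i]"] assms
  by (auto intro!: continuous_at_imp_continuous_on differentiable_imp_continuous_within)

lemma smooth_fun_add:
  assumes f: "smooth_fun f" and g: "smooth_fun g" shows "smooth_fun (\<lambda>x. f x + g x)"
proof -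
  have "iter_pderiv bs (\<lambda>x. f x + g x) = (\<lambda>x. iter_pderiv bs f x + iter_pderiv bs g x)"
    if "set bs \<subseteq> Basis" for bs
    using that
  proof (induction bs)
    case (Cons b bs)
    have "frechet_derivative (\<lambda>x. iter_pderiv bs f x + iter_pderiv bs g x) (at x) =
        (\<lambda>h. frechet_derivative (iter_pderiv bs f) (at x) h + frechet_derivative (iter_pderiv bs g) (at x) h)" for x
      by (rule frechet_derivative_at[symmetric], intro has_derivative_add)
        (use Cons f g in \<open>auto intro: iter_pderiv_has_derivative\<close>)
    then show ?case using Cons by simp
  qed simp
  then show ?thesis unfolding smooth_fun_def
    using iter_pderiv_differentiable[OF f] iter_pderiv_differentiable[OF g] by auto
qed

lemma smooth_fun_scale:
  assumes f: "smooth_fun f" shows "smooth_fun (\<lambda>x. c * f x)"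
proof -
  have "iter_pderiv bs (\<lambda>x. c * f x) = (\<lambda>x. c * iter_pderiv bs f x)"
    if "set bs \<subseteq> Basis" for bs
    using that
  proof (induction bs)
    case (Cons b bs)
    have "frechet_derivative (\<lambda>x. c * iter_pderiv bs f x) (at x) =
        (\<lambda>h. c * frechet_derivative (iter_pderiv bs f) (at x) h)" for x
      by (rule frechet_derivative_at[symmetric], intro has_derivative_mult_right)
        (use Cons f in \<open>auto intro: iter_pderiv_has_derivative\<close>)
    then show ?case using Cons by simp
  qed simp
  then show ?thesis unfolding smooth_fun_def
    using iter_pderiv_differentiable[OF f] by auto
qed

lemma smooth_fun_translate:
  assumes f: "smooth_fun f" shows "smooth_fun (\<lambda>x. f (x - a))"
proof -
  have D: "((\<lambda>x. g (x - a)) has_derivative frechet_derivative g (at (x - a))) (at x)"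
    if "g differentiable (at (x - a))" for g :: "'a \<Rightarrow> real" and x
  proof -
    have "((\<lambda>x. x - a) has_derivative (\<lambda>h. h)) (at x)" by (auto intro!: derivative_eq_intros)
    then show ?thesis
      by (rule has_derivative_compose) (use that frechet_derivative_works in blast)
  qed
  have "iter_pderiv bs (\<lambda>x. f (x - a)) = (\<lambda>x. iter_pderiv bs f (x - a))"
    if "set bs \<subseteq> Basis" for bs
    using that
  proof (induction bs)
    case (Cons b bs)
    have "frechet_derivative (\<lambda>x. iter_pderiv bs f (x - a)) (at x) = frechet_derivative (iter_pderiv bs f) (at (x - a))" for x
      by (rule frechet_derivative_at[symmetric], rule D)
        (use Cons f iter_pderiv_differentiable in auto)
    then show ?case using Cons by simp
  qed simp
  then show ?thesis unfolding smooth_fun_def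
    using iter_pderiv_differentiable[OF f] D differentiable_def by (auto simp: differentiable_def) metis
qed

section \<open>Test functions and weak derivatives\<close>

lemma test_funI:
  assumes "smooth_fun \<phi>" "compact K" "K \<subseteq> D" "\<And>x. x \<notin> K \<Longrightarrow> \<phi> x = 0"
  shows "\<phi> \<in> test_fun D"
proof -
  have "closure {x. \<phi> x \<noteq> 0} \<subseteq> K"
    by (rule closure_minimal) (use assms compact_imp_closed in auto)
  moreover have "compact (closure {x. \<phi> x \<noteq> 0})"
    using calculation assms(2) by (meson bounded_subset closed_closure compact_eq_bounded_closed)
  ultimately show ?thesis using assms unfolding test_fun_def by auto
qed

lemma test_funE:
  assumes "\<phi> \<in> test_fun D"
  obtains K where "smooth_fun \<phi>" "compact K" "K \<subseteq> D" "\<And>x. x \<notin> K \<Longrightarrow> \<phi> x = 0"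
    "\<And>x i. x \<notin> K \<Longrightarrow> frechet_derivative \<phi> (at x) i = 0"
proof -
  define K where "K = closure {x. \<phi> x \<noteq> 0}"
  have "frechet_derivative \<phi> (at x) i = 0" if "x \<notin> K" for x i
  proof -
    have "(\<phi> has_derivative (\<lambda>_. 0)) (at x)"
    proof (rule has_derivative_transform_within_open[OF has_derivative_const[of 0]])
      show "open (- K)" by (simp add: K_def open_Compl)
      show "x \<in> - K" using that by simp
      show "0 = \<phi> y" if "y \<in> - K" for y
        using that closure_subset[of "{x. \<phi> x \<noteq> 0}"] unfolding K_def by auto
    qed
    then show ?thesis by (simp add: frechet_derivative_at[symmetric])
  qed
  moreover have "\<phi> x = 0" if "x \<notin> K" for x
    using that closure_subset[of "{x. \<phi> x \<noteq> 0}"] unfolding K_def by auto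
  moreover have "smooth_fun \<phi>" "compact K" "K \<subseteq> D" using assms unfolding test_fun_def K_def by auto
  ultimately show ?thesis by (intro that)
qed

lemma test_fun_mono: "\<phi> \<in> test_fun C \<Longrightarrow> C \<subseteq> D \<Longrightarrow> \<phi> \<in> test_fun D"
  unfolding test_fun_def by auto

lemma test_fun_add: assumes "\<phi> \<in> test_fun D" "\<psi> \<in> test_fun D" shows "(\<lambda>x. \<phi> x + \<psi> x) \<in> test_fun D"
proof (rule test_funE[OF assms(1)], rule test_funE[OF assms(2)])
  fix K L assume "smooth_fun \<phi>" "compact K" "K \<subseteq> D" "\<And>x. x \<notin> K \<Longrightarrow> \<phi> x = 0"
    and "smooth_fun \<psi>" "compact L" "L \<subseteq> D" "\<And>x. x \<notin> L \<Longrightarrow> \<psi> x = 0"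
  then show ?thesis
    by (intro test_funI[of _ "K \<union> L"]) (auto intro: smooth_fun_add)
qed

lemma test_fun_scale: assumes "\<phi> \<in> test_fun D" shows "(\<lambda>x. c * \<phi> x) \<in> test_fun D"
proof (rule test_funE[OF assms])
  fix K assume "smooth_fun \<phi>" "compact K" "K \<subseteq> D" "\<And>x. x \<notin> K \<Longrightarrow> \<phi> x = 0"
  then show ?thesis by (intro test_funI[of _ K]) (auto intro: smooth_fun_scale)
qed

lemma test_fun_has_derivative:
  "\<phi> \<in> test_fun D \<Longrightarrow> (\<phi> has_derivative frechet_derivative \<phi> (at x)) (at x)"
  using smooth_fun_differentiable frechet_derivative_works unfolding test_fun_def by blast

lemma test_fun_continuous: "\<phi> \<in> test_fun D \<Longrightarrow> continuous_on UNIV \<phi>"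
  by (meson continuous_at_imp_continuous_on has_derivative_continuous test_fun_has_derivative)

lemma test_fun_pderiv_continuous:
  "\<phi> \<in> test_fun D \<Longrightarrow> i \<in> Basis \<Longrightarrow> continuous_on UNIV (\<lambda>x. frechet_derivative \<phi> (at x) i)"
  using smooth_fun_pderiv_continuous unfolding test_fun_def by blast

lemma pderiv_add:
  assumes "\<phi> \<in> test_fun D" "\<psi> \<in> test_fun D"
  shows "frechet_derivative (\<lambda>x. \<phi> x + \<psi> x) (at x) i = frechet_derivative \<phi> (at x) i + frechet_derivative \<psi> (at x) i"
  using fun_cong[OF frechet_derivative_at[OF has_derivative_add[OF test_fun_has_derivative[OF assms(1)]
          test_fun_has_derivative[OF assms(2)]]], of x i] by simp

lemma pderiv_scale:
  assumes "\<phi> \<in> test_fun D"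
  shows "frechet_derivative (\<lambda>x. c * \<phi> x) (at x) i = c * frechet_derivative \<phi> (at x) i"
  using fun_cong[OF frechet_derivative_at[OF has_derivative_mult_right[OF test_fun_has_derivative[OF assms(1)]]], of c x i]
  by simp

lemma compact_support_bound:
  fixes f :: "'a::euclidean_space \<Rightarrow> real"
  assumes "continuous_on UNIV f" "compact K" "\<And>x. x \<notin> K \<Longrightarrow> f x = 0"
  obtains B where "B \<ge> 0" "\<And>x. \<bar>f x\<bar> \<le> B * indicator K x"
proof -
  have "bounded (f ` K)"
    by (intro compact_imp_bounded compact_continuous_image continuous_on_subset[OF assms(1)] assms) auto
  then obtain B where B: "\<And>x. x \<in> K \<Longrightarrow> \<bar>f x\<bar> \<le> B" "B > 0" unfolding bounded_pos by auto
  show ?thesis by (rule that[of B]) (use B assms(3) in \<open>auto simp: indicator_def\<close>)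
qed

lemma continuous_lebesgue_measurable:
  fixes f :: "'a::euclidean_space \<Rightarrow> 'b::euclidean_space"
  shows "continuous_on UNIV f \<Longrightarrow> f \<in> borel_measurable lebesgue"
  by (intro measurable_completion) (simp add: borel_measurable_continuous_onI)

lemma integrable_indicator_lmeasurable: "K \<in> lmeasurable \<Longrightarrow> integrable lebesgue (indicat_real K)"
  by (intro integrable_real_indicator) (auto simp: fmeasurable_def)

lemma sq_integrable_bounded_support:
  fixes f :: "'a::euclidean_space \<Rightarrow> 'b::euclidean_space"
  assumes f: "f \<in> borel_measurable lebesgue" "\<And>x. norm (f x) \<le> B * indicator K x" and K: "K \<in> lmeasurable"
  shows "sq_integrable f"
proof (rule sq_integrable_bound[OF f(1)])
  show "integrable lebesgue (\<lambda>x. B\<^sup>2 * indicator K x :: real)"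
    using K by (intro integrable_mult_right integrable_indicator_lmeasurable)
  show "(norm (f x))\<^sup>2 \<le> B\<^sup>2 * indicator K x" for x
    using power_mono[OF f(2)[of x], of 2] by (auto simp: power_mult_distrib indicator_def split: if_splits)
qed

lemma sq_integrable_indicat_real: "K \<in> lmeasurable \<Longrightarrow> sq_integrable (indicat_real K)"
  by (rule sq_integrable_bounded_support[where B=1 and K=K])
    (auto intro!: borel_measurable_indicator simp: fmeasurable_def)

lemma integrable_bounded_support:
  fixes f :: "'a::euclidean_space \<Rightarrow> real"
  assumes f: "f \<in> borel_measurable lebesgue" "\<And>x. \<bar>f x\<bar> \<le> B * indicator K x" and K: "K \<in> lmeasurable"
  shows "integrable lebesgue f"
proof (rule Bochner_Integration.integrable_bound[OF _ f(1)])
  show "integrable lebesgue (\<lambda>x. B * indicator K x :: real)"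
    using K by (intro integrable_mult_right integrable_indicator_lmeasurable)
  show "AE x in lebesgue. norm (f x) \<le> norm (B * indicator K x)"
    using f(2) by (auto intro: order_trans[OF _ abs_ge_self])
qed

lemma test_fun_bound:
  assumes "\<phi> \<in> test_fun D"
  obtains B K where "compact K" "K \<subseteq> D" "B \<ge> 0" "\<And>x. \<bar>\<phi> x\<bar> \<le> B * indicator K x"
    "\<And>i x. i \<in> Basis \<Longrightarrow> \<bar>frechet_derivative \<phi> (at x) i\<bar> \<le> B * indicator K x"
proof (rule test_funE[OF assms])
  fix K assume K: "compact K" "K \<subseteq> D" "\<And>x. x \<notin> K \<Longrightarrow> \<phi> x = 0"
    "\<And>x i. x \<notin> K \<Longrightarrow> frechet_derivative \<phi> (at x) i = 0"
  obtain B0 where B0: "B0 \<ge> 0" "\<And>x. \<bar>\<phi> x\<bar> \<le> B0 * indicator K x"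
    by (rule compact_support_bound[OF test_fun_continuous[OF assms] K(1,3)]) blast+
  have "\<exists>B\<ge>0. \<forall>x. \<bar>frechet_derivative \<phi> (at x) i\<bar> \<le> B * indicator K x" if "i \<in> Basis" for i
    by (rule compact_support_bound[OF test_fun_pderiv_continuous[OF assms that] K(1) K(4)]) blast+
  then obtain B1 where B1: "\<And>i. i \<in> Basis \<Longrightarrow> B1 i \<ge> 0"
    "\<And>i x. i \<in> Basis \<Longrightarrow> \<bar>frechet_derivative \<phi> (at x) i\<bar> \<le> B1 i * indicator K x" by metis
  define B where "B = B0 + (\<Sum>i\<in>Basis. B1 i)"
  have s: "0 \<le> (\<Sum>i\<in>Basis. B1 i)" "\<And>i. i \<in> Basis \<Longrightarrow> B1 i \<le> (\<Sum>i\<in>Basis. B1 i)"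
    using B1(1) by (auto intro: sum_nonneg member_le_sum)
  show ?thesis
  proof (rule that[OF K(1,2)])
    show "B \<ge> 0" using s B0 by (simp add: B_def)
    show "\<bar>\<phi> x\<bar> \<le> B * indicator K x" for x
      using B0(2)[of x] s by (auto simp: B_def indicator_def)
    show "\<bar>frechet_derivative \<phi> (at x) i\<bar> \<le> B * indicator K x" if "i \<in> Basis" for i x
      using B1(2)[OF that, of x] s(2)[OF that] B0(1) by (auto simp: B_def indicator_def split: if_splits)
  qed
qed

lemma test_fun_sq_integrable:
  assumes "\<phi> \<in> test_fun D" shows "sq_integrable \<phi>" "integrable lebesgue \<phi>"
proof -
  obtain B K where "compact K" "\<And>x. \<bar>\<phi> x\<bar> \<le> B * indicator K x" by (rule test_fun_bound[OF assms]) blast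
  then show "sq_integrable \<phi>" "integrable lebesgue \<phi>"
    using assms by (auto intro!: sq_integrable_bounded_support[where K=K and B=B] integrable_bounded_support[where K=K and B=B] continuous_lebesgue_measurable
        lmeasurable_compact test_fun_continuous)
qed

lemma test_fun_pderiv_sq_integrable:
  assumes "\<phi> \<in> test_fun D" "i \<in> Basis" shows "sq_integrable (\<lambda>x. frechet_derivative \<phi> (at x) i)"
    "integrable lebesgue (\<lambda>x. frechet_derivative \<phi> (at x) i)"
proof -
  obtain B K where "compact K" "\<And>x. \<bar>frechet_derivative \<phi> (at x) i\<bar> \<le> B * indicator K x"
    by (rule test_fun_bound[OF assms(1)]) (use assms(2) in blast)
  then show "sq_integrable (\<lambda>x. frechet_derivative \<phi> (at x) i)" "integrable lebesgue (\<lambda>x. frechet_derivative \<phi> (at x) i)"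
    using assms by (auto intro!: sq_integrable_bounded_support[where K=K and B=B] integrable_bounded_support[where K=K and B=B] continuous_lebesgue_measurable
        lmeasurable_compact test_fun_pderiv_continuous)
qed

lemma sq_integrable_mult:
  fixes f g :: "'a::euclidean_space \<Rightarrow> real"
  shows "sq_integrable f \<Longrightarrow> sq_integrable g \<Longrightarrow> integrable lebesgue (\<lambda>x. f x * g x)"
  using sq_integrable_inner[of f g] by simp

text \<open>Differentiation under the integral sign, by dominated convergence: the mean value theorem bounds
  the difference quotients by \<open>B \<bar>u\<bar>\<close> on \<open>Q\<close>.\<close>

lemma integral_has_derivative:
  fixes K dK :: "real \<Rightarrow> 'a::euclidean_space \<Rightarrow> real"
  assumes u: "u \<in> borel_measurable lebesgue" "integrable lebesgue (\<lambda>x. u x * indicator Q x)"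
    and meas: "\<And>s. s \<in> {a..b} \<Longrightarrow> K s \<in> borel_measurable lebesgue"
      "\<And>s. s \<in> {a..b} \<Longrightarrow> dK s \<in> borel_measurable lebesgue"
    and deriv: "\<And>s x. s \<in> {a..b} \<Longrightarrow> ((\<lambda>s. K s x) has_real_derivative dK s x) (at s within {a..b})"
    and K: "\<And>s x. s \<in> {a..b} \<Longrightarrow> \<bar>K s x\<bar> \<le> B * indicator Q x"
    and dK: "\<And>s x. s \<in> {a..b} \<Longrightarrow> \<bar>dK s x\<bar> \<le> B * indicator Q x"
    and s: "s \<in> {a..b}"
  shows "((\<lambda>s. \<integral>x. u x * K s x \<partial>lebesgue) has_real_derivative (\<integral>x. u x * dK s x \<partial>lebesgue)) (at s within {a..b})"
proof -
  have dom: "integrable lebesgue (\<lambda>x. B * \<bar>u x * indicator Q x\<bar>)" using u(2) by simp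
  have int: "integrable lebesgue (\<lambda>x. u x * K r x)" if "r \<in> {a..b}" for r
  proof (rule Bochner_Integration.integrable_bound[OF dom])
    show "AE x in lebesgue. norm (u x * K r x) \<le> norm (B * \<bar>u x * indicator Q x\<bar>)"
    proof (rule AE_I2)
      fix x
      have "norm (u x * K r x) = \<bar>u x\<bar> * \<bar>K r x\<bar>" by (simp add: abs_mult)
      also have "\<dots> \<le> \<bar>u x\<bar> * (B * indicator Q x)" by (rule mult_left_mono[OF K[OF that]]) simp
      also have "\<dots> = B * \<bar>u x * indicator Q x\<bar>" by (simp add: abs_mult)
      also have "\<dots> \<le> norm (B * \<bar>u x * indicator Q x\<bar>)" unfolding real_norm_def by (rule abs_ge_self)
      finally show "norm (u x * K r x) \<le> norm (B * \<bar>u x * indicator Q x\<bar>)" .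
    qed
  qed (use u(1) meas(1)[OF that] in simp)
  have lip: "\<bar>K r x - K s x\<bar> \<le> B * indicator Q x * \<bar>r - s\<bar>" if "r \<in> {a..b}" for r x
    using field_differentiable_bound[of "{a..b}" "\<lambda>s. K s x" "\<lambda>s. dK s x" "B * indicator Q x" r s] deriv dK that s
    by auto
  have "((\<lambda>r. ((\<integral>x. u x * K r x \<partial>lebesgue) - (\<integral>x. u x * K s x \<partial>lebesgue)) / (r - s)) \<longlongrightarrow>
      (\<integral>x. u x * dK s x \<partial>lebesgue)) (at s within {a..b})"
    unfolding tendsto_at_iff_sequentially comp_def
  proof (intro allI impI)
    fix X :: "nat \<Rightarrow> real" assume X: "\<forall>n. X n \<in> {a..b} - {s}" "X \<longlonglongrightarrow> s"
    have eq: "((\<integral>x. u x * K (X n) x \<partial>lebesgue) - (\<integral>x. u x * K s x \<partial>lebesgue)) / (X n - s) =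
        (\<integral>x. u x * ((K (X n) x - K s x) / (X n - s)) \<partial>lebesgue)" for n
    proof -
      have "(\<integral>x. u x * ((K (X n) x - K s x) / (X n - s)) \<partial>lebesgue) =
          (\<integral>x. (u x * K (X n) x - u x * K s x) / (X n - s) \<partial>lebesgue)"
        by (simp add: right_diff_distrib)
      also have "\<dots> = (\<integral>x. u x * K (X n) x - u x * K s x \<partial>lebesgue) / (X n - s)" by simp
      also have "(\<integral>x. u x * K (X n) x - u x * K s x \<partial>lebesgue) =
          (\<integral>x. u x * K (X n) x \<partial>lebesgue) - (\<integral>x. u x * K s x \<partial>lebesgue)"
        using X(1) s by (intro Bochner_Integration.integral_diff int) auto
      finally show ?thesis by (rule sym)
    qed
    have "(\<lambda>n. \<integral>x. u x * ((K (X n) x - K s x) / (X n - s)) \<partial>lebesgue) \<longlonglongrightarrow> (\<integral>x. u x * dK s x \<partial>lebesgue)"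
    proof (rule integral_dominated_convergence[OF _ _ dom])
      show "(\<lambda>x. u x * dK s x) \<in> borel_measurable lebesgue" using u(1) meas(2)[OF s] by simp
      show "(\<lambda>x. u x * ((K (X n) x - K s x) / (X n - s))) \<in> borel_measurable lebesgue" for n
        using u(1) meas(1)[OF s] meas(1)[of "X n"] X(1) by (intro borel_measurable_times borel_measurable_divide borel_measurable_diff) auto
      show "AE x in lebesgue. (\<lambda>n. u x * ((K (X n) x - K s x) / (X n - s))) \<longlonglongrightarrow> u x * dK s x"
      proof (intro AE_I2 tendsto_intros)
        fix x
        have "((\<lambda>r. (K r x - K s x) / (r - s)) \<longlongrightarrow> dK s x) (at s within {a..b})"
          using deriv[OF s, of x] by (simp add: has_field_derivative_iff)
        then show "(\<lambda>n. (K (X n) x - K s x) / (X n - s)) \<longlonglongrightarrow> dK s x"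
          using X unfolding tendsto_at_iff_sequentially comp_def by blast
      qed
      show "AE x in lebesgue. norm (u x * ((K (X n) x - K s x) / (X n - s))) \<le> B * \<bar>u x * indicator Q x\<bar>" for n
      proof (rule AE_I2)
        fix x
        have ns: "\<bar>X n - s\<bar> > 0" using X(1) by auto
        have "\<bar>(K (X n) x - K s x) / (X n - s)\<bar> \<le> B * indicator Q x"
          using lip[of "X n" x] X(1) ns by (simp add: field_simps abs_mult)
        then have "\<bar>u x\<bar> * \<bar>(K (X n) x - K s x) / (X n - s)\<bar> \<le> \<bar>u x\<bar> * (B * indicator Q x)"
          by (rule mult_left_mono) simp
        then show "norm (u x * ((K (X n) x - K s x) / (X n - s))) \<le> B * \<bar>u x * indicator Q x\<bar>"
          by (simp add: abs_mult mult.left_commute)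
      qed
    qed
    then show "(\<lambda>n. ((\<integral>x. u x * K (X n) x \<partial>lebesgue) - (\<integral>x. u x * K s x \<partial>lebesgue)) / (X n - s)) \<longlonglongrightarrow>
        (\<integral>x. u x * dK s x \<partial>lebesgue)" unfolding eq .
  qed
  then show ?thesis by (simp add: has_field_derivative_iff)
qed

lemma translation_lebesgue:
  fixes a :: "'a::euclidean_space"
  shows "(\<lambda>x. a + x) \<in> lebesgue \<rightarrow>\<^sub>M lebesgue" "distr lebesgue lebesgue (\<lambda>x. a + x) = lebesgue"
proof -
  have T: "(\<lambda>x. a + (\<Sum>j\<in>Basis. (1 * (x \<bullet> j)) *\<^sub>R j)) = (\<lambda>x. a + x)"
    by (simp add: euclidean_representation)
  show "(\<lambda>x. a + x) \<in> lebesgue \<rightarrow>\<^sub>M lebesgue"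
    using lebesgue_affine_measurable[of "\<lambda>_. 1" a] unfolding T by simp
  have "density (distr lebesgue lebesgue (\<lambda>x. a + x)) (\<lambda>_. 1) = lebesgue"
    using lebesgue_affine_euclidean[of "\<lambda>_::'a. 1" a] unfolding T by simp
  then show "distr lebesgue lebesgue (\<lambda>x. a + x) = lebesgue" by (simp add: density_1)
qed

lemma integral_translate:
  fixes f :: "'a::euclidean_space \<Rightarrow> 'b::euclidean_space"
  assumes "f \<in> borel_measurable lebesgue"
  shows "(\<integral>x. f (a + x) \<partial>lebesgue) = (\<integral>x. f x \<partial>lebesgue)"
  using integral_distr[OF translation_lebesgue(1) assms, of a] by (simp add: translation_lebesgue(2))

lemma integrable_translate:
  fixes f :: "'a::euclidean_space \<Rightarrow> 'b::euclidean_space"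
  assumes "integrable lebesgue f"
  shows "integrable lebesgue (\<lambda>x. f (a + x))"
  using integrable_distr[OF translation_lebesgue(1)[of a], where f=f] assms by (simp add: translation_lebesgue(2))

text \<open>The integral of \<open>F (s i + x)\<close> over \<open>x\<close> is independent of \<open>s\<close>; differentiate it with respect to \<open>s\<close>.\<close>

lemma integral_derivative_zero:
  fixes F :: "'a::euclidean_space \<Rightarrow> real"
  assumes D: "\<And>x. (F has_derivative F' x) (at x)" and c: "continuous_on UNIV (\<lambda>x. F' x i)"
    and K: "compact K" "\<And>x. x \<notin> K \<Longrightarrow> F x = 0" "\<And>x. x \<notin> K \<Longrightarrow> F' x i = 0"
  shows "(\<integral>x. F' x i \<partial>lebesgue) = 0"
proof -
  have cF: "continuous_on UNIV F" using D has_derivative_continuous continuous_at_imp_continuous_on by blast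
  obtain B1 where B1: "B1 \<ge> 0" "\<And>x. \<bar>F x\<bar> \<le> B1 * indicator K x" by (rule compact_support_bound[OF cF K(1,2)]) blast+
  obtain B2 where B2: "B2 \<ge> 0" "\<And>x. \<bar>F' x i\<bar> \<le> B2 * indicator K x" by (rule compact_support_bound[OF c K(1,3)]) blast+
  define Q where "Q = (\<lambda>(x, s). x - s *\<^sub>R i) ` (K \<times> {0..1::real})"
  have Q: "compact Q" unfolding Q_def
    by (intro compact_continuous_image compact_Times K) (auto simp: case_prod_beta intro!: continuous_intros)
  have Q': "indicator K (s *\<^sub>R i + x) \<le> (indicator Q x :: real)" if "s \<in> {0..1}" for x s
    using that by (auto simp: indicator_def Q_def intro!: image_eqI[of _ _ "(s *\<^sub>R i + x, s)"])
  have "((\<lambda>s. \<integral>x. 1 * F (s *\<^sub>R i + x) \<partial>lebesgue) has_real_derivative (\<integral>x. 1 * F' ((1/2) *\<^sub>R i + x) i \<partial>lebesgue))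
      (at (1/2) within {0..1})"
  proof (rule integral_has_derivative[where Q=Q and B="B1 + B2"])
    show "integrable lebesgue (\<lambda>x. 1 * indicator Q x :: real)"
      using lmeasurable_compact[OF Q] by (simp add: integrable_indicator_lmeasurable)
    show "(\<lambda>x. F (s *\<^sub>R i + x)) \<in> borel_measurable lebesgue" for s
      by (intro continuous_lebesgue_measurable continuous_on_compose2[OF cF] continuous_intros) auto
    show "(\<lambda>x. F' (s *\<^sub>R i + x) i) \<in> borel_measurable lebesgue" for s
      by (intro continuous_lebesgue_measurable continuous_on_compose2[OF c] continuous_intros) auto
    show "((\<lambda>s. F (s *\<^sub>R i + x)) has_real_derivative F' (s *\<^sub>R i + x) i) (at s within {0..1})" for s x
    proof -
      have "((\<lambda>s. s *\<^sub>R i + x) has_derivative (\<lambda>h. h *\<^sub>R i)) (at s within {0..1})"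
        by (auto intro!: derivative_eq_intros)
      from has_derivative_compose[OF this D]
      have "((\<lambda>s. F (s *\<^sub>R i + x)) has_derivative (\<lambda>h. F' (s *\<^sub>R i + x) (h *\<^sub>R i))) (at s within {0..1})" .
      moreover have "F' (s *\<^sub>R i + x) (h *\<^sub>R i) = F' (s *\<^sub>R i + x) i * h" for h
        using linear_scale[OF has_derivative_linear[OF D]] by simp
      ultimately show ?thesis by (simp add: has_field_derivative_def)
    qed
    fix s :: real and x assume s: "s \<in> {0..1}"
    have "\<bar>F (s *\<^sub>R i + x)\<bar> \<le> B1 * indicator K (s *\<^sub>R i + x)" by (rule B1)
    also have "\<dots> \<le> (B1 + B2) * indicator Q x" using B1(1) B2(1) Q'[OF s, of x] by (intro mult_mono) auto
    finally show "\<bar>F (s *\<^sub>R i + x)\<bar> \<le> (B1 + B2) * indicator Q x" .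
    have "\<bar>F' (s *\<^sub>R i + x) i\<bar> \<le> B2 * indicator K (s *\<^sub>R i + x)" by (rule B2)
    also have "\<dots> \<le> (B1 + B2) * indicator Q x" using B1(1) B2(1) Q'[OF s, of x] by (intro mult_mono) auto
    finally show "\<bar>F' (s *\<^sub>R i + x) i\<bar> \<le> (B1 + B2) * indicator Q x" .
  qed auto
  moreover have "(\<integral>x. 1 * F (s *\<^sub>R i + x) \<partial>lebesgue) = (\<integral>x. F x \<partial>lebesgue)" for s
    using integral_translate[OF continuous_lebesgue_measurable[OF cF]] by simp
  moreover have "(\<integral>x. F' ((1/2) *\<^sub>R i + x) i \<partial>lebesgue) = (\<integral>x. F' x i \<partial>lebesgue)"
    by (rule integral_translate[OF continuous_lebesgue_measurable[OF c]])
  ultimately have "((\<lambda>s. \<integral>x. F x \<partial>lebesgue) has_real_derivative (\<integral>x. F' x i \<partial>lebesgue)) (at (1/2) within {0..1})"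
    by simp
  then have "((\<lambda>s::real. \<integral>x. F x \<partial>lebesgue) has_real_derivative (\<integral>x. F' x i \<partial>lebesgue)) (at (1/2))"
    by (simp add: at_within_Icc_at)
  then show ?thesis using DERIV_unique DERIV_const by blast
qed

lemma integration_by_parts:
  assumes \<phi>: "\<phi> \<in> test_fun UNIV" and \<psi>: "\<psi> \<in> test_fun UNIV" and i: "i \<in> Basis"
  shows "(\<integral>x. \<phi> x * frechet_derivative \<psi> (at x) i \<partial>lebesgue) = - (\<integral>x. frechet_derivative \<phi> (at x) i * \<psi> x \<partial>lebesgue)"
proof -
  obtain K where K: "compact K" "\<And>x. x \<notin> K \<Longrightarrow> \<phi> x = 0" "\<And>x i. x \<notin> K \<Longrightarrow> frechet_derivative \<phi> (at x) i = 0"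
    by (rule test_funE[OF \<phi>]) blast
  have "(\<integral>x. (\<lambda>h. \<phi> x * frechet_derivative \<psi> (at x) h + frechet_derivative \<phi> (at x) h * \<psi> x) i \<partial>lebesgue) = 0"
    by (rule integral_derivative_zero[where F="\<lambda>x. \<phi> x * \<psi> x" and K=K])
      (auto intro!: has_derivative_mult test_fun_has_derivative[OF \<phi>] test_fun_has_derivative[OF \<psi>]
        continuous_intros test_fun_continuous[OF \<phi>] test_fun_continuous[OF \<psi>]
        test_fun_pderiv_continuous[OF \<phi> i] test_fun_pderiv_continuous[OF \<psi> i] simp: K)
  moreover have "integrable lebesgue (\<lambda>x. \<phi> x * frechet_derivative \<psi> (at x) i)"
    "integrable lebesgue (\<lambda>x. frechet_derivative \<phi> (at x) i * \<psi> x)"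
    by (intro sq_integrable_mult test_fun_sq_integrable(1)[OF \<phi>] test_fun_sq_integrable(1)[OF \<psi>]
        test_fun_pderiv_sq_integrable(1)[OF \<phi> i] test_fun_pderiv_sq_integrable(1)[OF \<psi> i])+
  ultimately show ?thesis by simp
qed

text \<open>For \<open>t > 0\<close> the numbers \<open>flat 0 (n t)\<close> tend to 1, so products over the coordinates approximate the
  indicator of an open box from below.\<close>

lemma tame_bump_box:
  fixes a b :: "'a::euclidean_space"
  obtains \<eta> :: "nat \<Rightarrow> 'a \<Rightarrow> real" where "\<And>n. tame (\<eta> n)" "\<And>n x. 0 \<le> \<eta> n x" "\<And>n x. \<eta> n x \<le> indicator (box a b) x"
    "\<And>x. (\<lambda>n. \<eta> n x) \<longlonglongrightarrow> indicator (box a b) x"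
proof -
  define \<eta> where "\<eta> n x = (\<Prod>i\<in>Basis. flat 0 (real n * (x \<bullet> i - a \<bullet> i)) * flat 0 (real n * (b \<bullet> i - x \<bullet> i)))"
    for n :: nat and x :: 'a
  have lim: "(\<lambda>n. flat 0 (real n * t)) \<longlonglongrightarrow> 1" if "t > 0" for t
  proof -
    have "(\<lambda>n. exp (- (1 / t) * inverse (real n))) \<longlonglongrightarrow> exp (- (1 / t) * 0)"
      by (intro tendsto_intros LIMSEQ_inverse_real_of_nat_add lim_inverse_n)
    moreover have "\<forall>\<^sub>F n in sequentially. exp (- (1 / t) * inverse (real n)) = flat 0 (real n * t)"
      using eventually_gt_at_top[of 0] by eventually_elim (use that in \<open>auto simp: flat_def field_simps\<close>)
    ultimately show ?thesis using Lim_transform_eventually by fastforce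
  qed
  have zero: "\<eta> n x = 0" if "x \<notin> box a b" for n x
  proof -
    obtain i where i: "i \<in> Basis" "x \<bullet> i \<le> a \<bullet> i \<or> b \<bullet> i \<le> x \<bullet> i"
      using \<open>x \<notin> box a b\<close> by (auto simp: mem_box not_less)
    then have "flat 0 (real n * (x \<bullet> i - a \<bullet> i)) * flat 0 (real n * (b \<bullet> i - x \<bullet> i)) = 0"
      by (auto simp: flat_def zero_less_mult_iff)
    then show ?thesis unfolding \<eta>_def using i(1) by (intro prod_zero) auto
  qed
  show ?thesis
  proof (rule that[of \<eta>])
    show "tame (\<eta> n)" for n
    proof -
      have "tame (\<lambda>x. \<Prod>i\<in>Basis. flat 0 (- real n * (a \<bullet> i) + real n * (x \<bullet> i)) * flat 0 (real n * (b \<bullet> i) + (- real n) * (x \<bullet> i)))"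
        by (intro tame_prod tame_mult tame_flat tame_affine) simp
      then show ?thesis unfolding \<eta>_def[abs_def] by (simp add: algebra_simps)
    qed
    show "0 \<le> \<eta> n x" for n x unfolding \<eta>_def by (intro prod_nonneg) (simp add: flat_nonneg)
    show "\<eta> n x \<le> indicator (box a b) x" for n x
    proof (cases "x \<in> box a b")
      case True
      have "\<eta> n x \<le> 1" unfolding \<eta>_def
        by (intro prod_le_1) (auto simp: flat_nonneg flat_0_le_1 intro: mult_le_one)
      then show ?thesis using True by simp
    qed (simp add: zero)
    show "(\<lambda>n. \<eta> n x) \<longlonglongrightarrow> indicator (box a b) x" for x
    proof (cases "x \<in> box a b")
      case True
      have "(\<lambda>n. \<eta> n x) \<longlonglongrightarrow> (\<Prod>i\<in>(Basis :: 'a set). 1 * 1)"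
        unfolding \<eta>_def by (intro tendsto_prod tendsto_mult lim) (use True in \<open>auto simp: mem_box\<close>)
      then show ?thesis using True by simp
    qed (simp add: zero)
  qed
qed

text \<open>Open boxes are closed under intersection and generate the Borel sets; Lebesgue sets are Borel up
  to null sets.\<close>

lemma AE_zero_if_box_integrals_zero:
  fixes g :: "'a::euclidean_space \<Rightarrow> real"
  assumes g: "integrable lebesgue g" and box: "\<And>a b. (LINT x:(box a b)|lebesgue. g x) = 0"
    and all: "(\<integral>x. g x \<partial>lebesgue) = 0"
  shows "AE x in lebesgue. g x = 0"
proof -
  have si: "set_integrable lebesgue A g" if "A \<in> sets lebesgue" for A
    using integrable_mult_indicator[OF that g] by (simp add: set_integrable_def)
  have borel: "(LINT x:A|lebesgue. g x) = 0" if "A \<in> sets borel" for A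
  proof -
    have IS: "Int_stable (range (\<lambda>(a, b). box a b :: 'a set))"
      by (auto simp: Int_stable_def box_Int_box)
    have sub: "range (\<lambda>(a, b). box a b :: 'a set) \<subseteq> Pow UNIV" by simp
    have "A \<in> sigma_sets UNIV (range (\<lambda>(a, b). box a b :: 'a set))"
      using that unfolding borel_eq_box by simp
    with IS sub show ?thesis
    proof (induction rule: sigma_sets_induct_disjoint)
      case (basic A)
      then show ?case using box by auto
    next
      case empty
      then show ?case by (simp add: set_lebesgue_integral_def)
    next
      case (compl A)
      have A: "A \<in> sets lebesgue" using compl(1) by (simp add: borel_eq_box[symmetric] flip: sets_measure_of) 
          (metis borel_eq_box sets_completionI_sets sets_lborel sets_measure_of subset_UNIV Pow_UNIV)
      have "(LINT x:(A \<union> (UNIV - A))|lebesgue. g x) = (LINT x:A|lebesgue. g x) + (LINT x:(UNIV - A)|lebesgue. g x)"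
        by (rule set_integral_Un) (use A in \<open>auto intro!: si sets.Diff\<close>)
      then show ?case using compl(2) all by (simp add: set_lebesgue_integral_def)
    next
      case (union F)
      have F: "F i \<in> sets lebesgue" for i using union(2)
        by (metis (no_types, lifting) borel_eq_box sets_completionI_sets sets_lborel sets_measure_of subset_UNIV Pow_UNIV range_subsetD)
      have "(LINT x:(\<Union>i. F i)|lebesgue. g x) = (\<Sum>i. LINT x:(F i)|lebesgue. g x)"
        by (rule lebesgue_integral_countable_add) (use F union(1) si in \<open>auto simp: disjoint_family_on_def\<close>)
      then show ?case using union(3) by simp
    qed
  qed
  have "AE x in lebesgue. g x = (\<lambda>_. 0) x"
  proof (rule density_unique_real[OF g])
    fix A :: "'a set" assume "A \<in> sets lebesgue"
    then obtain C N where CN: "fsigma C" "N \<in> null_sets lebesgue" "C \<union> N = A" by (rule lebesgue_set_almost_fsigma)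
    have C: "C \<in> sets borel" using CN(1) by (cases rule: fsigma.cases) auto
    have "(LINT x:A|lebesgue. g x) = (LINT x:C|lebesgue. g x)"
      unfolding set_lebesgue_integral_def
    proof (rule integral_cong_AE)
      show "AE x in lebesgue. indicat_real A x *\<^sub>R g x = indicat_real C x *\<^sub>R g x"
        using AE_not_in[OF CN(2)] by eventually_elim (use CN(3) in \<open>auto simp: indicator_def\<close>)
    qed (use C \<open>A \<in> sets lebesgue\<close> in \<open>auto intro!: borel_measurable_times borel_measurable_indicator
        borel_measurable_integrable[OF g] sets_completionI_sets\<close>)
    then show "(LINT x:A|lebesgue. g x) = (LINT x:A|lebesgue. 0)" using borel[OF C] by (simp add: set_lebesgue_integral_def)
  qed simp
  then show ?thesis by simp
qed

text \<open>The fundamental lemma of the calculus of variations. Bumps approximate boxes, and \<open>D\<close> is a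
  countable union of boxes.\<close>

lemma AE_zero_if_orthogonal_to_test_funs:
  fixes g :: "'a::euclidean_space \<Rightarrow> real"
  assumes D: "open D" and g: "sq_integrable g"
    and orth: "\<And>\<phi>. tame \<phi> \<Longrightarrow> \<phi> \<in> test_fun D \<Longrightarrow> (\<integral>x. g x * \<phi> x \<partial>lebesgue) = 0"
  shows "AE x in lebesgue. x \<in> D \<longrightarrow> g x = 0"
proof -
  have box0: "(\<integral>x. g x * indicator (box a b) x \<partial>lebesgue) = 0" if ab: "cbox a b \<subseteq> D" for a b
  proof -
    obtain \<eta> where \<eta>: "\<And>n. tame (\<eta> n)" "\<And>n x. 0 \<le> \<eta> n x" "\<And>n x. \<eta> n x \<le> indicator (box a b) x"
      "\<And>x. (\<lambda>n. \<eta> n x) \<longlonglongrightarrow> indicator (box a b) x"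
      by (rule tame_bump_box[of a b]) blast
    have test: "\<eta> n \<in> test_fun D" for n
    proof (rule test_funI[OF tame_smooth[OF \<eta>(1)] compact_cbox ab])
      show "\<eta> n x = 0" if "x \<notin> cbox a b" for x
      proof -
        have "x \<notin> box a b" using that subsetD[OF box_subset_cbox, of x a b] by blast
        then show ?thesis using \<eta>(2)[of n x] \<eta>(3)[of n x] by simp
      qed
    qed
    have "(\<lambda>n. \<integral>x. g x * \<eta> n x \<partial>lebesgue) \<longlonglongrightarrow> (\<integral>x. g x * indicator (box a b) x \<partial>lebesgue)"
    proof (rule integral_dominated_convergence)
      have "sq_integrable (indicator (box a b) :: 'a \<Rightarrow> real)"
        by (rule sq_integrable_indicat_real) simp
      from sq_integrable_mult[OF g this] show "integrable lebesgue (\<lambda>x. \<bar>g x * indicator (box a b) x\<bar>)" by simp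
      show "(\<lambda>x. g x * \<eta> n x) \<in> borel_measurable lebesgue" for n
        using sq_integrableD[OF g] continuous_lebesgue_measurable[OF tame_continuous[OF \<eta>(1)]] by simp
      show "AE x in lebesgue. (\<lambda>n. g x * \<eta> n x) \<longlonglongrightarrow> g x * indicator (box a b) x"
        by (intro AE_I2 tendsto_intros \<eta>(4))
      show "AE x in lebesgue. norm (g x * \<eta> n x) \<le> \<bar>g x * indicator (box a b) x\<bar>" for n
        using \<eta>(2,3) by (intro AE_I2) (auto simp: abs_mult intro!: mult_left_mono)
    qed (auto intro!: borel_measurable_times sq_integrableD[OF g] borel_measurable_indicator)
    then show ?thesis using orth[OF \<eta>(1) test] LIMSEQ_unique[OF tendsto_const] by fastforce
  qed
  have cbox0: "AE x in lebesgue. x \<in> cbox c d \<longrightarrow> g x = 0" if cd: "cbox c d \<subseteq> D" for c d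
  proof -
    define h where "h x = g x * indicator (box c d) x" for x
    have "sq_integrable (indicator (box c d) :: 'a \<Rightarrow> real)"
      by (rule sq_integrable_indicat_real) simp
    from sq_integrable_mult[OF g this] have h: "integrable lebesgue h" unfolding h_def .
    have "AE x in lebesgue. h x = 0"
    proof (rule AE_zero_if_box_integrals_zero[OF h])
      show "(\<integral>x. h x \<partial>lebesgue) = 0" unfolding h_def by (rule box0[OF cd])
      fix a b :: 'a
      obtain a' b' where ab': "box a b \<inter> box c d = box a' b'" by (auto simp: box_Int_box)
      have "(LINT x:(box a b)|lebesgue. h x) = (\<integral>x. g x * indicator (box a' b') x \<partial>lebesgue)"
        unfolding set_lebesgue_integral_def h_def ab'[symmetric]
        by (rule Bochner_Integration.integral_cong) (auto simp: indicator_def)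
      also have "\<dots> = 0"
      proof (cases "box a' b' = {}")
        case False
        then have "cbox a' b' = closure (box a' b')" by (simp add: closure_box)
        also have "\<dots> \<subseteq> closure (box c d)" unfolding ab'[symmetric] by (intro closure_mono) auto
        also have "\<dots> \<subseteq> cbox c d" by (intro closure_minimal box_subset_cbox closed_cbox)
        finally show ?thesis using box0[of a' b'] cd by blast
      qed simp
      finally show "(LINT x:(box a b)|lebesgue. h x) = 0" .
    qed
    moreover have "AE x in lebesgue. x \<notin> cbox c d - box c d"
      by (intro AE_not_in) (metis negligible_frontier_interval negligible_iff_null_sets frontier_cbox)
    ultimately show ?thesis by eventually_elim (auto simp: h_def)
  qed
  obtain \<D> where DD: "countable \<D>" "\<D> \<subseteq> Pow D" "\<And>X. X \<in> \<D> \<Longrightarrow> \<exists>a b. X = cbox a b" "\<Union>\<D> = D"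
    by (rule open_countable_Union_open_cbox[OF D]) blast
  have "AE x in lebesgue. \<forall>X\<in>\<D>. x \<in> X \<longrightarrow> g x = 0"
    unfolding AE_ball_countable[OF DD(1)]
  proof
    fix X assume X: "X \<in> \<D>"
    then obtain c d where "X = cbox c d" using DD(3) by blast
    then show "AE x in lebesgue. x \<in> X \<longrightarrow> g x = 0" using cbox0[of c d] X DD(2) by blast
  qed
  then show ?thesis by eventually_elim (use DD(4) in blast)
qed

section \<open>The gradient as a closed operator\<close>

definition restr :: "'a::euclidean_space set \<Rightarrow> ('a, 'b::euclidean_space) l2 \<Rightarrow> ('a, 'b) l2" where
  "restr A f = cls (\<lambda>x. indicator A x *\<^sub>R rep f x)"

lemma sq_integrable_indicator:
  assumes "A \<in> sets lebesgue" "sq_integrable f" shows "sq_integrable (\<lambda>x. indicator A x *\<^sub>R f x)"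
proof (rule sq_integrable_bound)
  show "(\<lambda>x. indicator A x *\<^sub>R f x) \<in> borel_measurable lebesgue"
    using assms by (intro borel_measurable_scaleR borel_measurable_indicator sq_integrableD)
  show "integrable lebesgue (\<lambda>x. (norm (f x))\<^sup>2)" using assms(2) by (simp add: sq_integrable_def)
  show "(norm (indicator A x *\<^sub>R f x))\<^sup>2 \<le> (norm (f x))\<^sup>2" for x by (simp add: indicator_def)
qed

lemma rep_restr: "A \<in> sets lebesgue \<Longrightarrow> AE x in lebesgue. rep (restr A f) x = indicator A x *\<^sub>R rep f x"
  unfolding restr_def by (rule rep_cls) (simp add: sq_integrable_indicator)

lemma restr_cls:
  assumes "A \<in> sets lebesgue" "sq_integrable f" shows "restr A (cls f) = cls (\<lambda>x. indicator A x *\<^sub>R f x)"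
  unfolding restr_def using rep_cls[OF assms(2)] assms
  by (subst cls_eq_iff) (auto intro: sq_integrable_indicator)

lemma restr_inner: "A \<in> sets lebesgue \<Longrightarrow> restr A f \<bullet> g = (\<integral>x. indicator A x * (rep f x \<bullet> rep g x) \<partial>lebesgue)"
  unfolding l2_inner_rep using rep_restr[of A f]
  by (intro integral_cong_AE) (auto intro!: borel_measurable_times borel_measurable_inner borel_measurable_indicator)

lemma restr_sym: "A \<in> sets lebesgue \<Longrightarrow> restr A f \<bullet> g = f \<bullet> restr A g"
  by (simp add: restr_inner inner_commute[of f] inner_commute[of "rep f _"])

lemma restr_linear: "A \<in> sets lebesgue \<Longrightarrow> linear (restr A)"
proof (rule linearI)
  fix f g :: "('a, 'b) l2" and c assume A: "A \<in> sets lebesgue"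
  show "restr A (f + g) = restr A f + restr A g"
    by (rule l2_eqI)
      (use rep_restr[OF A, of "f + g"] rep_restr[OF A, of f] rep_restr[OF A, of g] rep_add[of f g]
         rep_add[of "restr A f" "restr A g"] in \<open>eventually_elim, simp add: scaleR_add_right\<close>)
  show "restr A (c *\<^sub>R f) = c *\<^sub>R restr A f"
    by (rule l2_eqI)
      (use rep_restr[OF A, of "c *\<^sub>R f"] rep_restr[OF A, of f] rep_scale[of c f]
         rep_scale[of c "restr A f"] in \<open>eventually_elim, simp\<close>)
qed

lemma norm_le_if_pointwise:
  assumes "AE x in lebesgue. norm (rep f x) \<le> norm (rep g x)" shows "norm f \<le> norm g"
proof -
  have "(\<integral>x. (norm (rep f x))\<^sup>2 \<partial>lebesgue) \<le> (\<integral>x. (norm (rep g x))\<^sup>2 \<partial>lebesgue)"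
    using rep_sq_integrable[of f] rep_sq_integrable[of g] assms
    by (intro integral_mono_AE) (auto simp: sq_integrable_def elim: eventually_mono intro: power_mono)
  then have "(norm f)\<^sup>2 \<le> (norm g)\<^sup>2" using l2_norm_cls[OF rep_sq_integrable, of f] l2_norm_cls[OF rep_sq_integrable, of g] by simp
  then show ?thesis by (rule power2_le_imp_le) simp
qed

lemma restr_norm: "A \<in> sets lebesgue \<Longrightarrow> norm (restr A f) \<le> norm f"
  by (rule norm_le_if_pointwise) (use rep_restr[of A f] in \<open>auto elim: eventually_mono simp: indicator_def\<close>)

lemma restr_bounded_linear: "A \<in> sets lebesgue \<Longrightarrow> bounded_linear (restr A)"
  by (rule bounded_linear_intro[of _ 1])
    (auto simp: linear_add[OF restr_linear] linear_scale[OF restr_linear] restr_norm)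

lemma restr_0_iff:
  assumes "A \<in> sets lebesgue"
  shows "restr A f = 0 \<longleftrightarrow> (AE x in lebesgue. x \<in> A \<longrightarrow> rep f x = 0)"
proof -
  have "restr A f = 0 \<longleftrightarrow> (AE x in lebesgue. indicator A x *\<^sub>R rep f x = 0)"
    unfolding restr_def cls_zero[symmetric]
    by (rule cls_eq_iff) (simp_all add: sq_integrable_indicator sq_integrable_0 assms)
  also have "\<dots> \<longleftrightarrow> (AE x in lebesgue. x \<in> A \<longrightarrow> rep f x = 0)"
    by (intro AE_cong) (auto simp: indicator_def)
  finally show ?thesis .
qed

lemma subspace_test_functional:
  fixes l :: "('a::euclidean_space \<Rightarrow> real) \<Rightarrow> real"
  assumes add: "\<And>\<phi> \<psi>. \<phi> \<in> test_fun D \<Longrightarrow> \<psi> \<in> test_fun D \<Longrightarrow> l (\<lambda>x. \<phi> x + \<psi> x) = l \<phi> + l \<psi>"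
    and scale: "\<And>c \<phi>. \<phi> \<in> test_fun D \<Longrightarrow> l (\<lambda>x. c * \<phi> x) = c * l \<phi>"
  shows "subspace ((\<lambda>\<phi>. (cls \<phi>, l \<phi>)) ` test_fun D)" (is "subspace ?G")
proof (rule subspaceI)
  have 0: "(\<lambda>_. 0) \<in> test_fun D" by (rule test_funI[of _ "{}"]) (auto intro: tame_smooth tame_const)
  then show "0 \<in> ?G"
    using scale[OF 0, of 0] by (intro image_eqI[OF _ 0]) (simp add: cls_zero zero_prod_def)
  show "x + y \<in> ?G" if "x \<in> ?G" "y \<in> ?G" for x y
  proof -
    obtain \<phi> \<psi> where *: "\<phi> \<in> test_fun D" "\<psi> \<in> test_fun D" "x = (cls \<phi>, l \<phi>)" "y = (cls \<psi>, l \<psi>)"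
      using \<open>x \<in> ?G\<close> \<open>y \<in> ?G\<close> by blast
    show ?thesis
      by (intro image_eqI[OF _ test_fun_add[OF *(1,2)]]) (simp add: *(3,4) add[OF *(1,2)]
          cls_add[OF test_fun_sq_integrable(1)[OF *(1)] test_fun_sq_integrable(1)[OF *(2)], symmetric])
  qed
  show "c *\<^sub>R x \<in> ?G" if "x \<in> ?G" for c x
  proof -
    obtain \<phi> where *: "\<phi> \<in> test_fun D" "x = (cls \<phi>, l \<phi>)" using \<open>x \<in> ?G\<close> by blast
    show ?thesis
      using cls_scale[OF test_fun_sq_integrable(1)[OF *(1)], of c]
      by (intro image_eqI[OF _ test_fun_scale[OF *(1), of c]]) (simp add: *(2) scale[OF *(1)])
  qed
qed

text \<open>The pairing with \<open>f\<close> is represented on the test functions by some \<open>g\<close> of norm at most \<open>C\<close>. Then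
  \<open>f - g\<close> is orthogonal to all test functions and vanishes on \<open>D\<close>.\<close>

lemma norm_restr_le_if_tested:
  fixes f :: "('a::euclidean_space, real) l2"
  assumes D: "open D" and C: "0 \<le> C" and test: "\<And>\<psi>. \<psi> \<in> test_fun D \<Longrightarrow> \<bar>f \<bullet> cls \<psi>\<bar> \<le> C * norm (cls \<psi>)"
  shows "norm (restr D f) \<le> C"
proof -
  define G where "G = (\<lambda>\<psi>. (cls \<psi>, f \<bullet> cls \<psi>)) ` test_fun D"
  have "subspace G" unfolding G_def
  proof (rule subspace_test_functional)
    fix \<phi> \<psi> :: "'a \<Rightarrow> real" and c assume \<phi>: "\<phi> \<in> test_fun D"
    show "f \<bullet> cls (\<lambda>x. c * \<phi> x) = c * (f \<bullet> cls \<phi>)"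
      using cls_scale[OF test_fun_sq_integrable(1)[OF \<phi>], of c, symmetric] by simp
    assume \<psi>: "\<psi> \<in> test_fun D"
    show "f \<bullet> cls (\<lambda>x. \<phi> x + \<psi> x) = f \<bullet> cls \<phi> + f \<bullet> cls \<psi>"
      using cls_add[OF test_fun_sq_integrable(1)[OF \<phi>] test_fun_sq_integrable(1)[OF \<psi>], symmetric]
      by (simp add: inner_add_right)
  qed
  then obtain g where g: "\<And>x t. (x, t) \<in> G \<Longrightarrow> t = g \<bullet> x" "norm g \<le> C"
    by (rule Riesz_relation[OF _ C]) (use test in \<open>auto simp: G_def\<close>)
  have "AE x in lebesgue. x \<in> D \<longrightarrow> rep (f - g) x = 0"
  proof (rule AE_zero_if_orthogonal_to_test_funs[OF D])
    fix \<psi> :: "'a \<Rightarrow> real" assume \<psi>: "\<psi> \<in> test_fun D"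
    have "f \<bullet> cls \<psi> = g \<bullet> cls \<psi>" by (rule g(1)) (use \<psi> in \<open>auto simp: G_def\<close>)
    then have "(f - g) \<bullet> cls \<psi> = 0" by (simp add: inner_diff_left)
    then show "(\<integral>x. rep (f - g) x * \<psi> x \<partial>lebesgue) = 0"
      using l2_inner_cls[OF test_fun_sq_integrable(1)[OF \<psi>], of "f - g"] by simp
  qed simp
  then have "restr D (f - g) = 0" using D by (simp add: restr_0_iff)
  then have "restr D f = restr D g" using D by (simp add: linear_diff[OF restr_linear])
  then show ?thesis using restr_norm[of D g] D g(2) by simp
qed

text \<open>The integrals run over the whole space, but test functions vanish outside \<open>D\<close>, so the values of
  \<open>u\<close> and \<open>g\<close> there have no influence.\<close>

definition weak_deriv :: "'a::euclidean_space set \<Rightarrow> 'a \<Rightarrow> ('a, real) l2 \<Rightarrow> ('a, real) l2 \<Rightarrow> bool" where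
  "weak_deriv D i u g \<longleftrightarrow> (\<forall>\<phi>\<in>test_fun D. u \<bullet> cls (\<lambda>x. frechet_derivative \<phi> (at x) i) = - (g \<bullet> cls \<phi>))"

lemma translated_test_fun:
  fixes u :: "('a::euclidean_space, real) l2"
  assumes \<phi>: "\<phi> \<in> test_fun D" and i: "i \<in> Basis" and s: "s \<in> {0..h}"
  shows "((\<lambda>s. \<integral>x. rep u x * \<phi> (x + s *\<^sub>R i) \<partial>lebesgue) has_real_derivative
    (\<integral>x. rep u x * frechet_derivative \<phi> (at (x + s *\<^sub>R i)) i \<partial>lebesgue)) (at s within {0..h})"
proof (rule test_fun_bound[OF \<phi>])
  fix B K assume K: "compact K" "B \<ge> 0" "\<And>x. \<bar>\<phi> x\<bar> \<le> B * indicator K x"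
    "\<And>i x. i \<in> Basis \<Longrightarrow> \<bar>frechet_derivative \<phi> (at x) i\<bar> \<le> B * indicator K x"
  define Q where "Q = (\<lambda>(x, s). x - s *\<^sub>R i) ` (K \<times> {0..h})"
  have Q: "compact Q" unfolding Q_def
    by (intro compact_continuous_image compact_Times K) (auto simp: case_prod_beta intro!: continuous_intros)
  have Q': "indicator K (x + s *\<^sub>R i) \<le> (indicator Q x :: real)" if "s \<in> {0..h}" for x s
    using that by (auto simp: indicator_def Q_def intro!: image_eqI[of _ _ "(x + s *\<^sub>R i, s)"])
  show ?thesis
  proof (rule integral_has_derivative[where Q=Q and B=B and K="\<lambda>s x. \<phi> (x + s *\<^sub>R i)"
        and dK="\<lambda>s x. frechet_derivative \<phi> (at (x + s *\<^sub>R i)) i"])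
    have "sq_integrable (indicator Q :: 'a \<Rightarrow> real)"
      by (rule sq_integrable_indicat_real) (rule lmeasurable_compact[OF Q])
    then show "integrable lebesgue (\<lambda>x. rep u x * indicator Q x)" by (rule sq_integrable_mult[OF rep_sq_integrable])
    show "(\<lambda>x. \<phi> (x + s *\<^sub>R i)) \<in> borel_measurable lebesgue" for s
      by (intro continuous_lebesgue_measurable continuous_on_compose2[OF test_fun_continuous[OF \<phi>]] continuous_intros) auto
    show "(\<lambda>x. frechet_derivative \<phi> (at (x + s *\<^sub>R i)) i) \<in> borel_measurable lebesgue" for s
      by (intro continuous_lebesgue_measurable continuous_on_compose2[OF test_fun_pderiv_continuous[OF \<phi> i]] continuous_intros) auto
    show "((\<lambda>s. \<phi> (x + s *\<^sub>R i)) has_real_derivative frechet_derivative \<phi> (at (x + s *\<^sub>R i)) i) (at s within {0..h})" for s x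
    proof -
      have "((\<lambda>s. x + s *\<^sub>R i) has_derivative (\<lambda>h. h *\<^sub>R i)) (at s within {0..h})"
        by (auto intro!: derivative_eq_intros)
      from has_derivative_compose[OF this test_fun_has_derivative[OF \<phi>]]
      have "((\<lambda>s. \<phi> (x + s *\<^sub>R i)) has_derivative (\<lambda>h. frechet_derivative \<phi> (at (x + s *\<^sub>R i)) (h *\<^sub>R i))) (at s within {0..h})" .
      moreover have "frechet_derivative \<phi> (at (x + s *\<^sub>R i)) (h *\<^sub>R i) = frechet_derivative \<phi> (at (x + s *\<^sub>R i)) i * h" for h
        using linear_scale[OF has_derivative_linear[OF test_fun_has_derivative[OF \<phi>]]] by simp
      ultimately show ?thesis by (simp add: has_field_derivative_def)
    qed
    fix s x assume s: "s \<in> {0..h}"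
    show "\<bar>\<phi> (x + s *\<^sub>R i)\<bar> \<le> B * indicator Q x"
      using order_trans[OF K(3) mult_left_mono[OF Q'[OF s] K(2)]] .
    show "\<bar>frechet_derivative \<phi> (at (x + s *\<^sub>R i)) i\<bar> \<le> B * indicator Q x"
      using order_trans[OF K(4)[OF i] mult_left_mono[OF Q'[OF s] K(2)]] .
  qed (use s in auto)
qed

lemma sq_integrable_translate:
  assumes "sq_integrable f" shows "sq_integrable (\<lambda>x. f (a + x))"
  unfolding sq_integrable_def
proof
  show "(\<lambda>x. f (a + x)) \<in> borel_measurable lebesgue"
    using measurable_compose[OF translation_lebesgue(1) sq_integrableD[OF assms]] .
  show "integrable lebesgue (\<lambda>x. (norm (f (a + x)))\<^sup>2)"
    using assms integrable_translate[of "\<lambda>x. (norm (f x))\<^sup>2" a] by (simp add: sq_integrable_def)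
qed

lemma integral_translate_mult:
  fixes u \<psi> :: "'a::euclidean_space \<Rightarrow> real"
  assumes "sq_integrable u" "sq_integrable \<psi>"
  shows "(\<integral>x. u (x - a) * \<psi> x \<partial>lebesgue) = (\<integral>x. u x * \<psi> (x + a) \<partial>lebesgue)"
proof -
  have "(\<lambda>x. u (- a + x) * \<psi> x) \<in> borel_measurable lebesgue"
    using sq_integrable_translate[OF assms(1), of "- a"] assms(2) by (simp add: sq_integrableD borel_measurable_times)
  from integral_translate[OF this, of a] show ?thesis by (simp add: add.commute)
qed

definition increment :: "'a::euclidean_space \<Rightarrow> ('a, real) l2 \<Rightarrow> ('a, real) l2" where
  "increment a u = cls (\<lambda>x. rep u (x - a) - rep u x)"

lemma increment_sq: "sq_integrable (\<lambda>x. rep u (x - a) - rep u x)"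
  using sq_integrable_diff[OF sq_integrable_translate[OF rep_sq_integrable, of u "- a"] rep_sq_integrable[of u]] by simp

lemma increment_inner:
  assumes \<psi>: "sq_integrable \<psi>"
  shows "increment a u \<bullet> cls \<psi> = (\<integral>x. rep u x * \<psi> (x + a) \<partial>lebesgue) - (\<integral>x. rep u x * \<psi> x \<partial>lebesgue)"
proof -
  have "increment a u \<bullet> cls \<psi> = (\<integral>x. rep u (x - a) * \<psi> x - rep u x * \<psi> x \<partial>lebesgue)"
    unfolding increment_def cls_inner[OF increment_sq \<psi>] by (simp add: left_diff_distrib)
  also have "\<dots> = (\<integral>x. rep u (x - a) * \<psi> x \<partial>lebesgue) - (\<integral>x. rep u x * \<psi> x \<partial>lebesgue)"
    using sq_integrable_translate[OF rep_sq_integrable, of u "- a"]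
    by (intro Bochner_Integration.integral_diff sq_integrable_mult \<psi>) auto
  finally show ?thesis by (simp add: integral_translate_mult[OF rep_sq_integrable \<psi>])
qed

text \<open>Tested against \<open>\<psi>\<close>, the increment is the change of \<open>\<langle>u, \<psi>(\<cdot> + s i)\<rangle>\<close> between \<open>s = 0\<close> and \<open>s = h\<close>. Its
  derivative in \<open>s\<close> is \<open>- \<langle>g, \<psi>(\<cdot> + s i)\<rangle>\<close>, which is at most \<open>\<parallel>g\<parallel> \<parallel>\<psi>\<parallel>\<close>.\<close>

lemma increment_bound:
  assumes w: "weak_deriv D i u g" and i: "i \<in> Basis" and U: "open U" and h: "h \<ge> 0"
    and UD: "\<And>x s. x \<in> U \<Longrightarrow> s \<in> {0..h} \<Longrightarrow> x - s *\<^sub>R i \<in> D"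
  shows "norm (restr U (increment (h *\<^sub>R i) u)) \<le> h * norm g"
proof (rule norm_restr_le_if_tested[OF U])
  show "0 \<le> h * norm g" using h by simp
  fix \<psi> :: "'a \<Rightarrow> real" assume \<psi>: "\<psi> \<in> test_fun U"
  have sq: "sq_integrable (\<lambda>x. \<psi> (x + a))" for a
    using sq_integrable_translate[OF test_fun_sq_integrable(1)[OF \<psi>], of a] by (simp add: add.commute)
  have "norm ((\<integral>x. rep u x * \<psi> (x + h *\<^sub>R i) \<partial>lebesgue) - (\<integral>x. rep u x * \<psi> (x + 0 *\<^sub>R i) \<partial>lebesgue)) \<le>
      (norm g * norm (cls \<psi>)) * norm (h - 0)"
  proof (rule field_differentiable_bound[of "{0..h}"])
    fix s assume s: "s \<in> {0..h}"
    show "((\<lambda>s. \<integral>x. rep u x * \<psi> (x + s *\<^sub>R i) \<partial>lebesgue) has_real_derivative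
        (\<integral>x. rep u x * frechet_derivative \<psi> (at (x + s *\<^sub>R i)) i \<partial>lebesgue)) (at s within {0..h})"
      by (rule translated_test_fun[OF \<psi> i s])
    define \<phi> where "\<phi> x = \<psi> (x + s *\<^sub>R i)" for x
    have \<phi>: "\<phi> \<in> test_fun D"
    proof (rule test_funE[OF \<psi>])
      fix K assume K: "smooth_fun \<psi>" "compact K" "K \<subseteq> U" "\<And>x. x \<notin> K \<Longrightarrow> \<psi> x = 0"
      show ?thesis
      proof (rule test_funI[of _ "(\<lambda>x. x - s *\<^sub>R i) ` K"])
        show "smooth_fun \<phi>" using smooth_fun_translate[OF K(1), of "- s *\<^sub>R i"] by (simp add: \<phi>_def[abs_def])
        show "compact ((\<lambda>x. x - s *\<^sub>R i) ` K)" by (intro compact_continuous_image K continuous_intros)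
        show "(\<lambda>x. x - s *\<^sub>R i) ` K \<subseteq> D" using K(3) UD s by auto
        show "\<phi> x = 0" if "x \<notin> (\<lambda>x. x - s *\<^sub>R i) ` K" for x
        proof -
          have "x + s *\<^sub>R i \<notin> K"
          proof
            assume "x + s *\<^sub>R i \<in> K"
            then have "(x + s *\<^sub>R i) - s *\<^sub>R i \<in> (\<lambda>x. x - s *\<^sub>R i) ` K" by (rule imageI)
            then show False using that by simp
          qed
          then show ?thesis unfolding \<phi>_def by (rule K(4))
        qed
      qed
    qed
    have "frechet_derivative \<phi> (at x) = frechet_derivative \<psi> (at (x + s *\<^sub>R i))" for x
    proof (rule frechet_derivative_at[symmetric])
      have "((\<lambda>x. x + s *\<^sub>R i) has_derivative (\<lambda>h. h)) (at x)" by (auto intro!: derivative_eq_intros)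
      from has_derivative_compose[OF this test_fun_has_derivative[OF \<psi>]]
      show "(\<phi> has_derivative frechet_derivative \<psi> (at (x + s *\<^sub>R i))) (at x)" unfolding \<phi>_def .
    qed
    then have "(\<integral>x. rep u x * frechet_derivative \<psi> (at (x + s *\<^sub>R i)) i \<partial>lebesgue) =
        u \<bullet> cls (\<lambda>x. frechet_derivative \<phi> (at x) i)"
      using l2_inner_cls[OF test_fun_pderiv_sq_integrable(1)[OF \<phi> i], of u] by simp
    also have "\<dots> = - (g \<bullet> cls \<phi>)" using w \<phi> unfolding weak_deriv_def by blast
    finally have "norm (\<integral>x. rep u x * frechet_derivative \<psi> (at (x + s *\<^sub>R i)) i \<partial>lebesgue) = \<bar>g \<bullet> cls \<phi>\<bar>" by simp
    also have "\<dots> \<le> norm g * norm (cls \<phi>)" by (rule Cauchy_Schwarz_ineq2)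
    also have "norm (cls \<phi>) = norm (cls \<psi>)"
    proof -
      have "(norm (cls \<phi>))\<^sup>2 = (\<integral>x. (norm (\<psi> (s *\<^sub>R i + x)))\<^sup>2 \<partial>lebesgue)"
        using l2_norm_cls[OF test_fun_sq_integrable(1)[OF \<phi>]] by (simp add: \<phi>_def add.commute)
      also have "\<dots> = (\<integral>x. (norm (\<psi> x))\<^sup>2 \<partial>lebesgue)"
        using test_fun_sq_integrable(1)[OF \<psi>]
        by (intro integral_translate) (auto simp: sq_integrable_def)
      also have "\<dots> = (norm (cls \<psi>))\<^sup>2" using l2_norm_cls[OF test_fun_sq_integrable(1)[OF \<psi>]] by simp
      finally show ?thesis by simp
    qed
    finally show "norm (\<integral>x. rep u x * frechet_derivative \<psi> (at (x + s *\<^sub>R i)) i \<partial>lebesgue) \<le> norm g * norm (cls \<psi>)" .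
  qed (use h in auto)
  then show "\<bar>increment (h *\<^sub>R i) u \<bullet> cls \<psi>\<bar> \<le> h * norm g * norm (cls \<psi>)"
    using h by (simp add: increment_inner[OF test_fun_sq_integrable(1)[OF \<psi>]] mult.commute mult.left_commute)
qed

text \<open>A converse to the previous bound: paired with a test function \<open>\<phi>\<close>, the increments divided by \<open>h\<close> tend to
  the pairing of \<open>v\<close> with the derivative of \<open>\<phi>\<close>. The latter is therefore at most \<open>C \<parallel>\<phi>\<parallel>\<close>, and the
  Riesz representation theorem yields the weak derivative.\<close>

lemma weak_deriv_if_increment_bound:
  fixes v :: "('a::euclidean_space, real) l2"
  assumes i: "i \<in> Basis" and C: "C \<ge> 0"
    and bound: "\<And>K. compact K \<Longrightarrow> K \<subseteq> D \<Longrightarrow>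
      \<forall>\<^sub>F h in at_right 0. norm (restr K (increment (h *\<^sub>R i) v)) \<le> h * C"
  obtains z where "weak_deriv D i v z" "norm z \<le> C"
proof -
  have key: "\<bar>v \<bullet> cls (\<lambda>x. frechet_derivative \<phi> (at x) i)\<bar> \<le> C * norm (cls \<phi>)" if \<phi>: "\<phi> \<in> test_fun D" for \<phi>
  proof (rule test_fun_bound[OF \<phi>])
    fix B K assume K: "compact K" "K \<subseteq> D" "B \<ge> 0" "\<And>x. \<bar>\<phi> x\<bar> \<le> B * indicator K x"
    have Kl: "K \<in> sets lebesgue" using lmeasurable_compact[OF K(1)] by blast
    define j where "j s = (\<integral>x. rep v x * \<phi> (x + s *\<^sub>R i) \<partial>lebesgue)" for s
    define j' where "j' = v \<bullet> cls (\<lambda>x. frechet_derivative \<phi> (at x) i)"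
    have "(j has_real_derivative j') (at 0 within {0..1})"
      unfolding j_def j'_def using translated_test_fun[OF \<phi> i, of 0 1 v]
      by (simp add: l2_inner_cls[OF test_fun_pderiv_sq_integrable(1)[OF \<phi> i]])
    then have "((\<lambda>h. (j h - j 0) / (h - 0)) \<longlongrightarrow> j') (at_right 0)"
      by (simp add: has_field_derivative_iff at_within_Icc_at_right)
    then have lim: "((\<lambda>h. \<bar>(j h - j 0) / (h - 0)\<bar>) \<longlongrightarrow> \<bar>j'\<bar>) (at_right 0)" by (rule tendsto_rabs)
    have "\<forall>\<^sub>F h in at_right 0. \<bar>(j h - j 0) / (h - 0)\<bar> \<le> C * norm (cls \<phi>)"
      using bound[OF K(1,2)] eventually_at_right_less[of 0]
    proof eventually_elim
      fix h :: real assume h: "norm (restr K (increment (h *\<^sub>R i) v)) \<le> h * C" "0 < h"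
      have "restr K (cls \<phi>) = cls \<phi>"
      proof -
        have "(\<lambda>x. indicator K x *\<^sub>R \<phi> x) = \<phi>"
        proof
          show "indicator K x *\<^sub>R \<phi> x = \<phi> x" for x using K(4)[of x] by (auto simp: indicator_def split: if_splits)
        qed
        then show ?thesis using restr_cls[OF Kl test_fun_sq_integrable(1)[OF \<phi>]] by simp
      qed
      then have "j h - j 0 = restr K (increment (h *\<^sub>R i) v) \<bullet> cls \<phi>"
        unfolding restr_sym[OF Kl] by (simp add: increment_inner[OF test_fun_sq_integrable(1)[OF \<phi>]] j_def)
      also have "\<bar>\<dots>\<bar> \<le> norm (restr K (increment (h *\<^sub>R i) v)) * norm (cls \<phi>)" by (rule Cauchy_Schwarz_ineq2)
      also have "\<dots> \<le> h * C * norm (cls \<phi>)" using h(1) by (rule mult_right_mono) simp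
      finally show "\<bar>(j h - j 0) / (h - 0)\<bar> \<le> C * norm (cls \<phi>)"
        using h(2) by (simp add: field_simps)
    qed
    then show ?thesis unfolding j'_def[symmetric] using tendsto_upperbound[OF lim] by simp
  qed
  define G where "G = (\<lambda>\<phi>. (cls \<phi>, - (v \<bullet> cls (\<lambda>x. frechet_derivative \<phi> (at x) i)))) ` test_fun D"
  have "subspace G" unfolding G_def
  proof (rule subspace_test_functional)
    fix \<phi> \<psi> :: "'a \<Rightarrow> real" and c assume \<phi>: "\<phi> \<in> test_fun D"
    note d\<phi> = test_fun_pderiv_sq_integrable(1)[OF \<phi> i]
    show "- (v \<bullet> cls (\<lambda>x. frechet_derivative (\<lambda>x. c * \<phi> x) (at x) i)) =
        c * - (v \<bullet> cls (\<lambda>x. frechet_derivative \<phi> (at x) i))"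
      unfolding pderiv_scale[OF \<phi>] using cls_scale[OF d\<phi>, of c, symmetric] by simp
    assume \<psi>: "\<psi> \<in> test_fun D"
    note d\<psi> = test_fun_pderiv_sq_integrable(1)[OF \<psi> i]
    show "- (v \<bullet> cls (\<lambda>x. frechet_derivative (\<lambda>x. \<phi> x + \<psi> x) (at x) i)) =
        - (v \<bullet> cls (\<lambda>x. frechet_derivative \<phi> (at x) i)) + - (v \<bullet> cls (\<lambda>x. frechet_derivative \<psi> (at x) i))"
      unfolding pderiv_add[OF \<phi> \<psi>] using cls_add[OF d\<phi> d\<psi>, symmetric] by (simp add: inner_add_right)
  qed
  then obtain z where z: "\<And>x t. (x, t) \<in> G \<Longrightarrow> t = z \<bullet> x" "norm z \<le> C"
    by (rule Riesz_relation[OF _ C]) (use key in \<open>auto simp: G_def\<close>)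
  have "weak_deriv D i v z"
    unfolding weak_deriv_def
  proof
    fix \<phi> :: "'a \<Rightarrow> real" assume "\<phi> \<in> test_fun D"
    then have "- (v \<bullet> cls (\<lambda>x. frechet_derivative \<phi> (at x) i)) = z \<bullet> cls \<phi>"
      by (intro z(1)) (auto simp: G_def)
    then show "v \<bullet> cls (\<lambda>x. frechet_derivative \<phi> (at x) i) = - (z \<bullet> cls \<phi>)" by simp
  qed
  then show ?thesis using z(2) by (rule that)
qed

text \<open>The increments of \<open>\<tau> \<circ> u\<close> are pointwise dominated by those of \<open>u\<close>. Characterizing weak derivatives
  by increments thus replaces a chain rule.\<close>

lemma weak_deriv_contraction:
  fixes u :: "('a::euclidean_space, real) l2" and \<tau> :: "real \<Rightarrow> real"
  assumes D: "open D" and i: "i \<in> Basis" and w: "weak_deriv D i u g"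
    and \<tau>: "\<And>s t. \<bar>\<tau> s - \<tau> t\<bar> \<le> \<bar>s - t\<bar>" and sq: "sq_integrable (\<lambda>x. \<tau> (rep u x))"
  obtains z where "weak_deriv D i (cls (\<lambda>x. \<tau> (rep u x))) z" "norm z \<le> norm g"
proof (rule weak_deriv_if_increment_bound[OF i norm_ge_zero])
  fix K :: "'a set" assume K: "compact K" "K \<subseteq> D"
  then obtain e where e: "e > 0" "(\<Union>x\<in>K. ball x e) \<subseteq> D"
    using compact_subset_open_imp_ball_epsilon_subset[OF K(1) D] by blast
  define U where "U = (\<Union>x\<in>K. ball x (e / 2))"
  have U: "open U" "K \<subseteq> U" using e(1) unfolding U_def by (auto intro!: bexI)
  have Kl: "K \<in> sets lebesgue" using lmeasurable_compact[OF K(1)] by blast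
  have Ul: "U \<in> sets lebesgue" using U(1) by simp
  have "norm (restr K (increment (h *\<^sub>R i) (cls (\<lambda>x. \<tau> (rep u x))))) \<le> h * norm g" if h: "0 < h" "h < e / 2" for h
  proof -
    have "norm (restr U (increment (h *\<^sub>R i) u)) \<le> h * norm g"
    proof (rule increment_bound[OF w i U(1)])
      fix x s assume xs: "x \<in> U" "s \<in> {0..h}"
      then obtain y where y: "y \<in> K" "dist y x < e / 2" unfolding U_def by auto
      have "dist x (x - s *\<^sub>R i) < e / 2" using xs(2) h i by (simp add: dist_norm)
      then have "x - s *\<^sub>R i \<in> ball y e" using y(2) dist_triangle[of y "x - s *\<^sub>R i" x] by simp
      then show "x - s *\<^sub>R i \<in> D" using e(2) y(1) by blast
    qed (use h in auto)
    moreover have "norm (restr K (increment (h *\<^sub>R i) (cls (\<lambda>x. \<tau> (rep u x))))) \<le> norm (restr U (increment (h *\<^sub>R i) u))"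
    proof (rule norm_le_if_pointwise)
      let ?v = "cls (\<lambda>x. \<tau> (rep u x))"
      have tr: "AE x in lebesgue. rep ?v (x - h *\<^sub>R i) = \<tau> (rep u (x - h *\<^sub>R i))"
      proof -
        have "AE x in distr lebesgue lebesgue (\<lambda>x. - (h *\<^sub>R i) + x). rep ?v x = \<tau> (rep u x)"
          unfolding translation_lebesgue(2) by (rule rep_cls[OF sq])
        from AE_distrD[OF translation_lebesgue(1) this]
        have "AE x in lebesgue. rep ?v (- (h *\<^sub>R i) + x) = \<tau> (rep u (- (h *\<^sub>R i) + x))" .
        then show ?thesis by simp
      qed
      show "AE x in lebesgue. norm (rep (restr K (increment (h *\<^sub>R i) ?v)) x) \<le> norm (rep (restr U (increment (h *\<^sub>R i) u)) x)"
        using rep_restr[OF Kl, of "increment (h *\<^sub>R i) ?v"] rep_restr[OF Ul, of "increment (h *\<^sub>R i) u"]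
          rep_cls[OF increment_sq[of ?v "h *\<^sub>R i"]] rep_cls[OF increment_sq[of u "h *\<^sub>R i"]] tr rep_cls[OF sq]
        unfolding increment_def[symmetric]
      proof eventually_elim
        case (elim x)
        then show ?case using \<tau>[of "rep u (x - h *\<^sub>R i)" "rep u x"] U(2) by (auto simp: indicator_def)
      qed
    qed
    ultimately show ?thesis by linarith
  qed
  then show "\<forall>\<^sub>F h in at_right 0. norm (restr K (increment (h *\<^sub>R i) (cls (\<lambda>x. \<tau> (rep u x))))) \<le> h * norm g"
    unfolding eventually_at_right_field using e(1) by (intro exI[of _ "e / 2"]) auto
qed

definition coord :: "'a::euclidean_space \<Rightarrow> ('a, 'a) l2 \<Rightarrow> ('a, real) l2" where
  "coord i w = cls (\<lambda>x. rep w x \<bullet> i)"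

lemma coord_sq: "i \<in> Basis \<Longrightarrow> sq_integrable (\<lambda>x. rep w x \<bullet> i)"
proof (rule sq_integrable_bound)
  assume i: "i \<in> Basis"
  show "integrable lebesgue (\<lambda>x. (norm (rep w x))\<^sup>2)" using rep_sq_integrable[of w] unfolding sq_integrable_def by blast
  show "(norm (rep w x \<bullet> i))\<^sup>2 \<le> (norm (rep w x))\<^sup>2" for x
    using Basis_le_norm[OF i, of "rep w x"] by (intro power_mono) auto
qed (intro borel_measurable_inner rep_measurable borel_measurable_const)

lemma rep_coord: "i \<in> Basis \<Longrightarrow> AE x in lebesgue. rep (coord i w) x = rep w x \<bullet> i"
  unfolding coord_def by (rule rep_cls[OF coord_sq])

lemma coord_linear: "i \<in> Basis \<Longrightarrow> linear (coord i)"
proof (rule linearI)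
  fix f g :: "('a, 'a) l2" and c assume i: "i \<in> Basis"
  show "coord i (f + g) = coord i f + coord i g"
    by (rule l2_eqI)
      (use rep_coord[OF i, of "f + g"] rep_coord[OF i, of f] rep_coord[OF i, of g] rep_add[of f g]
         rep_add[of "coord i f" "coord i g"] in \<open>eventually_elim, simp add: inner_add_left\<close>)
  show "coord i (c *\<^sub>R f) = c *\<^sub>R coord i f"
    by (rule l2_eqI)
      (use rep_coord[OF i, of "c *\<^sub>R f"] rep_coord[OF i, of f] rep_scale[of c f]
         rep_scale[of c "coord i f"] in \<open>eventually_elim, simp\<close>)
qed

lemma inner_eq_sum_coord: "w \<bullet> z = (\<Sum>i\<in>Basis. coord i w \<bullet> coord i z)"
proof -
  have "w \<bullet> z = (\<integral>x. (\<Sum>i\<in>Basis. (rep w x \<bullet> i) * (rep z x \<bullet> i)) \<partial>lebesgue)"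
    unfolding l2_inner_rep by (rule Bochner_Integration.integral_cong) (auto intro: euclidean_inner)
  also have "\<dots> = (\<Sum>i\<in>Basis. \<integral>x. (rep w x \<bullet> i) * (rep z x \<bullet> i) \<partial>lebesgue)"
    by (rule Bochner_Integration.integral_sum) (intro sq_integrable_mult coord_sq)
  also have "\<dots> = (\<Sum>i\<in>Basis. coord i w \<bullet> coord i z)"
    by (rule sum.cong) (auto simp: coord_def cls_inner coord_sq)
  finally show ?thesis .
qed

lemma coord_norm: assumes "i \<in> Basis" shows "norm (coord i w) \<le> norm w"
proof -
  have "AE x in lebesgue. norm (rep (coord i w) x) \<le> norm (rep w x)"
    using rep_coord[OF assms, of w] by eventually_elim (use Basis_le_norm[OF assms] in simp)
  then show ?thesis by (rule norm_le_if_pointwise)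
qed

lemma coord_bounded_linear: "i \<in> Basis \<Longrightarrow> bounded_linear (coord i)"
  by (rule bounded_linear_intro[of _ 1])
    (auto simp: linear_add[OF coord_linear] linear_scale[OF coord_linear] coord_norm)

lemma coord_restr:
  assumes i: "i \<in> Basis" and A: "A \<in> sets lebesgue"
  shows "coord i (restr A w) = restr A (coord i w)"
  by (rule l2_eqI)
    (use rep_coord[OF i, of "restr A w"] rep_coord[OF i, of w] rep_restr[OF A, of w]
       rep_restr[OF A, of "coord i w"] in \<open>eventually_elim, simp\<close>)

lemma l2_of_components:
  fixes z :: "'a::euclidean_space \<Rightarrow> ('a, real) l2"
  obtains w :: "('a, 'a) l2" where "\<And>i. i \<in> Basis \<Longrightarrow> coord i w = z i"
proof -
  have sq: "sq_integrable (\<lambda>x. \<Sum>i\<in>Basis. rep (z i) x *\<^sub>R i :: 'a)"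
  proof -
    have t: "sq_integrable (\<lambda>x. rep (z i) x *\<^sub>R i :: 'a)" for i
    proof (rule sq_integrable_bound)
      show "integrable lebesgue (\<lambda>x. (norm i)\<^sup>2 * (norm (rep (z i) x))\<^sup>2)"
        using rep_sq_integrable[of "z i"] unfolding sq_integrable_def by (intro integrable_mult_right) blast
    qed (auto simp: power_mult_distrib intro!: borel_measurable_scaleR)
    have "sq_integrable (\<lambda>x. \<Sum>i\<in>A. rep (z i) x *\<^sub>R i :: 'a)" if "finite A" for A
      using that by (induction A rule: finite_induct) (auto simp: sq_integrable_0 intro: sq_integrable_add t)
    then show ?thesis by simp
  qed
  show ?thesis
  proof (rule that[of "cls (\<lambda>x. \<Sum>i\<in>Basis. rep (z i) x *\<^sub>R i)"])
    fix i :: 'a assume i: "i \<in> Basis"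
    show "coord i (cls (\<lambda>x. \<Sum>i\<in>Basis. rep (z i) x *\<^sub>R i)) = z i"
      by (rule l2_eqI)
        (use rep_coord[OF i, of "cls (\<lambda>x. \<Sum>i\<in>Basis. rep (z i) x *\<^sub>R i)"] rep_cls[OF sq]
          in \<open>eventually_elim, simp add: i\<close>)
  qed
qed

lemma weak_deriv_unique:
  assumes D: "open D" and "weak_deriv D i u g" "weak_deriv D i u g'"
  shows "restr D g = restr D g'"
proof -
  have "norm (restr D (g - g')) \<le> 0"
  proof (rule norm_restr_le_if_tested[OF D order_refl])
    fix \<psi> :: "'a \<Rightarrow> real" assume "\<psi> \<in> test_fun D"
    then have "g \<bullet> cls \<psi> = g' \<bullet> cls \<psi>" using assms(2,3) unfolding weak_deriv_def by fastforce
    then show "\<bar>(g - g') \<bullet> cls \<psi>\<bar> \<le> 0 * norm (cls \<psi>)" by (simp add: inner_diff_left)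
  qed
  then show ?thesis using D by (simp add: linear_diff[OF restr_linear])
qed

lemma cls_test_fun_restr:
  assumes D: "D \<in> sets lebesgue" and \<phi>: "\<phi> \<in> test_fun D"
  shows "restr D (cls \<phi>) = cls \<phi>"
    and "i \<in> Basis \<Longrightarrow> restr D (cls (\<lambda>x. frechet_derivative \<phi> (at x) i)) = cls (\<lambda>x. frechet_derivative \<phi> (at x) i)"
proof -
  obtain K where K: "K \<subseteq> D" "\<And>x. x \<notin> K \<Longrightarrow> \<phi> x = 0" "\<And>x i. x \<notin> K \<Longrightarrow> frechet_derivative \<phi> (at x) i = 0"
    by (rule test_funE[OF \<phi>]) blast
  have "(\<lambda>x. indicator D x *\<^sub>R \<phi> x) = \<phi>" using K by (auto simp: fun_eq_iff indicator_def)
  then show "restr D (cls \<phi>) = cls \<phi>" using restr_cls[OF D test_fun_sq_integrable(1)[OF \<phi>]] by simp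
  assume i: "i \<in> Basis"
  have "(\<lambda>x. indicator D x *\<^sub>R frechet_derivative \<phi> (at x) i) = (\<lambda>x. frechet_derivative \<phi> (at x) i)"
    using K by (auto simp: fun_eq_iff indicator_def)
  then show "restr D (cls (\<lambda>x. frechet_derivative \<phi> (at x) i)) = cls (\<lambda>x. frechet_derivative \<phi> (at x) i)"
    using restr_cls[OF D test_fun_pderiv_sq_integrable(1)[OF \<phi> i]] by simp
qed

lemma weak_deriv_restr:
  assumes D: "D \<in> sets lebesgue" and i: "i \<in> Basis"
  shows "weak_deriv D i (restr D u) g \<longleftrightarrow> weak_deriv D i u g" "weak_deriv D i u (restr D g) \<longleftrightarrow> weak_deriv D i u g"
  unfolding weak_deriv_def by (auto simp: restr_sym[OF D] cls_test_fun_restr[OF D] i)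

lemma restr_complement: assumes A: "A \<in> sets lebesgue" shows "restr A f + restr (- A) f = f"
proof -
  have A': "- A \<in> sets lebesgue" using A by (metis Compl_in_sets_lebesgue)
  show ?thesis
    by (rule l2_eqI)
      (use rep_restr[OF A, of f] rep_restr[OF A', of f] rep_add[of "restr A f" "restr (- A) f"]
        in \<open>eventually_elim, simp add: indicator_def\<close>)
qed

lemma restr_disjoint:
  assumes "A \<in> sets lebesgue" "B \<in> sets lebesgue" "A \<inter> B = {}" shows "restr A (restr B f) = 0"
  unfolding restr_0_iff[OF assms(1)] using rep_restr[OF assms(2), of f]
  by eventually_elim (use assms(3) in \<open>auto simp: indicator_def\<close>)

text \<open>The graph of the weak gradient in \<open>D\<close>, for functions on the whole space whose values outside \<open>D\<close> are
  arbitrary. This adds the zero form on \<open>L\<^sup>2\<close> of the complement to the Dirichlet form of \<open>D\<close>. The domain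
  of the sum is dense in \<open>L\<^sup>2\<close> of the whole space, and the two summands do not interact.\<close>

definition grad_graph :: "'a::euclidean_space set \<Rightarrow> (('a, real) l2 \<times> ('a, 'a) l2) set" where
  "grad_graph D = {(u, w). (\<forall>i\<in>Basis. weak_deriv D i u (coord i w)) \<and> restr (- D) w = 0}"

text \<open>The scaling produces the form \<open>\<langle>\<nabla>u, \<nabla>v\<rangle> / 2\<close>.\<close>

definition half_graph :: "'a::euclidean_space set \<Rightarrow> (('a, real) l2 \<times> ('a, 'a) l2) set" where
  "half_graph D = {(u, w). (u, sqrt 2 *\<^sub>R w) \<in> grad_graph D}"

locale open_domain =
  fixes D :: "'a::euclidean_space set"
  assumes open_D: "open D"
begin

lemma D_sets [simp]: "D \<in> sets lebesgue" "- D \<in> sets lebesgue"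
  using open_D by (auto intro!: Compl_in_sets_lebesgue[THEN iffD2])

lemma closed_grad_graph: "closed (grad_graph D)"
proof -
  have eq: "grad_graph D = (\<Inter>i\<in>Basis. \<Inter>\<phi>\<in>test_fun D.
      {p. fst p \<bullet> cls (\<lambda>x. frechet_derivative \<phi> (at x) i) = - (coord i (snd p) \<bullet> cls \<phi>)}) \<inter> {p. restr (- D) (snd p) = 0}"
    by (auto simp: grad_graph_def weak_deriv_def)
  have c1: "continuous_on UNIV (\<lambda>p :: ('a, real) l2 \<times> ('a, 'a) l2. coord i (snd p))" if "i \<in> Basis" for i
    using bounded_linear.continuous_on[OF coord_bounded_linear[OF that] continuous_on_snd[OF continuous_on_id]] .
  have c2: "continuous_on UNIV (\<lambda>p :: ('a, real) l2 \<times> ('a, 'a) l2. restr (- D) (snd p))"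
    using bounded_linear.continuous_on[OF restr_bounded_linear[OF D_sets(2)] continuous_on_snd[OF continuous_on_id]] .
  show ?thesis unfolding eq
    by (intro closed_Int closed_INT ballI closed_Collect_eq continuous_intros c1 c2) auto
qed

lemma subspace_grad_graph: "subspace (grad_graph D)"
proof (rule subspaceI)
  show "0 \<in> grad_graph D"
    by (auto simp: grad_graph_def zero_prod_def weak_deriv_def linear_0[OF coord_linear] linear_0[OF restr_linear])
  show "x + y \<in> grad_graph D" if "x \<in> grad_graph D" "y \<in> grad_graph D" for x y
    using that by (auto simp: grad_graph_def weak_deriv_def linear_add[OF coord_linear] linear_add[OF restr_linear] inner_add_left)
  show "c *\<^sub>R x \<in> grad_graph D" if "x \<in> grad_graph D" for c x
    using that by (auto simp: grad_graph_def weak_deriv_def linear_scale[OF coord_linear] linear_scale[OF restr_linear])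
qed

lemma restr_in_grad_graph:
  assumes "(u, w) \<in> grad_graph D" shows "(restr D u, w) \<in> grad_graph D"
  using assms by (auto simp: grad_graph_def weak_deriv_restr)

lemma complement_in_grad_graph: "(restr (- D) u, 0) \<in> grad_graph D"
proof -
  have "restr (- D) u \<bullet> cls (\<lambda>x. frechet_derivative \<phi> (at x) i) = 0" if "\<phi> \<in> test_fun D" "i \<in> Basis" for \<phi> i
  proof -
    have "restr (- D) u \<bullet> restr D (cls (\<lambda>x. frechet_derivative \<phi> (at x) i)) = 0"
      unfolding restr_sym[OF D_sets(1), symmetric] restr_disjoint[OF D_sets Compl_disjoint] by simp
    then show ?thesis using cls_test_fun_restr(2)[OF D_sets(1) that] by simp
  qed
  then show ?thesis
    by (auto simp: grad_graph_def weak_deriv_def linear_0[OF coord_linear] linear_0[OF restr_linear])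
qed

lemma test_fun_in_grad_graph:
  assumes \<phi>: "\<phi> \<in> test_fun D" shows "cls \<phi> \<in> fst ` grad_graph D"
proof -
  obtain w where w: "\<And>i. i \<in> Basis \<Longrightarrow> coord i w = cls (\<lambda>x. frechet_derivative \<phi> (at x) i)"
    by (rule l2_of_components[of "\<lambda>i. cls (\<lambda>x. frechet_derivative \<phi> (at x) i)"]) blast
  have wd: "weak_deriv D i (cls \<phi>) (cls (\<lambda>x. frechet_derivative \<phi> (at x) i))" if i: "i \<in> Basis" for i
    unfolding weak_deriv_def
  proof
    fix \<psi> :: "'a \<Rightarrow> real" assume \<psi>: "\<psi> \<in> test_fun D"
    have "(\<integral>x. \<phi> x * frechet_derivative \<psi> (at x) i \<partial>lebesgue) = - (\<integral>x. frechet_derivative \<phi> (at x) i * \<psi> x \<partial>lebesgue)"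
      by (rule integration_by_parts) (use \<phi> \<psi> i test_fun_mono in auto)
    then show "cls \<phi> \<bullet> cls (\<lambda>x. frechet_derivative \<psi> (at x) i) = - (cls (\<lambda>x. frechet_derivative \<phi> (at x) i) \<bullet> cls \<psi>)"
      using cls_inner[OF test_fun_sq_integrable(1)[OF \<phi>] test_fun_pderiv_sq_integrable(1)[OF \<psi> i]]
        cls_inner[OF test_fun_pderiv_sq_integrable(1)[OF \<phi> i] test_fun_sq_integrable(1)[OF \<psi>]] by simp
  qed
  have "weak_deriv D i (cls \<phi>) (coord i (restr D w))" if i: "i \<in> Basis" for i
    unfolding coord_restr[OF i D_sets(1)] weak_deriv_restr[OF D_sets(1) i] w[OF i] by (rule wd[OF i])
  then have "(cls \<phi>, restr D w) \<in> grad_graph D"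
    by (simp add: grad_graph_def restr_disjoint)
  then show ?thesis by force
qed

text \<open>A vector orthogonal to all test functions vanishes on \<open>D\<close>, and functions supported outside \<open>D\<close> belong
  to the domain with gradient 0.\<close>

lemma dense_grad_graph: "closure (fst ` grad_graph D) = UNIV"
proof (rule dense_if_orthogonal_complement_trivial)
  show "subspace (fst ` grad_graph D)"
    by (rule linear_subspace_image[OF bounded_linear.linear[OF bounded_linear_fst] subspace_grad_graph])
  fix u assume u: "\<And>v. v \<in> fst ` grad_graph D \<Longrightarrow> u \<bullet> v = 0"
  have "norm (restr D u) \<le> 0"
    by (rule norm_restr_le_if_tested[OF open_D order_refl]) (use u test_fun_in_grad_graph in auto)
  then have 1: "restr D u = 0" by simp
  have "restr (- D) u \<in> fst ` grad_graph D" using complement_in_grad_graph[of u] by force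
  then have "u \<bullet> restr (- D) u = 0" by (rule u)
  then have "u \<bullet> u = 0"
    using restr_complement[OF D_sets(1), of u] 1 by simp
  then show "u = 0" by simp
qed

sublocale closed_form "half_graph D"
proof
  have "half_graph D = (\<lambda>p. (fst p, sqrt 2 *\<^sub>R snd p)) -` grad_graph D"
    by (auto simp: half_graph_def)
  then show "closed (half_graph D)"
    by (auto intro!: closed_vimage closed_grad_graph continuous_intros)
  show "subspace (half_graph D)"
  proof (rule subspaceI)
    show "0 \<in> half_graph D" using subspace_0[OF subspace_grad_graph] by (simp add: half_graph_def zero_prod_def)
    show "x + y \<in> half_graph D" if "x \<in> half_graph D" "y \<in> half_graph D" for x y
      using that subspace_add[OF subspace_grad_graph, of "(fst x, sqrt 2 *\<^sub>R snd x)" "(fst y, sqrt 2 *\<^sub>R snd y)"]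
      by (auto simp: half_graph_def scaleR_add_right)
    show "c *\<^sub>R x \<in> half_graph D" if "x \<in> half_graph D" for c x
      using that subspace_scale[OF subspace_grad_graph, of "(fst x, sqrt 2 *\<^sub>R snd x)" c]
      by (auto simp: half_graph_def mult.commute)
  qed
  have "fst ` half_graph D = fst ` grad_graph D"
  proof (intro equalityI subsetI)
    fix u assume "u \<in> fst ` grad_graph D"
    then obtain w where "(u, w) \<in> grad_graph D" by auto
    then have "(u, (1 / sqrt 2) *\<^sub>R w) \<in> half_graph D" by (simp add: half_graph_def)
    then show "u \<in> fst ` half_graph D" by force
  qed (force simp: half_graph_def)
  then show "closure (fst ` half_graph D) = UNIV" using dense_grad_graph by simp
qed

lemma half_graph_iff: "(u, (1 / sqrt 2) *\<^sub>R w) \<in> half_graph D \<longleftrightarrow> (u, w) \<in> grad_graph D"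
  by (simp add: half_graph_def)

text \<open>Multiplication with the indicator of \<open>D\<close> preserves the gradient, so the functions supported in \<open>D\<close> form an
  invariant convex set.\<close>

lemma T_supported: assumes "restr (- D) f = 0" "t \<ge> 0" shows "restr (- D) (T t f) = 0"
proof -
  define C where "C = {f :: ('a, real) l2. restr (- D) f = 0}"
  have "T t f \<in> C"
  proof (rule T_invariant)
    have "continuous_on UNIV (\<lambda>f :: ('a, real) l2. restr (- D) f)"
      using bounded_linear.continuous_on[OF restr_bounded_linear[OF D_sets(2)] continuous_on_id] .
    then show "closed C" unfolding C_def by (intro closed_Collect_eq continuous_intros)
    show "convex C" unfolding C_def convex_def
      by (simp add: linear_add[OF restr_linear] linear_scale[OF restr_linear])
    show "0 \<in> C" by (simp add: C_def linear_0[OF restr_linear])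
    fix a :: real and f assume a: "a > 0" and f: "f \<in> C"
    show "J a f \<in> C"
    proof (rule J_invariant[OF a f, where P="restr D"])
      fix u w assume "(u, w) \<in> half_graph D"
      then have "(restr D u, w) \<in> half_graph D"
        using restr_in_grad_graph by (auto simp: half_graph_def)
      then show "restr D u \<in> C \<and> (\<exists>z. (restr D u, z) \<in> half_graph D \<and> norm z \<le> norm w)"
        by (auto simp: C_def restr_disjoint)
    next
      fix u f :: "('a, real) l2" assume "f \<in> C"
      then have "restr D f = f" using restr_complement[OF D_sets(1), of f] by (simp add: C_def)
      then have "restr D u - f = restr D (u - f)" by (simp add: linear_diff[OF restr_linear])
      then show "norm (restr D u - f) \<le> norm (u - f)" by (simp add: restr_norm)
    qed
  qed (use assms in \<open>auto simp: C_def\<close>)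
  then show ?thesis by (simp add: C_def)
qed

lemma S_supported: assumes "restr (- D) f = 0" "N \<ge> 0" shows "restr (- D) (S N f) = 0"
proof -
  have "restr (- D) (S N f) = integral {0..N} (\<lambda>s. restr (- D) (T s f))"
    unfolding S_def
    using integral_linear[OF T_integrable[of 0 f N] restr_bounded_linear[OF D_sets(2)]] by (simp add: o_def)
  also have "\<dots> = integral {0..N} (\<lambda>s. 0)"
    by (rule integral_cong) (use assms in \<open>simp add: T_supported\<close>)
  finally show ?thesis by simp
qed

text \<open>Markov property: truncating the values of a function to an interval that contains 0 is a
  contraction of the form and of \<open>L\<^sup>2\<close>, so the semigroup preserves bounds on the values.\<close>

definition values_in :: "real set \<Rightarrow> ('a, real) l2 set" where
  "values_in I = {f. AE x in lebesgue. rep f x \<in> I}"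

definition clamp_l2 :: "real set \<Rightarrow> ('a, real) l2 \<Rightarrow> ('a, real) l2" where
  "clamp_l2 I f = cls (\<lambda>x. closest_point I (rep f x))"

context
  fixes I :: "real set"
  assumes I: "closed I" "convex I" "0 \<in> I"
begin

lemma closest_point_contraction: "\<bar>closest_point I s - closest_point I t\<bar> \<le> \<bar>s - t\<bar>"
  using closest_point_lipschitz[OF I(2,1), of s t] I(3) by (auto simp: dist_real_def)

lemma clamp_sq: "sq_integrable (\<lambda>x. closest_point I (rep f x))"
proof (rule sq_integrable_bound)
  show "integrable lebesgue (\<lambda>x. (norm (rep f x))\<^sup>2)" using rep_sq_integrable[of f] unfolding sq_integrable_def by blast
  have "continuous_on UNIV (closest_point I)" using I by (intro continuous_on_closest_point) auto
  then show "(\<lambda>x. closest_point I (rep f x)) \<in> borel_measurable lebesgue"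
    using measurable_compose[OF rep_measurable borel_measurable_continuous_onI] by blast
  show "(norm (closest_point I (rep f x)))\<^sup>2 \<le> (norm (rep f x))\<^sup>2" for x
    using closest_point_contraction[of "rep f x" 0] I(3) by (intro power_mono) (auto simp: closest_point_self)
qed

lemma rep_clamp: "AE x in lebesgue. rep (clamp_l2 I f) x = closest_point I (rep f x)"
  unfolding clamp_l2_def by (rule rep_cls[OF clamp_sq])

lemma clamp_values: "clamp_l2 I f \<in> values_in I"
  unfolding values_in_def mem_Collect_eq using rep_clamp[of f]
  by eventually_elim (use closest_point_in_set[OF I(1)] I(3) in auto)

lemma clamp_contraction: "norm (clamp_l2 I f - clamp_l2 I g) \<le> norm (f - g)"
proof (rule norm_le_if_pointwise)
  show "AE x in lebesgue. norm (rep (clamp_l2 I f - clamp_l2 I g) x) \<le> norm (rep (f - g) x)"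
    using rep_clamp[of f] rep_clamp[of g] rep_diff[of f g] rep_diff[of "clamp_l2 I f" "clamp_l2 I g"]
    by eventually_elim (simp add: closest_point_contraction)
qed

lemma clamp_fixes: "f \<in> values_in I \<longleftrightarrow> clamp_l2 I f = f"
proof
  assume f: "f \<in> values_in I"
  show "clamp_l2 I f = f"
    by (rule l2_eqI)
      (use rep_clamp[of f] f[unfolded values_in_def mem_Collect_eq] in \<open>eventually_elim, simp add: closest_point_self\<close>)
qed (use clamp_values[of f] in simp)

lemma clamp_in_half_graph:
  assumes "(u, w) \<in> half_graph D"
  shows "\<exists>z. (clamp_l2 I u, z) \<in> half_graph D \<and> norm z \<le> norm w"
proof -
  define w' where "w' = sqrt 2 *\<^sub>R w"
  have w': "weak_deriv D i u (coord i w')" if "i \<in> Basis" for i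
    using assms that by (simp add: w'_def half_graph_def grad_graph_def)
  have "\<exists>z. weak_deriv D i (clamp_l2 I u) z \<and> norm z \<le> norm (coord i w')" if i: "i \<in> Basis" for i
    unfolding clamp_l2_def
    by (rule weak_deriv_contraction[OF open_D i w'[OF i] closest_point_contraction clamp_sq]) blast
  then obtain z where z: "\<And>i. i \<in> Basis \<Longrightarrow> weak_deriv D i (clamp_l2 I u) (z i)"
    "\<And>i. i \<in> Basis \<Longrightarrow> norm (z i) \<le> norm (coord i w')" by metis
  obtain y where y: "\<And>i. i \<in> Basis \<Longrightarrow> coord i y = z i" by (rule l2_of_components[of z]) blast
  have c: "coord i (restr D y) = restr D (z i)" if "i \<in> Basis" for i
    using coord_restr[OF that D_sets(1)] y[OF that] by simp
  have "(clamp_l2 I u, restr D y) \<in> grad_graph D"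
    using z(1) by (simp add: grad_graph_def restr_disjoint c weak_deriv_restr)
  moreover have "norm (restr D y) \<le> norm w'"
  proof (rule power2_le_imp_le)
    show "(norm (restr D y))\<^sup>2 \<le> (norm w')\<^sup>2"
      unfolding power2_norm_eq_inner inner_eq_sum_coord[of w'] inner_eq_sum_coord[of "restr D y"]
    proof (rule sum_mono)
      fix i :: 'a assume i: "i \<in> Basis"
      have "norm (coord i (restr D y)) \<le> norm (coord i w')"
        using restr_norm[OF D_sets(1), of "z i"] z(2)[OF i] c[OF i] by simp
      then show "coord i (restr D y) \<bullet> coord i (restr D y) \<le> coord i w' \<bullet> coord i w'"
        by (simp add: dot_square_norm power_mono)
    qed
  qed simp
  ultimately show ?thesis
    by (intro exI[of _ "(1 / sqrt 2) *\<^sub>R restr D y"]) (simp add: half_graph_iff w'_def field_simps)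
qed

lemma T_values: assumes f: "f \<in> values_in I" and t: "t \<ge> 0" shows "T t f \<in> values_in I"
proof (rule T_invariant[OF _ _ _ _ f t])
  have "continuous_on UNIV (clamp_l2 I)"
    unfolding continuous_on_iff dist_norm using clamp_contraction by (meson le_less_trans)
  moreover have "values_in I = {f. clamp_l2 I f = f}" using clamp_fixes by blast
  ultimately show "closed (values_in I)" by (simp add: closed_Collect_eq continuous_on_id)
  show "convex (values_in I)"
    unfolding convex_alt values_in_def
  proof (intro ballI allI impI, unfold mem_Collect_eq)
    fix f g :: "('a, real) l2" and c :: real
    assume *: "AE x in lebesgue. rep f x \<in> I" "AE x in lebesgue. rep g x \<in> I" and c: "0 \<le> c \<and> c \<le> 1"
    show "AE x in lebesgue. rep ((1 - c) *\<^sub>R f + c *\<^sub>R g) x \<in> I"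
      using * rep_add[of "(1 - c) *\<^sub>R f" "c *\<^sub>R g"] rep_scale[of "1 - c" f] rep_scale[of c g]
      by eventually_elim (use I(2) c in \<open>auto simp: convex_alt\<close>)
  qed
  show "0 \<in> values_in I"
  proof -
    have "AE x in lebesgue. rep (0 :: ('a, real) l2) x = 0"
      using rep_cls[of "\<lambda>_ :: 'a. 0 :: real"] by (simp add: cls_zero sq_integrable_0)
    then show ?thesis
      unfolding values_in_def mem_Collect_eq by eventually_elim (simp add: I(3))
  qed
  fix a :: real and f assume a: "a > 0" and f: "f \<in> values_in I"
  show "J a f \<in> values_in I"
  proof (rule J_invariant[OF a f, where P="clamp_l2 I"])
    fix u w assume "(u, w) \<in> half_graph D"
    then show "clamp_l2 I u \<in> values_in I \<and> (\<exists>z. (clamp_l2 I u, z) \<in> half_graph D \<and> norm z \<le> norm w)"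
      using clamp_values clamp_in_half_graph by blast
  next
    fix u f assume "f \<in> values_in I"
    then show "norm (clamp_l2 I u - f) \<le> norm (u - f)"
      using clamp_contraction[of u f] by (simp add: clamp_fixes)
  qed
qed

end

end

section \<open>The form on functions on the domain\<close>

context open_domain
begin

definition ext :: "('a \<Rightarrow> real) \<Rightarrow> ('a, real) l2" where
  "ext f = cls (\<lambda>x. indicator D x *\<^sub>R f x)"

lemma D_space: "D \<inter> space lebesgue \<in> sets lebesgue"
  by simp

lemma L2_iff: "f \<in> L2 (lebesgue_on D) \<longleftrightarrow> sq_integrable (\<lambda>x. indicator D x *\<^sub>R f x)"
proof -
  have "f \<in> borel_measurable (lebesgue_on D) \<longleftrightarrow> (\<lambda>x. indicator D x *\<^sub>R f x) \<in> borel_measurable lebesgue"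
    by (rule borel_measurable_restrict_space_iff[OF D_space])
  moreover have "integrable (lebesgue_on D) (\<lambda>x. (f x)\<^sup>2) \<longleftrightarrow> integrable lebesgue (\<lambda>x. (norm (indicator D x *\<^sub>R f x))\<^sup>2)"
  proof -
    have "(\<lambda>x. (norm (indicator D x *\<^sub>R f x))\<^sup>2) = (\<lambda>x. indicator D x *\<^sub>R (f x)\<^sup>2)"
      by (auto simp: fun_eq_iff indicator_def)
    then show ?thesis by (simp add: integrable_restrict_space[OF D_space])
  qed
  ultimately show ?thesis unfolding L2_def sq_integrable_def by simp
qed

lemma L2_inner_ext:
  assumes "f \<in> L2 (lebesgue_on D)" "g \<in> L2 (lebesgue_on D)"
  shows "L2_inner (lebesgue_on D) f g = ext f \<bullet> ext g"
proof -
  have "L2_inner (lebesgue_on D) f g = (\<integral>x. indicator D x *\<^sub>R (f x * g x) \<partial>lebesgue)"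
    unfolding L2_inner_def by (rule integral_restrict_space[OF D_space])
  also have "\<dots> = (\<integral>x. (indicator D x *\<^sub>R f x) \<bullet> (indicator D x *\<^sub>R g x) \<partial>lebesgue)"
    by (rule Bochner_Integration.integral_cong) (auto simp: indicator_def)
  finally show ?thesis using cls_inner[OF assms[unfolded L2_iff]] by (simp add: ext_def)
qed

lemma L2_norm_ext: "f \<in> L2 (lebesgue_on D) \<Longrightarrow> L2_norm (lebesgue_on D) f = norm (ext f)"
  using L2_inner_ext[of f f] by (simp add: L2_norm_def L2_inner_def norm_eq_sqrt_inner power2_eq_square)

lemma AE_iff_ext:
  assumes "f \<in> L2 (lebesgue_on D)" "g \<in> L2 (lebesgue_on D)"
  shows "(AE x in lebesgue_on D. f x = g x) \<longleftrightarrow> ext f = ext g"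
proof -
  have "(AE x in lebesgue_on D. f x = g x) \<longleftrightarrow> (AE x in lebesgue. x \<in> D \<longrightarrow> f x = g x)"
    by (rule AE_restrict_space_iff[OF D_space])
  also have "\<dots> \<longleftrightarrow> (AE x in lebesgue. indicator D x *\<^sub>R f x = indicator D x *\<^sub>R g x)"
    by (intro AE_cong) (auto simp: indicator_def)
  also have "\<dots> \<longleftrightarrow> ext f = ext g"
    unfolding ext_def using assms[unfolded L2_iff] by (rule cls_eq_iff[symmetric])
  finally show ?thesis .
qed

lemma rep_L2: "rep f \<in> L2 (lebesgue_on D)"
  unfolding L2_iff by (rule sq_integrable_indicator) auto

lemma ext_rep: "ext (rep f) = restr D f"
  unfolding ext_def restr_def ..

lemma restr_ext: "f \<in> L2 (lebesgue_on D) \<Longrightarrow> restr D (ext f) = ext f"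
  and restr_compl_ext: "f \<in> L2 (lebesgue_on D) \<Longrightarrow> restr (- D) (ext f) = 0"
proof -
  assume f: "f \<in> L2 (lebesgue_on D)"
  have "(\<lambda>x. indicator D x *\<^sub>R indicator D x *\<^sub>R f x) = (\<lambda>x. indicator D x *\<^sub>R f x)"
    by (auto simp: fun_eq_iff indicator_def)
  then show 1: "restr D (ext f) = ext f"
    using restr_cls[OF D_sets(1) f[unfolded L2_iff]] by (simp add: ext_def)
  show "restr (- D) (ext f) = 0" using restr_disjoint[OF D_sets(2,1), of "ext f"] by (simp add: 1)
qed

lemma ext_rep_supported: "restr (- D) f = 0 \<Longrightarrow> ext (rep f) = f"
  using restr_complement[OF D_sets(1), of f] by (simp add: ext_rep)

lemma L2_lincomb:
  assumes f: "f \<in> L2 (lebesgue_on D)" and g: "g \<in> L2 (lebesgue_on D)"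
  shows "(\<lambda>x. a * f x + b * g x) \<in> L2 (lebesgue_on D)" (is "?h \<in> _")
    and "ext (\<lambda>x. a * f x + b * g x) = a *\<^sub>R ext f + b *\<^sub>R ext g"
proof -
  let ?f = "\<lambda>x. indicator D x *\<^sub>R f x" and ?g = "\<lambda>x. indicator D x *\<^sub>R g x"
  have eq: "(\<lambda>x. indicator D x *\<^sub>R ?h x) = (\<lambda>x. a *\<^sub>R ?f x + b *\<^sub>R ?g x)"
    by (auto simp: fun_eq_iff algebra_simps)
  have sq: "sq_integrable (\<lambda>x. a *\<^sub>R ?f x)" "sq_integrable (\<lambda>x. b *\<^sub>R ?g x)"
    by (rule sq_integrable_scale[OF f[unfolded L2_iff]], rule sq_integrable_scale[OF g[unfolded L2_iff]])
  show "?h \<in> L2 (lebesgue_on D)" unfolding L2_iff eq by (rule sq_integrable_add[OF sq])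
  have "ext ?h = cls (\<lambda>x. a *\<^sub>R ?f x) + cls (\<lambda>x. b *\<^sub>R ?g x)"
    unfolding ext_def eq by (rule cls_add[OF sq, symmetric])
  also have "\<dots> = a *\<^sub>R ext f + b *\<^sub>R ext g"
    unfolding ext_def using cls_scale[OF f[unfolded L2_iff], of a] cls_scale[OF g[unfolded L2_iff], of b] by simp
  finally show "ext ?h = a *\<^sub>R ext f + b *\<^sub>R ext g" .
qed

lemma L2_diff:
  assumes "f \<in> L2 (lebesgue_on D)" "g \<in> L2 (lebesgue_on D)"
  shows "(\<lambda>x. f x - g x) \<in> L2 (lebesgue_on D)" "ext (\<lambda>x. f x - g x) = ext f - ext g"
  using L2_lincomb[OF assms, of 1 "-1"] by simp_all

lemma L2_0: "(\<lambda>_. 0) \<in> L2 (lebesgue_on D)" "ext (\<lambda>_. 0) = 0"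
  unfolding L2_iff ext_def by (simp_all add: sq_integrable_0 cls_zero)

lemma L2_sum:
  assumes "finite A" "\<And>a. a \<in> A \<Longrightarrow> f a \<in> L2 (lebesgue_on D)"
  shows "(\<lambda>x. \<Sum>a\<in>A. c a * f a x) \<in> L2 (lebesgue_on D) \<and> ext (\<lambda>x. \<Sum>a\<in>A. c a * f a x) = (\<Sum>a\<in>A. c a *\<^sub>R ext (f a))"
  using assms
proof (induction A rule: finite_induct)
  case (insert b A)
  then show ?case
    using L2_lincomb[of "f b" "\<lambda>x. \<Sum>a\<in>A. c a * f a x" "c b" 1] by simp
qed (simp add: L2_0)

lemma has_weak_pderiv_iff:
  assumes u: "u \<in> L2 (lebesgue_on D)" and g: "g \<in> L2 (lebesgue_on D)" and i: "i \<in> Basis"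
  shows "has_weak_pderiv D u i g \<longleftrightarrow> weak_deriv D i (ext u) (ext g)"
proof -
  have "(\<integral>x. u x * frechet_derivative \<phi> (at x) i \<partial>lebesgue_on D) = ext u \<bullet> cls (\<lambda>x. frechet_derivative \<phi> (at x) i)"
    "(\<integral>x. g x * \<phi> x \<partial>lebesgue_on D) = ext g \<bullet> cls \<phi>" if \<phi>: "\<phi> \<in> test_fun D" for \<phi>
  proof -
    have "(\<integral>x. u x * frechet_derivative \<phi> (at x) i \<partial>lebesgue_on D) =
        (\<integral>x. (indicator D x *\<^sub>R u x) \<bullet> frechet_derivative \<phi> (at x) i \<partial>lebesgue)"
      unfolding integral_restrict_space[OF D_space] by (simp add: mult.assoc)
    then show "(\<integral>x. u x * frechet_derivative \<phi> (at x) i \<partial>lebesgue_on D) = ext u \<bullet> cls (\<lambda>x. frechet_derivative \<phi> (at x) i)"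
      unfolding ext_def using cls_inner[OF u[unfolded L2_iff] test_fun_pderiv_sq_integrable(1)[OF \<phi> i]] by simp
    have "(\<integral>x. g x * \<phi> x \<partial>lebesgue_on D) = (\<integral>x. (indicator D x *\<^sub>R g x) \<bullet> \<phi> x \<partial>lebesgue)"
      unfolding integral_restrict_space[OF D_space] by (simp add: mult.assoc)
    then show "(\<integral>x. g x * \<phi> x \<partial>lebesgue_on D) = ext g \<bullet> cls \<phi>"
      unfolding ext_def using cls_inner[OF g[unfolded L2_iff] test_fun_sq_integrable(1)[OF \<phi>]] by simp
  qed
  then show ?thesis unfolding has_weak_pderiv_def weak_deriv_def by simp
qed

lemma L2_imp_L2_loc: assumes "u \<in> L2 (lebesgue_on D)" shows "u \<in> L2_loc D"
  unfolding L2_loc_def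
proof (intro CollectI conjI allI impI)
  show "u \<in> borel_measurable (lebesgue_on D)" using assms by (simp add: L2_def)
  fix K assume K: "compact K \<and> K \<subseteq> D"
  then have "K \<in> sets lebesgue" using lmeasurable_compact by blast
  then have Ks: "K \<inter> space lebesgue \<in> sets lebesgue" by simp
  have "integrable lebesgue (\<lambda>x. indicator D x *\<^sub>R (u x)\<^sup>2)"
    using assms by (simp add: L2_def integrable_restrict_space[OF D_space])
  from integrable_mult_indicator[OF \<open>K \<in> sets lebesgue\<close> this]
  have "integrable lebesgue (\<lambda>x. indicator K x *\<^sub>R (u x)\<^sup>2)"
    by (rule Bochner_Integration.integrable_cong[THEN iffD1, rotated -1]) (use K in \<open>auto simp: indicator_def\<close>)
  then show "integrable (lebesgue_on K) (\<lambda>x. (u x)\<^sup>2)" by (simp add: integrable_restrict_space[OF Ks])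
qed

lemma W12_iff: "u \<in> W12 D \<longleftrightarrow> u \<in> L2 (lebesgue_on D) \<and> (\<exists>w. (ext u, w) \<in> grad_graph D)"
proof (intro iffI conjI)
  assume u: "u \<in> W12 D"
  then show u2: "u \<in> L2 (lebesgue_on D)" by (simp add: W12_def)
  obtain g where g: "\<And>i. i \<in> Basis \<Longrightarrow> g i \<in> L2 (lebesgue_on D)" "\<And>i. i \<in> Basis \<Longrightarrow> has_weak_pderiv D u i (g i)"
  proof -
    have "\<forall>i\<in>Basis. \<exists>g. g \<in> L2 (lebesgue_on D) \<and> has_weak_pderiv D u i g"
      using u unfolding W12_def BL_def by blast
    from bchoice[OF this] show ?thesis using that by blast
  qed
  obtain w where w: "\<And>i. i \<in> Basis \<Longrightarrow> coord i w = ext (g i)" by (rule l2_of_components[of "\<lambda>i. ext (g i)"]) blast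
  have "(ext u, restr D w) \<in> grad_graph D"
    using g w has_weak_pderiv_iff[OF u2]
    by (simp add: grad_graph_def restr_disjoint coord_restr weak_deriv_restr)
  then show "\<exists>w. (ext u, w) \<in> grad_graph D" by blast
next
  assume u: "u \<in> L2 (lebesgue_on D) \<and> (\<exists>w. (ext u, w) \<in> grad_graph D)"
  then obtain w where w: "(ext u, w) \<in> grad_graph D" by blast
  have "\<exists>g\<in>L2 (lebesgue_on D). has_weak_pderiv D u i g" if i: "i \<in> Basis" for i
    by (rule bexI[of _ "rep (coord i w)"])
      (use w i u in \<open>auto simp: rep_L2 has_weak_pderiv_iff ext_rep weak_deriv_restr grad_graph_def\<close>)
  then show "u \<in> W12 D" using u L2_imp_L2_loc by (simp add: W12_def BL_def)
qed

text \<open>Weak derivatives are unique almost everywhere in \<open>D\<close>, so the ones chosen in the definition of the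
  Dirichlet integral are the coordinates of \<open>w\<close> and \<open>z\<close>.\<close>

lemma Dirichlet_int_eq:
  assumes u: "u \<in> L2 (lebesgue_on D)" "(ext u, w) \<in> grad_graph D"
    and v: "v \<in> L2 (lebesgue_on D)" "(ext v, z) \<in> grad_graph D"
  shows "Dirichlet_int D u v = w \<bullet> z"
proof -
  have wp: "weak_pderiv D u i \<in> L2 (lebesgue_on D) \<and> ext (weak_pderiv D u i) = coord i w"
    if u: "u \<in> L2 (lebesgue_on D)" "(ext u, w) \<in> grad_graph D" and i: "i \<in> Basis" for u w i
  proof -
    have "\<exists>g. g \<in> L2 (lebesgue_on D) \<and> has_weak_pderiv D u i g"
      using u W12_iff[of u] i unfolding W12_def BL_def by blast
    from someI_ex[OF this]
    have g: "weak_pderiv D u i \<in> L2 (lebesgue_on D)" "has_weak_pderiv D u i (weak_pderiv D u i)"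
      unfolding weak_pderiv_def by blast+
    have "weak_deriv D i (ext u) (ext (weak_pderiv D u i))" using g has_weak_pderiv_iff[OF u(1) g(1) i] by blast
    moreover have "weak_deriv D i (ext u) (coord i w)" using u(2) i by (simp add: grad_graph_def)
    ultimately have "restr D (ext (weak_pderiv D u i)) = restr D (coord i w)" by (rule weak_deriv_unique[OF open_D])
    moreover have "restr D (coord i w) = coord i w"
      using u(2) restr_complement[OF D_sets(1), of w] by (simp add: grad_graph_def coord_restr[OF i, symmetric])
    ultimately show ?thesis using g(1) by (simp add: restr_ext)
  qed
  have "Dirichlet_int D u v = (\<Sum>i\<in>Basis. \<integral>x. weak_pderiv D u i x * weak_pderiv D v i x \<partial>lebesgue_on D)"
    unfolding Dirichlet_int_def
  proof (rule Bochner_Integration.integral_sum)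
    fix i :: 'a assume i: "i \<in> Basis"
    let ?f = "weak_pderiv D u i" and ?g = "weak_pderiv D v i"
    have "integrable lebesgue (\<lambda>x. (indicator D x *\<^sub>R ?f x) \<bullet> (indicator D x *\<^sub>R ?g x))"
      using wp[OF u i] wp[OF v i] unfolding L2_iff by (intro sq_integrable_inner) auto
    moreover have "(\<lambda>x. (indicator D x *\<^sub>R ?f x) \<bullet> (indicator D x *\<^sub>R ?g x)) = (\<lambda>x. indicator D x *\<^sub>R (?f x * ?g x))"
      by (auto simp: fun_eq_iff indicator_def)
    ultimately show "integrable (lebesgue_on D) (\<lambda>x. ?f x * ?g x)"
      by (simp add: integrable_restrict_space[OF D_space])
  qed
  also have "\<dots> = (\<Sum>i\<in>Basis. coord i w \<bullet> coord i z)"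
    by (rule sum.cong) (use wp[OF u] wp[OF v] L2_inner_ext in \<open>auto simp: L2_inner_def\<close>)
  finally show ?thesis by (simp add: inner_eq_sum_coord)
qed

text \<open>The semigroup on functions on \<open>D\<close>. A representative is chosen after evolving the extension by 0.\<close>

definition TD :: "real \<Rightarrow> ('a \<Rightarrow> real) \<Rightarrow> 'a \<Rightarrow> real" where
  "TD t f = rep (T t (ext f))"

lemma TD_L2: "TD t f \<in> L2 (lebesgue_on D)"
  unfolding TD_def by (rule rep_L2)

lemma ext_TD: "f \<in> L2 (lebesgue_on D) \<Longrightarrow> t \<ge> 0 \<Longrightarrow> ext (TD t f) = T t (ext f)"
  unfolding TD_def by (intro ext_rep_supported T_supported restr_compl_ext)

lemma L2_semigroup_TD: "L2_semigroup (lebesgue_on D) TD"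
  unfolding L2_semigroup_def
proof (intro conjI allI ballI impI)
  fix t :: real and f assume *: "0 \<le> t" "f \<in> L2 (lebesgue_on D)"
  show "TD t f \<in> L2 (lebesgue_on D)" by (rule TD_L2)
  show "L2_norm (lebesgue_on D) (TD t f) \<le> L2_norm (lebesgue_on D) f"
    using * by (simp add: L2_norm_ext TD_L2 ext_TD T_contraction)
next
  fix t a b :: real and f g assume *: "0 \<le> t" "f \<in> L2 (lebesgue_on D)" "g \<in> L2 (lebesgue_on D)"
  show "AE x in lebesgue_on D. TD t (\<lambda>y. a * f y + b * g y) x = a * TD t f x + b * TD t g x"
    by (subst AE_iff_ext) (simp_all add: TD_L2 L2_lincomb * ext_TD T_add T_scale)
next
  fix t :: real and f g assume *: "0 \<le> t" "f \<in> L2 (lebesgue_on D)" "g \<in> L2 (lebesgue_on D)"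
  show "L2_inner (lebesgue_on D) (TD t f) g = L2_inner (lebesgue_on D) f (TD t g)"
    by (simp add: L2_inner_ext TD_L2 ext_TD * T_sym)
next
  fix f assume f: "f \<in> L2 (lebesgue_on D)"
  show "AE x in lebesgue_on D. TD 0 f x = f x"
    by (subst AE_iff_ext) (simp_all add: TD_L2 f ext_TD T_0)
next
  fix s t :: real and f assume *: "0 \<le> s" "0 \<le> t" "f \<in> L2 (lebesgue_on D)"
  show "AE x in lebesgue_on D. TD (s + t) f x = TD s (TD t f) x"
    by (subst AE_iff_ext) (simp_all add: TD_L2 * ext_TD T_semigroup)
next
  fix f assume f: "f \<in> L2 (lebesgue_on D)"
  have "((\<lambda>t. norm (T t (ext f) - ext f)) \<longlongrightarrow> 0) (at_right 0)"
    using tendsto_norm_zero[OF LIM_zero[OF T_strongly_continuous[of "ext f"]]] .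
  then show "((\<lambda>t. L2_norm (lebesgue_on D) (\<lambda>x. TD t f x - f x)) \<longlongrightarrow> 0) (at_right 0)"
  proof (rule Lim_transform_eventually)
    show "\<forall>\<^sub>F t in at_right 0. norm (T t (ext f) - ext f) = L2_norm (lebesgue_on D) (\<lambda>x. TD t f x - f x)"
      unfolding eventually_at_right_field
      by (intro exI[of _ 1]) (simp add: L2_norm_ext L2_diff TD_L2 f ext_TD)
  qed
qed

lemma generator_TD:
  assumes u: "u \<in> L2 (lebesgue_on D)" and w: "w \<in> L2 (lebesgue_on D)"
  shows "((\<lambda>t. L2_norm (lebesgue_on D) (\<lambda>x. (TD t u x - u x) / t - w x)) \<longlongrightarrow> 0) (at_right 0) \<longleftrightarrow>
    L_rel (ext u) (- ext w)"
proof -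
  have ev: "\<forall>\<^sub>F t in at_right 0. L2_norm (lebesgue_on D) (\<lambda>x. (TD t u x - u x) / t - w x) =
      norm ((1 / t) *\<^sub>R (T t (ext u) - ext u) - ext w)"
    unfolding eventually_at_right_field
  proof (intro exI[of _ 1] conjI allI impI)
    fix t :: real assume t: "0 < t" "t < 1"
    have 1: "(\<lambda>x. TD t u x - u x) \<in> L2 (lebesgue_on D)" "ext (\<lambda>x. TD t u x - u x) = T t (ext u) - ext u"
      using t by (simp_all add: L2_diff TD_L2 u ext_TD)
    have "(\<lambda>x. (TD t u x - u x) / t - w x) = (\<lambda>x. (1 / t) * (TD t u x - u x) + (-1) * w x)"
      by (simp add: fun_eq_iff)
    then show "L2_norm (lebesgue_on D) (\<lambda>x. (TD t u x - u x) / t - w x) =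
        norm ((1 / t) *\<^sub>R (T t (ext u) - ext u) - ext w)"
      using L2_lincomb[OF 1(1) w, of "1 / t" "-1"] 1(2) by (simp add: L2_norm_ext)
  qed simp
  have "((\<lambda>t. L2_norm (lebesgue_on D) (\<lambda>x. (TD t u x - u x) / t - w x)) \<longlongrightarrow> 0) (at_right 0) \<longleftrightarrow>
      ((\<lambda>t. norm ((1 / t) *\<^sub>R (T t (ext u) - ext u) - ext w)) \<longlongrightarrow> 0) (at_right 0)"
    by (rule tendsto_cong[OF ev])
  also have "\<dots> \<longleftrightarrow> ((\<lambda>t. (1 / t) *\<^sub>R (T t (ext u) - ext u)) \<longlongrightarrow> ext w) (at_right 0)"
    by (simp add: tendsto_norm_zero_iff LIM_zero_iff)
  also have "\<dots> \<longleftrightarrow> L_rel (ext u) (- ext w)"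
    using L_rel_if_generator[of "ext u" "ext w"] generator_if_L_rel[of "ext u" "- ext w"] by auto
  finally show ?thesis .
qed

text \<open>The difference between the two sides is that the form on the whole space is tested with functions
  that need not vanish outside \<open>D\<close>; replacing such a function by its restriction to \<open>D\<close> changes
  neither its gradient nor its pairing with \<open>w\<close>.\<close>

lemma L_rel_iff_form:
  assumes u: "u \<in> L2 (lebesgue_on D)" and w: "w \<in> L2 (lebesgue_on D)"
  shows "L_rel (ext u) (- ext w) \<longleftrightarrow>
    u \<in> W12 D \<and> (\<forall>v\<in>W12 D. 1 / 2 * Dirichlet_int D u v = - L2_inner (lebesgue_on D) w v)"
proof
  assume "L_rel (ext u) (- ext w)"
  then obtain z where z: "(ext u, z) \<in> half_graph D" "\<And>v y. (v, y) \<in> half_graph D \<Longrightarrow> z \<bullet> y = - ext w \<bullet> v"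
    by (rule L_relE) blast
  have uz: "(ext u, sqrt 2 *\<^sub>R z) \<in> grad_graph D" using z(1) by (simp add: half_graph_def)
  have "1 / 2 * Dirichlet_int D u v = - L2_inner (lebesgue_on D) w v" if vW: "v \<in> W12 D" for v
  proof -
    obtain y where v: "v \<in> L2 (lebesgue_on D)" "(ext v, y) \<in> grad_graph D" using vW W12_iff[of v] by blast
    have "z \<bullet> ((1 / sqrt 2) *\<^sub>R y) = - ext w \<bullet> ext v" by (rule z(2)) (use v half_graph_iff[of "ext v" y] in blast)
    moreover have "1 / 2 * (sqrt 2 * (z \<bullet> y)) = (1 / sqrt 2) * (z \<bullet> y)"
      by (simp add: field_simps)
    ultimately show ?thesis
      unfolding Dirichlet_int_eq[OF u uz v] L2_inner_ext[OF w v(1)] by simp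
  qed
  moreover have "u \<in> W12 D" using u uz W12_iff[of u] by blast
  ultimately show "u \<in> W12 D \<and> (\<forall>v\<in>W12 D. 1 / 2 * Dirichlet_int D u v = - L2_inner (lebesgue_on D) w v)" by blast
next
  assume R: "u \<in> W12 D \<and> (\<forall>v\<in>W12 D. 1 / 2 * Dirichlet_int D u v = - L2_inner (lebesgue_on D) w v)"
  then obtain z where z: "(ext u, z) \<in> grad_graph D" using W12_iff[of u] by blast
  show "L_rel (ext u) (- ext w)"
  proof (rule L_relI)
    show "(ext u, (1 / sqrt 2) *\<^sub>R z) \<in> half_graph D" using z half_graph_iff[of "ext u" z] by blast
    fix v y assume "(v, y) \<in> half_graph D"
    then have "(restr D v, sqrt 2 *\<^sub>R y) \<in> grad_graph D"
      using restr_in_grad_graph by (simp add: half_graph_def)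
    then have v: "(ext (rep v), sqrt 2 *\<^sub>R y) \<in> grad_graph D" by (simp add: ext_rep)
    then have "rep v \<in> W12 D" using rep_L2[of v] W12_iff[of "rep v"] by blast
    then have "1 / 2 * Dirichlet_int D u (rep v) = - L2_inner (lebesgue_on D) w (rep v)" using R by blast
    then have "1 / 2 * (sqrt 2 * (z \<bullet> y)) = - (ext w \<bullet> restr D v)"
      unfolding Dirichlet_int_eq[OF u z rep_L2 v] L2_inner_ext[OF w rep_L2] by (simp add: ext_rep)
    also have "ext w \<bullet> restr D v = ext w \<bullet> v"
      using restr_sym[OF D_sets(1), of "ext w" v] restr_ext[OF w] by simp
    finally have "1 / 2 * (sqrt 2 * (z \<bullet> y)) = - (ext w \<bullet> v)" .
    moreover have "1 / 2 * (sqrt 2 * (z \<bullet> y)) = (1 / sqrt 2) * (z \<bullet> y)"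
      by (simp add: field_simps)
    ultimately show "(1 / sqrt 2) *\<^sub>R z \<bullet> y = - ext w \<bullet> v" by simp
  qed
qed

lemma semigroup_of_form_TD:
  "semigroup_of_form (lebesgue_on D) (\<lambda>u v. 1 / 2 * Dirichlet_int D u v) (W12 D) TD"
  unfolding semigroup_of_form_def
proof (intro conjI L2_semigroup_TD set_eqI)
  fix p :: "('a \<Rightarrow> real) \<times> ('a \<Rightarrow> real)"
  obtain u w where p: "p = (u, w)" by force
  have "W12 D \<subseteq> L2 (lebesgue_on D)" by (auto simp: W12_def)
  then show "p \<in> generator_graph (lebesgue_on D) TD \<longleftrightarrow> p \<in> {(u, w). u \<in> W12 D \<and> w \<in> L2 (lebesgue_on D) \<and>
      (\<forall>v\<in>W12 D. 1 / 2 * Dirichlet_int D u v = - L2_inner (lebesgue_on D) w v)}"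
    using generator_TD[of u w] L_rel_iff_form[of u w] unfolding p generator_graph_def by auto
qed

lemma semigroup_integral_L2_TD:
  assumes f: "f \<in> L2 (lebesgue_on D)" and N: "N \<ge> 0"
  shows "semigroup_integral_L2 (lebesgue_on D) TD N f (rep (S N (ext f)))"
  unfolding semigroup_integral_L2_def
proof (intro conjI allI impI rep_L2)
  fix e :: real assume e: "e > 0"
  obtain d where d: "d > 0" "\<And>p. p tagged_division_of {0..N} \<Longrightarrow> (\<lambda>s. ball s d) fine p \<Longrightarrow>
    norm ((\<Sum>(s, K)\<in>p. measure lborel K *\<^sub>R T s (ext f)) - S N (ext f)) < e"
    by (rule Riemann_sums_S[OF N e]) blast
  have "L2_norm (lebesgue_on D) (\<lambda>x. (\<Sum>(s, K)\<in>p. measure lborel K * TD s f x) - rep (S N (ext f)) x) < e"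
    if p: "p tagged_division_of {0..N}" "(\<lambda>s. ball s d) fine p" for p
  proof -
    have s0: "s \<ge> 0" if "(s, K) \<in> p" for s K using tagged_division_ofD(2,3)[OF p(1) that] by auto
    have sum: "(\<lambda>x. \<Sum>(s, K)\<in>p. measure lborel K * TD s f x) \<in> L2 (lebesgue_on D)"
      "ext (\<lambda>x. \<Sum>(s, K)\<in>p. measure lborel K * TD s f x) = (\<Sum>(s, K)\<in>p. measure lborel K *\<^sub>R ext (TD s f))"
      using L2_sum[OF tagged_division_ofD(1)[OF p(1)], of "\<lambda>q. TD (fst q) f" "\<lambda>q. measure lborel (snd q)"] TD_L2
      by (simp_all add: case_prod_beta)
    have "(\<Sum>(s, K)\<in>p. measure lborel K *\<^sub>R ext (TD s f)) = (\<Sum>(s, K)\<in>p. measure lborel K *\<^sub>R T s (ext f))"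
      by (rule sum.cong) (auto simp: ext_TD f s0)
    then show ?thesis
      using d(2)[of p] p L2_diff[OF sum(1) rep_L2[of "S N (ext f)"]]
      by (simp add: L2_norm_ext sum(2) ext_rep_supported S_supported restr_compl_ext f N)
  qed
  then show "\<exists>d>0. \<forall>p. p tagged_division_of {0..N} \<and> (\<lambda>s. ball s d) fine p \<longrightarrow>
      L2_norm (lebesgue_on D) (\<lambda>x. (\<Sum>(s, K)\<in>p. measure lborel K * TD s f x) - rep (S N (ext f)) x) < e"
    using d(1) by blast
qed

end

section \<open>Averages of a function and its gradient\<close>

definition bump :: "'a::euclidean_space \<Rightarrow> real \<Rightarrow> 'a \<Rightarrow> real" where
  "bump z r x = flat 0 (1 - (norm (x - z))\<^sup>2 / r\<^sup>2)"

text \<open>The kernel is not normalized to have integral 1, but its integral does not depend on \<open>z\<close> and \<open>r\<close>. This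
  is what makes differences of two such kernels divergences.\<close>

definition avg_kernel :: "'a::euclidean_space \<Rightarrow> real \<Rightarrow> 'a \<Rightarrow> real" where
  "avg_kernel z r x = bump z r x / r ^ DIM('a)"

lemma tame_norm_sq: "tame (\<lambda>x::'a::euclidean_space. (norm (x - z))\<^sup>2)"
proof -
  have "tame (\<lambda>x. \<Sum>i\<in>Basis. (- (z \<bullet> i) + 1 * (x \<bullet> i)) * (- (z \<bullet> i) + 1 * (x \<bullet> i)))"
    by (intro tame_sum tame_mult tame_affine) simp
  moreover have "(norm (x - z))\<^sup>2 = (\<Sum>i\<in>Basis. (- (z \<bullet> i) + 1 * (x \<bullet> i)) * (- (z \<bullet> i) + 1 * (x \<bullet> i)))" for x
    unfolding power2_norm_eq_inner euclidean_inner[of "x - z" "x - z"] by (simp add: inner_diff_left)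
  ultimately show ?thesis by simp
qed

lemma tame_bump: "tame (bump z r)"
proof -
  have "tame (\<lambda>x. flat 0 (1 + (- 1 / r\<^sup>2) * (norm (x - z))\<^sup>2))"
    by (intro tame.intros tame_norm_sq)
  then show ?thesis unfolding bump_def[abs_def] by simp
qed

lemma flat_ball_zero: "r > 0 \<Longrightarrow> x \<notin> ball z r \<Longrightarrow> flat k (1 - (norm (x - z))\<^sup>2 / r\<^sup>2) = 0"
proof -
  assume r: "r > 0" and "x \<notin> ball z r"
  then have "r \<le> norm (x - z)" by (simp add: dist_norm norm_minus_commute)
  then have "r\<^sup>2 \<le> (norm (x - z))\<^sup>2" using r by (intro power_mono) auto
  then have "1 \<le> (norm (x - z))\<^sup>2 / r\<^sup>2" using r by simp
  then show ?thesis unfolding flat_def by simp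
qed

lemma bump_zero: "r > 0 \<Longrightarrow> x \<notin> ball z r \<Longrightarrow> bump z r x = 0"
  unfolding bump_def by (rule flat_ball_zero)

lemma bump_nonneg: "0 \<le> bump z r x" by (simp add: bump_def flat_nonneg)

lemma bump_le_1: "bump z r x \<le> 1" by (simp add: bump_def flat_0_le_1)

lemma bump_pos:
  assumes "x \<in> ball z r" shows "0 < bump z r x"
proof -
  have "norm (x - z) < r" using assms by (simp add: dist_norm norm_minus_commute)
  moreover have "r > 0" using assms by (metis ball_eq_empty empty_iff not_le)
  ultimately have "(norm (x - z))\<^sup>2 < r\<^sup>2" by (intro power_strict_mono) auto
  then show ?thesis using \<open>r > 0\<close> unfolding bump_def by (intro flat_0_pos) simp
qed

lemma avg_kernel_bounds:
  assumes r: "r > 0"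
  shows "0 \<le> avg_kernel z r x" "\<bar>avg_kernel z r x\<bar> \<le> (1 / r ^ DIM('a)) * indicator (cball z r) (x::'a::euclidean_space)"
proof -
  show "0 \<le> avg_kernel z r x" using r bump_nonneg[of z r x] by (simp add: avg_kernel_def)
  then show "\<bar>avg_kernel z r x\<bar> \<le> (1 / r ^ DIM('a)) * indicator (cball z r) x"
    using bump_zero[OF r, of x z] bump_le_1[of z r x] r ball_subset_cball[of z r]
    by (cases "x \<in> cball z r") (auto simp: avg_kernel_def bump_nonneg abs_of_nonneg divide_right_mono)
qed

lemma tame_avg_kernel: "tame (avg_kernel z r :: 'a::euclidean_space \<Rightarrow> real)"
proof -
  have "tame (\<lambda>x::'a. (1 / r ^ DIM('a)) * bump z r x)" by (intro tame_mult tame_const tame_bump)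
  then show ?thesis unfolding avg_kernel_def[abs_def] by simp
qed

lemma avg_kernel_sq_integrable: "r > 0 \<Longrightarrow> sq_integrable (avg_kernel z r)"
  by (rule sq_integrable_bounded_support[where K="cball z r"])
    (auto intro!: continuous_lebesgue_measurable tame_continuous tame_avg_kernel order_trans[OF avg_kernel_bounds(2)])

lemma norm_cls_le_support:
  fixes f :: "'a::euclidean_space \<Rightarrow> 'b::euclidean_space"
  assumes f: "f \<in> borel_measurable lebesgue" "\<And>x. norm (f x) \<le> B * indicator (cball z r) x"
    and B: "0 \<le> B" and r: "0 < r"
  shows "sq_integrable f" "norm (cls f) \<le> B * sqrt (unit_ball_vol (DIM('a)) * r ^ DIM('a))"
proof -
  show sq: "sq_integrable f" by (rule sq_integrable_bounded_support[OF f]) simp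
  have "(norm (cls f))\<^sup>2 = (\<integral>x. (norm (f x))\<^sup>2 \<partial>lebesgue)" by (rule l2_norm_cls[OF sq])
  also have "\<dots> \<le> (\<integral>x. B\<^sup>2 * indicator (cball z r) x \<partial>lebesgue)"
  proof (rule integral_mono)
    show "integrable lebesgue (\<lambda>x. (norm (f x))\<^sup>2)" using sq by (simp add: sq_integrable_def)
    show "integrable lebesgue (\<lambda>x. B\<^sup>2 * indicator (cball z r) x :: real)"
      by (intro integrable_mult_right integrable_indicator_lmeasurable) simp
    show "(norm (f x))\<^sup>2 \<le> B\<^sup>2 * indicator (cball z r) x" for x
      using power_mono[OF f(2)[of x], of 2] by (auto simp: indicator_def split: if_splits)
  qed
  also have "\<dots> = B\<^sup>2 * measure lebesgue (cball z r)" by simp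
  also have "\<dots> = (B * sqrt (unit_ball_vol (DIM('a)) * r ^ DIM('a)))\<^sup>2"
    using r by (simp add: content_cball power_mult_distrib)
  finally show "norm (cls f) \<le> B * sqrt (unit_ball_vol (DIM('a)) * r ^ DIM('a))"
    by (rule power2_le_imp_le) (use B r in simp)
qed

definition ball_const :: "'a::euclidean_space itself \<Rightarrow> real" where
  "ball_const _ = sqrt (unit_ball_vol (real (DIM('a))))"

lemma ball_const_nonneg: "0 \<le> ball_const TYPE('a::euclidean_space)"
  by (simp add: ball_const_def)

lemma norm_avg_kernel:
  fixes z :: "'a::euclidean_space"
  assumes "r > 0"
  shows "norm (cls (avg_kernel z r)) \<le> ball_const TYPE('a::euclidean_space) / sqrt (r ^ DIM('a))"
proof -
  have "norm (cls (avg_kernel (z::'a) r)) \<le> 1 / r ^ DIM('a) * sqrt (unit_ball_vol (DIM('a)) * r ^ DIM('a))"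
  proof (rule norm_cls_le_support(2)[OF continuous_lebesgue_measurable[OF tame_continuous[OF tame_avg_kernel]] _ _ assms])
    show "norm (avg_kernel z r x) \<le> 1 / r ^ DIM('a) * indicat_real (cball z r) x" for x
      unfolding real_norm_def by (rule avg_kernel_bounds(2)[OF assms])
  qed (use assms in simp)
  also have "\<dots> = ball_const TYPE('a) / sqrt (r ^ DIM('a))"
    using assms by (simp add: ball_const_def real_sqrt_mult real_div_sqrt field_simps)
  finally show ?thesis .
qed

text \<open>If the centre moves with velocity \<open>p\<close> and the radius grows with speed \<open>q\<close>, the point \<open>x\<close> of the ball moves
  with velocity \<open>p + (q / r) (x - z)\<close>. The kernel is transported by this flow, so its time derivative is
  minus the divergence of the kernel times the velocity field.\<close>

definition field_kernel :: "'a::euclidean_space \<Rightarrow> real \<Rightarrow> 'a \<Rightarrow> real \<Rightarrow> 'a \<Rightarrow> 'a" where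
  "field_kernel z r p q x = avg_kernel z r x *\<^sub>R (p + (q / r) *\<^sub>R (x - z))"

text \<open>The derivative at \<open>s = 0\<close> of the kernel with centre \<open>z + s p\<close> and radius \<open>r + s q\<close>.\<close>

definition kernel_derivative :: "'a::euclidean_space \<Rightarrow> real \<Rightarrow> 'a \<Rightarrow> real \<Rightarrow> 'a \<Rightarrow> real" where
  "kernel_derivative z r p q x =
    (flat 2 (1 - (norm (x - z))\<^sup>2 / r\<^sup>2) * (2 * ((x - z) \<bullet> p) / r\<^sup>2 + 2 * (norm (x - z))\<^sup>2 * q / r ^ 3)
      - real (DIM('a)) * q / r * bump z r x) / r ^ DIM('a)"

lemma bump_has_derivative:
  "(bump z r has_derivative (\<lambda>h. flat 2 (1 - (norm (x - z))\<^sup>2 / r\<^sup>2) * (- 2 * ((x - z) \<bullet> h) / r\<^sup>2))) (at x)"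
proof -
  have a: "((\<lambda>x. 1 - ((x - z) \<bullet> (x - z)) / r\<^sup>2) has_derivative (\<lambda>h. - 2 * ((x - z) \<bullet> h) / r\<^sup>2)) (at x)"
    by (auto intro!: derivative_eq_intros simp: inner_commute divide_inverse algebra_simps)
  have b: "(flat 0 has_derivative (\<lambda>h. flat 2 t * h)) (at t)" for t
    using flat_derivative[of 0 t] by (simp add: has_field_derivative_def numeral_2_eq_2)
  show ?thesis
    using has_derivative_compose[OF a b] unfolding bump_def[abs_def] power2_norm_eq_inner .
qed

lemma field_kernel_divergence:
  fixes z :: "'a::euclidean_space"
  assumes r: "r > 0"
  shows "(\<Sum>i\<in>Basis. frechet_derivative (\<lambda>x. field_kernel z r p q x \<bullet> i) (at x) i) = - kernel_derivative z r p q x"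
proof -
  let ?F = "flat 2 (1 - (norm (x - z))\<^sup>2 / r\<^sup>2)"
  have d: "frechet_derivative (\<lambda>x. field_kernel z r p q x \<bullet> i) (at x) i =
      (?F * (- 2 * ((x - z) \<bullet> i) / r\<^sup>2) * (p \<bullet> i + q / r * ((x - z) \<bullet> i)) + bump z r x * (q / r)) / r ^ DIM('a)"
    if i: "i \<in> Basis" for i
  proof -
    have "((\<lambda>x. field_kernel z r p q x \<bullet> i) has_derivative
      (\<lambda>h. (bump z r x * (q / r * (h \<bullet> i)) + ?F * (- 2 * ((x - z) \<bullet> h) / r\<^sup>2) * (p \<bullet> i + q / r * ((x - z) \<bullet> i))) / r ^ DIM('a))) (at x)"
    proof -
      have "((\<lambda>x. p \<bullet> i + q / r * ((x - z) \<bullet> i)) has_derivative (\<lambda>h. q / r * (h \<bullet> i))) (at x)"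
        using r by (auto intro!: derivative_eq_intros)
      from bounded_linear.has_derivative[OF bounded_linear_divide[of "r ^ DIM('a)"] has_derivative_mult[OF bump_has_derivative[of z r x] this]]
      have "((\<lambda>x. bump z r x * (p \<bullet> i + q / r * ((x - z) \<bullet> i)) / r ^ DIM('a)) has_derivative
        (\<lambda>h. (bump z r x * (q / r * (h \<bullet> i)) + ?F * (- 2 * ((x - z) \<bullet> h) / r\<^sup>2) * (p \<bullet> i + q / r * ((x - z) \<bullet> i))) / r ^ DIM('a))) (at x)"
        .
      then show ?thesis by (simp add: field_kernel_def avg_kernel_def inner_add_left)
    qed
    from frechet_derivative_at[OF this, symmetric] show ?thesis using i by (simp add: inner_Basis add.commute)
  qed
  have "(\<Sum>i\<in>Basis. frechet_derivative (\<lambda>x. field_kernel z r p q x \<bullet> i) (at x) i) =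
    (\<Sum>i\<in>Basis. (?F * (- 2 / r\<^sup>2) * (((x - z) \<bullet> i) * (p \<bullet> i)) + ?F * (- 2 / r\<^sup>2) * (q / r) * (((x - z) \<bullet> i) * ((x - z) \<bullet> i))
      + bump z r x * (q / r)) / r ^ DIM('a))"
    by (rule sum.cong) (simp_all add: d algebra_simps divide_inverse)
  also have "\<dots> = (?F * (- 2 / r\<^sup>2) * (\<Sum>i\<in>Basis. ((x - z) \<bullet> i) * (p \<bullet> i))
      + ?F * (- 2 / r\<^sup>2) * (q / r) * (\<Sum>i\<in>Basis. ((x - z) \<bullet> i) * ((x - z) \<bullet> i))
      + real (DIM('a)) * (bump z r x * (q / r))) / r ^ DIM('a)"
  proof -
    have "(\<Sum>i\<in>A. (a * f i + b * g i + c) / R) = (a * (\<Sum>i\<in>A. f i) + b * (\<Sum>i\<in>A. g i) + real (card A) * c) / R"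
      for a b c R :: real and f g :: "'a \<Rightarrow> real" and A
      by (simp add: sum_divide_distrib[symmetric] sum.distrib sum_distrib_left[symmetric])
    then show ?thesis .
  qed
  also have "\<dots> = (?F * (- 2 / r\<^sup>2) * ((x - z) \<bullet> p) + ?F * (- 2 / r\<^sup>2) * (q / r) * (norm (x - z))\<^sup>2
      + real (DIM('a)) * (bump z r x * (q / r))) / r ^ DIM('a)"
    using euclidean_inner[of "x - z" p] euclidean_inner[of "x - z" "x - z"]
    unfolding power2_norm_eq_inner by simp
  also have "\<dots> = - kernel_derivative z r p q x"
    using r by (simp add: kernel_derivative_def field_simps power2_eq_square power3_eq_cube)
  finally show ?thesis .
qed

lemma kernel_derivative_correct:
  fixes z :: "'a::euclidean_space"
  assumes "r + s * q > 0"
  shows "((\<lambda>s. avg_kernel (z + s *\<^sub>R p) (r + s * q) x) has_real_derivative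
    kernel_derivative (z + s *\<^sub>R p) (r + s * q) p q x) (at s within A)"
proof -
  define y where "y s = x - (z + s *\<^sub>R p)" for s
  define t where "t s = r + s * q" for s
  have ts: "t s > 0" using assms by (simp add: t_def)
  have dy: "((\<lambda>s. y s \<bullet> y s) has_real_derivative - 2 * (y s \<bullet> p)) (at s)"
  proof -
    have "(y has_derivative (\<lambda>h. - (h *\<^sub>R p))) (at s)"
      unfolding y_def[abs_def] by (auto intro!: derivative_eq_intros)
    from has_derivative_inner[OF this this]
    show ?thesis unfolding has_field_derivative_def
      by (rule has_derivative_eq_rhs) (simp add: fun_eq_iff inner_commute algebra_simps)
  qed
  have dt: "(t has_real_derivative q) (at s)" unfolding t_def[abs_def] by (auto intro!: derivative_eq_intros)
  define a where "a s = 1 - (y s \<bullet> y s) / (t s)\<^sup>2" for s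
  have da: "(a has_real_derivative (2 * (y s \<bullet> p) / (t s)\<^sup>2 + 2 * (y s \<bullet> y s) * q / (t s) ^ 3)) (at s)"
  proof -
    have dt2: "((\<lambda>s. (t s)\<^sup>2) has_real_derivative 2 * t s * q) (at s)"
      by (rule DERIV_cong[OF DERIV_power[OF dt, of 2]]) simp
    have t2: "(t s)\<^sup>2 \<noteq> 0" using ts by simp
    from DERIV_diff[OF DERIV_const[of 1] DERIV_divide[OF dy dt2 t2]]
    have "(a has_real_derivative 0 - ((- 2 * (y s \<bullet> p)) * (t s)\<^sup>2 - (y s \<bullet> y s) * (2 * t s * q)) / ((t s)\<^sup>2 * (t s)\<^sup>2)) (at s)"
      unfolding a_def[abs_def] .
    moreover have "0 - ((- 2 * (y s \<bullet> p)) * (t s)\<^sup>2 - (y s \<bullet> y s) * (2 * t s * q)) / ((t s)\<^sup>2 * (t s)\<^sup>2) =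
        2 * (y s \<bullet> p) / (t s)\<^sup>2 + 2 * (y s \<bullet> y s) * q / (t s) ^ 3"
      using ts by (simp add: field_simps power2_eq_square power3_eq_cube)
    ultimately show ?thesis by simp
  qed
  have dflat: "((\<lambda>s. flat 0 (a s)) has_real_derivative (flat 2 (a s) * (2 * (y s \<bullet> p) / (t s)\<^sup>2 + 2 * (y s \<bullet> y s) * q / (t s) ^ 3))) (at s)"
    using DERIV_chain2[OF flat_derivative[of 0 "a s"] da] by (simp add: numeral_2_eq_2)
  have "((\<lambda>s. flat 0 (a s) / (t s) ^ DIM('a)) has_real_derivative
      ((flat 2 (a s) * (2 * (y s \<bullet> p) / (t s)\<^sup>2 + 2 * (y s \<bullet> y s) * q / (t s) ^ 3)) * (t s) ^ DIM('a)
        - flat 0 (a s) * (real (DIM('a)) * (q * (t s) ^ (DIM('a) - 1)))) / ((t s) ^ DIM('a) * (t s) ^ DIM('a))) (at s)"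
    by (rule derivative_eq_intros dflat dt refl)+ (use ts in auto)
  moreover have "((flat 2 (a s) * (2 * (y s \<bullet> p) / (t s)\<^sup>2 + 2 * (y s \<bullet> y s) * q / (t s) ^ 3)) * (t s) ^ DIM('a)
        - flat 0 (a s) * (real (DIM('a)) * (q * (t s) ^ (DIM('a) - 1)))) / ((t s) ^ DIM('a) * (t s) ^ DIM('a)) =
      kernel_derivative (z + s *\<^sub>R p) (r + s * q) p q x"
  proof -
    have pw: "(t s) ^ (DIM('a) - 1) = (t s) ^ DIM('a) / t s"
      using ts DIM_positive[where 'a='a] by (simp add: power_diff)
    show ?thesis
      unfolding pw kernel_derivative_def bump_def y_def[symmetric] t_def[symmetric] power2_norm_eq_inner a_def[symmetric]
      using ts by (simp add: field_simps)
  qed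
  moreover have "(\<lambda>s. flat 0 (a s) / (t s) ^ DIM('a)) = (\<lambda>s. avg_kernel (z + s *\<^sub>R p) (r + s * q) x)"
    by (simp add: fun_eq_iff avg_kernel_def bump_def a_def y_def t_def power2_norm_eq_inner)
  ultimately show ?thesis by (auto intro: has_field_derivative_at_within)
qed

lemma flat_continuous: "continuous_on A (flat k)"
  by (rule DERIV_continuous_on) (rule has_field_derivative_at_within[OF flat_derivative])

text \<open>Integration by parts against \<open>field_kernel\<close> moves the derivative of the kernel to \<open>u\<close>, where it becomes the
  gradient \<open>w\<close>. The bound is the product of the supremum of the field and the square root of the volume of the ball.\<close>

lemma (in open_domain) average_pairing:
  assumes uw: "(u, w) \<in> grad_graph D" and zr: "cball z r \<subseteq> D" and r: "r > 0"
  shows "(\<integral>x. rep u x * kernel_derivative z r p q x \<partial>lebesgue) = w \<bullet> cls (field_kernel z r p q)"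
    and "norm (cls (field_kernel z r p q)) \<le> ball_const TYPE('a) / sqrt (r ^ DIM('a)) * (norm p + \<bar>q\<bar>)"
proof -
  let ?\<Psi> = "\<lambda>i x. field_kernel z r p q x \<bullet> i"
  have zero: "field_kernel z r p q x = 0" if "x \<notin> cball z r" for x
    using that bump_zero[OF r, of x z] ball_subset_cball[of z r] by (auto simp: field_kernel_def avg_kernel_def)
  have tame: "tame (?\<Psi> i)" for i
  proof -
    have "tame (\<lambda>x. avg_kernel z r x * ((p \<bullet> i - q / r * (z \<bullet> i)) + q / r * (x \<bullet> i)))"
      by (intro tame_mult tame_avg_kernel tame_affine)
    then show ?thesis by (simp add: field_kernel_def inner_add_left inner_diff_left algebra_simps)
  qed
  have test: "?\<Psi> i \<in> test_fun D" for i
    by (rule test_funI[OF tame_smooth[OF tame] compact_cball zr]) (simp add: zero)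
  have cont: "continuous_on UNIV (field_kernel z r p q)"
    unfolding field_kernel_def[abs_def]
    by (intro continuous_intros tame_continuous[OF tame_avg_kernel])
  have bnd: "norm (field_kernel z r p q x) \<le> (1 / r ^ DIM('a) * (norm p + \<bar>q\<bar>)) * indicator (cball z r) x" for x
  proof (cases "x \<in> cball z r")
    case True
    then have "norm (x - z) \<le> r" by (simp add: dist_norm norm_minus_commute)
    then have "\<bar>q\<bar> / r * norm (x - z) \<le> \<bar>q\<bar> / r * r" using r by (intro mult_left_mono) auto
    then have "norm ((q / r) *\<^sub>R (x - z)) \<le> \<bar>q\<bar>" unfolding norm_scaleR using r by simp
    then have "norm (p + (q / r) *\<^sub>R (x - z)) \<le> norm p + \<bar>q\<bar>" by (meson add_left_mono norm_triangle_ineq order_trans)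
    moreover have "\<bar>avg_kernel z r x\<bar> \<le> 1 / r ^ DIM('a)" using avg_kernel_bounds(2)[OF r, of z x] True by simp
    ultimately have "\<bar>avg_kernel z r x\<bar> * norm (p + (q / r) *\<^sub>R (x - z)) \<le> 1 / r ^ DIM('a) * (norm p + \<bar>q\<bar>)"
      using r by (intro mult_mono) auto
    then show ?thesis using True by (simp add: field_kernel_def)
  qed (simp add: zero)
  note sq = norm_cls_le_support(1)[OF continuous_lebesgue_measurable[OF cont] bnd _ r]
  have sq: "sq_integrable (field_kernel z r p q)" by (rule sq) (use r in simp)
  have "norm (cls (field_kernel z r p q)) \<le> (1 / r ^ DIM('a) * (norm p + \<bar>q\<bar>)) * sqrt (unit_ball_vol (DIM('a)) * r ^ DIM('a))"
    by (rule norm_cls_le_support(2)[OF continuous_lebesgue_measurable[OF cont] bnd _ r]) (use r in simp)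
  also have "\<dots> = ball_const TYPE('a) / sqrt (r ^ DIM('a)) * (norm p + \<bar>q\<bar>)"
  proof -
    have "1 / r ^ DIM('a) * sqrt (r ^ DIM('a)) = 1 / sqrt (r ^ DIM('a))"
      using r by (simp add: real_div_sqrt field_simps)
    then have e: "1 / r ^ DIM('a) * (norm p + \<bar>q\<bar>) * (c * sqrt (r ^ DIM('a))) = c * (1 / sqrt (r ^ DIM('a))) * (norm p + \<bar>q\<bar>)" for c
      by (metis mult.assoc mult.commute)
    show ?thesis unfolding real_sqrt_mult e ball_const_def by simp
  qed
  finally show "norm (cls (field_kernel z r p q)) \<le> ball_const TYPE('a) / sqrt (r ^ DIM('a)) * (norm p + \<bar>q\<bar>)" .
  have "(\<integral>x. rep u x * kernel_derivative z r p q x \<partial>lebesgue) =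
      (\<integral>x. - (\<Sum>i\<in>Basis. rep u x * frechet_derivative (?\<Psi> i) (at x) i) \<partial>lebesgue)"
    using field_kernel_divergence[OF r, of z p q]
    by (intro Bochner_Integration.integral_cong) (simp_all add: sum_distrib_left[symmetric])
  also have "\<dots> = - (\<Sum>i\<in>Basis. \<integral>x. rep u x * frechet_derivative (?\<Psi> i) (at x) i \<partial>lebesgue)"
    by (subst Bochner_Integration.integral_minus, subst Bochner_Integration.integral_sum)
      (auto intro!: sq_integrable_mult test_fun_pderiv_sq_integrable(1)[OF test])
  also have "\<dots> = (\<Sum>i\<in>Basis. coord i w \<bullet> cls (?\<Psi> i))"
    unfolding sum_negf[symmetric]
  proof (rule sum.cong)
    fix i :: 'a assume i: "i \<in> Basis"
    have "u \<bullet> cls (\<lambda>x. frechet_derivative (?\<Psi> i) (at x) i) = - (coord i w \<bullet> cls (?\<Psi> i))"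
      using uw i test[of i] unfolding grad_graph_def weak_deriv_def by blast
    then show "- (\<integral>x. rep u x * frechet_derivative (?\<Psi> i) (at x) i \<partial>lebesgue) = coord i w \<bullet> cls (?\<Psi> i)"
      using l2_inner_cls[OF test_fun_pderiv_sq_integrable(1)[OF test i], of u i] by simp
  qed simp
  also have "\<dots> = (\<Sum>i\<in>Basis. coord i w \<bullet> coord i (cls (field_kernel z r p q)))"
  proof (rule sum.cong)
    fix i :: 'a assume i: "i \<in> Basis"
    have "coord i (cls (field_kernel z r p q)) = cls (?\<Psi> i)"
      unfolding coord_def
    proof (subst cls_eq_iff)
      show "AE x in lebesgue. rep (cls (field_kernel z r p q)) x \<bullet> i = field_kernel z r p q x \<bullet> i"
        using rep_cls[OF sq] by eventually_elim simp
    qed (auto intro: coord_sq i test_fun_sq_integrable(1)[OF test])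
    then show "coord i w \<bullet> cls (?\<Psi> i) = coord i w \<bullet> coord i (cls (field_kernel z r p q))" by simp
  qed simp
  also have "\<dots> = w \<bullet> cls (field_kernel z r p q)" by (simp add: inner_eq_sum_coord)
  finally show "(\<integral>x. rep u x * kernel_derivative z r p q x \<partial>lebesgue) = w \<bullet> cls (field_kernel z r p q)" .
qed

text \<open>The average is differentiable along the segment, and the previous lemma bounds its derivative. The estimate
  involves the gradient only, and its constant improves with the radius as \<open>\<rho>\<^sup>-\<^sup>d\<^sup>/\<^sup>2\<close>.\<close>

lemma (in open_domain) average_along_segment:
  assumes uw: "(u, w) \<in> grad_graph D" and \<rho>: "0 < \<rho>" "\<rho> \<le> r" "\<rho> \<le> r + q"
    and sub: "\<And>s. s \<in> {0..1} \<Longrightarrow> cball (z + s *\<^sub>R p) (r + s * q) \<subseteq> D"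
  shows "\<bar>u \<bullet> cls (avg_kernel (z + p) (r + q)) - u \<bullet> cls (avg_kernel z r)\<bar>
    \<le> ball_const TYPE('a) / sqrt (\<rho> ^ DIM('a)) * (norm p + \<bar>q\<bar>) * norm w"
proof -
  have rs: "\<rho> \<le> r + s * q" if "s \<in> {0..1}" for s
  proof -
    have "\<rho> = (1 - s) * \<rho> + s * \<rho>" by (simp add: algebra_simps)
    also have "\<dots> \<le> (1 - s) * r + s * (r + q)" using that \<rho> by (intro add_mono mult_left_mono) auto
    finally show ?thesis by (simp add: algebra_simps)
  qed
  then have rs0: "0 < r + s * q" if "s \<in> {0..1}" for s using that \<rho>(1) by fastforce
  define Q where "Q = cball z (norm p + \<bar>r\<bar> + \<bar>q\<bar>)"
  have inQ: "x \<in> Q" if "s \<in> {0..1}" "x \<in> cball (z + s *\<^sub>R p) (r + s * q)" for s x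
  proof -
    have "dist z x \<le> dist z (z + s *\<^sub>R p) + dist (z + s *\<^sub>R p) x" by (rule dist_triangle)
    moreover have "dist z (z + s *\<^sub>R p) \<le> norm p" using that(1) by (simp add: dist_norm mult_left_le_one_le)
    moreover have "s * q \<le> \<bar>q\<bar>"
      using that(1) by (meson abs_ge_self abs_ge_zero atLeastAtMost_iff dual_order.trans mult_left_le_one_le mult_left_mono)
    ultimately show ?thesis using that(2) unfolding Q_def by simp
  qed
  define K where "K s = avg_kernel (z + s *\<^sub>R p) (r + s * q)" for s
  define dK where "dK s = kernel_derivative (z + s *\<^sub>R p) (r + s * q) p q" for s
  have K0: "K s x = 0" "dK s x = 0" if "s \<in> {0..1}" "x \<notin> Q" for s x
  proof -
    have x: "x \<notin> ball (z + s *\<^sub>R p) (r + s * q)" using inQ[of s x] that ball_subset_cball by blast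
    show "K s x = 0" "dK s x = 0"
      unfolding K_def dK_def avg_kernel_def kernel_derivative_def bump_zero[OF rs0[OF that(1)] x]
        flat_ball_zero[OF rs0[OF that(1)] x] by simp_all
  qed
  have contK: "continuous_on ({0..1} \<times> UNIV) (\<lambda>(s, x). K s x)"
    unfolding K_def avg_kernel_def bump_def case_prod_beta
    by (intro continuous_intros continuous_on_compose2[OF flat_continuous[of UNIV]]) (use rs0 in fastforce)+
  have contdK: "continuous_on ({0..1} \<times> UNIV) (\<lambda>(s, x). dK s x)"
    unfolding dK_def kernel_derivative_def bump_def case_prod_beta
    by (intro continuous_intros continuous_on_compose2[OF flat_continuous[of UNIV]]) (use rs0 in fastforce)+
  have slice: "continuous_on UNIV (F s)" if F: "continuous_on ({0..1} \<times> UNIV) (\<lambda>(s, x). F s x)" and s: "s \<in> {0..1}"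
    for F :: "real \<Rightarrow> 'a \<Rightarrow> real" and s
  proof -
    have "continuous_on UNIV ((\<lambda>(s, x). F s x) \<circ> (\<lambda>x. (s, x)))"
      using s by (intro continuous_on_compose) (auto intro!: continuous_intros continuous_on_subset[OF F])
    then show ?thesis by (simp add: o_def)
  qed
  have bounded: "\<exists>B\<ge>0. \<forall>s\<in>{0..1}. \<forall>x\<in>Q. \<bar>F s x\<bar> \<le> B" if F: "continuous_on ({0..1} \<times> UNIV) (\<lambda>(s, x). F s x)"
    for F :: "real \<Rightarrow> 'a \<Rightarrow> real"
  proof -
    have "compact ((\<lambda>(s, x). F s x) ` ({0..1} \<times> Q))"
      by (rule compact_continuous_image) (auto intro: continuous_on_subset[OF F] compact_Times simp: Q_def)
    then have "bounded ((\<lambda>(s, x). F s x) ` ({0..1} \<times> Q))" by (rule compact_imp_bounded)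
    then obtain B where "B > 0" "\<forall>y\<in>(\<lambda>(s, x). F s x) ` ({0..1} \<times> Q). norm y \<le> B" unfolding bounded_pos by blast
    then show ?thesis by (intro exI[of _ B]) auto
  qed
  obtain B1 B2 where B: "B1 \<ge> 0" "\<And>s x. s \<in> {0..1} \<Longrightarrow> x \<in> Q \<Longrightarrow> \<bar>K s x\<bar> \<le> B1"
    "B2 \<ge> 0" "\<And>s x. s \<in> {0..1} \<Longrightarrow> x \<in> Q \<Longrightarrow> \<bar>dK s x\<bar> \<le> B2"
    using bounded[OF contK] bounded[OF contdK] by blast
  define V where "V s = (\<integral>x. rep u x * K s x \<partial>lebesgue)" for s
  have "norm (V 1 - V 0) \<le> (ball_const TYPE('a) / sqrt (\<rho> ^ DIM('a)) * (norm p + \<bar>q\<bar>) * norm w) * norm (1 - 0 :: real)"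
  proof (rule field_differentiable_bound[of "{0..1}"])
    fix s :: real assume s: "s \<in> {0..1}"
    show "(V has_real_derivative (\<integral>x. rep u x * dK s x \<partial>lebesgue)) (at s within {0..1})"
      unfolding V_def[abs_def]
    proof (rule integral_has_derivative[where Q=Q and B="B1 + B2"])
      have "sq_integrable (indicator Q :: 'a \<Rightarrow> real)"
        by (rule sq_integrable_indicat_real) (simp add: Q_def)
      then show "integrable lebesgue (\<lambda>x. rep u x * indicator Q x)" by (rule sq_integrable_mult[OF rep_sq_integrable])
      show "K s \<in> borel_measurable lebesgue" "dK s \<in> borel_measurable lebesgue" if "s \<in> {0..1}" for s
        by (intro continuous_lebesgue_measurable slice contK contdK that)+
      show "((\<lambda>s. K s x) has_real_derivative dK s x) (at s within {0..1})" if "s \<in> {0..1}" for s x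
        unfolding K_def dK_def by (rule kernel_derivative_correct[OF rs0[OF that]])
      show "\<bar>K s x\<bar> \<le> (B1 + B2) * indicator Q x" if "s \<in> {0..1}" for s x
        using B(2)[OF that, of x] B(1,3) K0(1)[OF that, of x] by (cases "x \<in> Q") auto
      show "\<bar>dK s x\<bar> \<le> (B1 + B2) * indicator Q x" if "s \<in> {0..1}" for s x
        using B(4)[OF that, of x] B(1,3) K0(2)[OF that, of x] by (cases "x \<in> Q") auto
    qed (use s in auto)
    have "norm (\<integral>x. rep u x * dK s x \<partial>lebesgue) = \<bar>w \<bullet> cls (field_kernel (z + s *\<^sub>R p) (r + s * q) p q)\<bar>"
      unfolding dK_def average_pairing(1)[OF uw sub[OF s] rs0[OF s]] by simp
    also have "\<dots> \<le> norm w * norm (cls (field_kernel (z + s *\<^sub>R p) (r + s * q) p q))" by (rule Cauchy_Schwarz_ineq2)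
    also have "\<dots> \<le> norm w * (ball_const TYPE('a) / sqrt ((r + s * q) ^ DIM('a)) * (norm p + \<bar>q\<bar>))"
      by (intro mult_left_mono average_pairing(2)[OF uw sub[OF s] rs0[OF s]]) simp
    also have "\<dots> \<le> norm w * (ball_const TYPE('a) / sqrt (\<rho> ^ DIM('a)) * (norm p + \<bar>q\<bar>))"
      using rs[OF s] \<rho>(1) ball_const_nonneg[where 'a='a]
      by (intro mult_left_mono mult_right_mono divide_left_mono real_sqrt_le_mono power_mono mult_pos_pos) auto
    finally show "norm (\<integral>x. rep u x * dK s x \<partial>lebesgue) \<le> ball_const TYPE('a) / sqrt (\<rho> ^ DIM('a)) * (norm p + \<bar>q\<bar>) * norm w"
      by (simp add: mult.commute mult.left_commute)
  qed auto
  moreover have "V 1 = u \<bullet> cls (avg_kernel (z + p) (r + q))"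
    unfolding V_def K_def using l2_inner_cls[OF avg_kernel_sq_integrable, of "r + q" u "z + p"] rs0[of 1] by simp
  moreover have "V 0 = u \<bullet> cls (avg_kernel z r)"
    unfolding V_def K_def using l2_inner_cls[OF avg_kernel_sq_integrable, of r u z] rs0[of 0] by simp
  ultimately show ?thesis by simp
qed

section \<open>Chains of balls in a uniform domain\<close>

lemma bound_by_geometric_increments:
  fixes v :: "nat \<Rightarrow> real"
  assumes lim: "v \<longlonglongrightarrow> 0" and q: "0 \<le> q" "q < 1" and step: "\<And>k. \<bar>v (Suc k) - v k\<bar> \<le> c * q ^ k"
  shows "\<bar>v 0\<bar> \<le> c / (1 - q)"
proof -
  have c: "c \<ge> 0" using order_trans[OF abs_ge_zero step[of 0]] by simp
  have "\<bar>v 0 - v n\<bar> \<le> c / (1 - q)" for n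
  proof -
    have "v 0 - v n = - (\<Sum>k<n. v (Suc k) - v k)" by (simp add: sum_lessThan_telescope)
    also have "\<bar>\<dots>\<bar> \<le> (\<Sum>k<n. \<bar>v (Suc k) - v k\<bar>)" by (simp add: sum_abs)
    also have "\<dots> \<le> (\<Sum>k<n. c * q ^ k)" by (rule sum_mono) (rule step)
    also have "\<dots> = c * ((1 - q ^ n) / (1 - q))" using q by (simp add: sum_distrib_left[symmetric] sum_gp_strict)
    also have "\<dots> \<le> c * (1 / (1 - q))" using q c by (intro mult_left_mono divide_right_mono) auto
    finally show ?thesis by simp
  qed
  moreover have "(\<lambda>n. \<bar>v 0 - v n\<bar>) \<longlonglongrightarrow> \<bar>v 0 - 0\<bar>" by (intro tendsto_intros lim)
  ultimately show ?thesis using LIMSEQ_le_const2[of "\<lambda>n. \<bar>v 0 - v n\<bar>" "\<bar>v 0 - 0\<bar>" "c / (1 - q)"] by auto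
qed

lemma path_chord_sums:
  fixes \<gamma> :: "real \<Rightarrow> 'a::euclidean_space"
  assumes g: "path \<gamma>" and len: "curve_length \<gamma> \<le> ereal L" and e: "e > 0"
  obtains n and t :: "nat \<Rightarrow> real" where "t 0 = 0" "t n = 1" "\<And>k. t k \<in> {0..1}"
    "\<And>k. k < n \<Longrightarrow> dist (\<gamma> (t k)) (\<gamma> (t (Suc k))) < e"
    "(\<Sum>k<n. dist (\<gamma> (t k)) (\<gamma> (t (Suc k)))) \<le> L"
proof -
  have "uniformly_continuous_on {0..1} \<gamma>"
    using g by (intro compact_uniformly_continuous) (auto simp: path_def)
  then obtain d where d: "d > 0" "\<And>s t. s \<in> {0..1} \<Longrightarrow> t \<in> {0..1} \<Longrightarrow> dist t s < d \<Longrightarrow> dist (\<gamma> t) (\<gamma> s) < e"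
    unfolding uniformly_continuous_on_def using e by metis
  obtain n where n: "inverse (real (Suc n)) < d" using reals_Archimedean[OF d(1)] by blast
  define t where "t k = min (real k / real (Suc n)) 1" for k
  have t01: "t k \<in> {0..1}" for k by (simp add: t_def)
  have mono: "mono t"
  proof (rule monoI)
    fix x y :: nat assume "x \<le> y"
    then have "real x / real (Suc n) \<le> real y / real (Suc n)" by (intro divide_right_mono) auto
    then show "t x \<le> t y" unfolding t_def by (intro min.mono) auto
  qed
  show ?thesis
  proof (rule that[of t "Suc n"])
    show "t 0 = 0" "t (Suc n) = 1" by (simp_all add: t_def)
    show "t k \<in> {0..1}" for k by (rule t01)
    show "dist (\<gamma> (t k)) (\<gamma> (t (Suc k))) < e" if "k < Suc n" for k
    proof (rule d(2)[OF t01 t01])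
      have "dist (t k) (t (Suc k)) \<le> inverse (real (Suc n))"
      proof -
        have "t (Suc k) = min (real k / real (Suc n) + inverse (real (Suc n))) 1"
          unfolding t_def by (simp add: divide_inverse distrib_right add.commute)
        moreover have "dist (min a 1) (min (a + h) 1) \<le> h" if "h \<ge> 0" for a h :: real
          using that by (auto simp: dist_real_def min_def)
        moreover have "0 \<le> inverse (real (Suc n))" by simp
        ultimately show ?thesis unfolding t_def by simp
      qed
      then show "dist (t k) (t (Suc k)) < d" using n by linarith
    qed
    have "ereal (\<Sum>k<Suc n. dist (\<gamma> (t k)) (\<gamma> (t (Suc k)))) \<le> curve_length \<gamma>"
      unfolding curve_length_def
      by (rule SUP_upper2[of "(Suc n, t)"]) (use mono t01 in auto)
    then show "(\<Sum>k<Suc n. dist (\<gamma> (t k)) (\<gamma> (t (Suc k)))) \<le> L" using len by (meson ereal_less_eq(3) order_trans)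
  qed
qed

text \<open>The points \<open>z k\<close> lie at distance \<open>2\<^sup>k\<close> from a base point and at a distance comparable to \<open>2\<^sup>k\<close> from the
  complement of \<open>U\<close>; they are found on curves to points of \<open>U\<close> far away, which exist as \<open>U\<close> is unbounded. A
  curve given by uniformity from \<open>z k\<close> to \<open>z (Suc k)\<close> has length at most a multiple of \<open>2\<^sup>k\<close>. It also keeps a distance
  comparable to \<open>2\<^sup>k\<close> from the complement: near its ends because they do, elsewhere by uniformity.\<close>

lemma uniform_domain_chain:
  fixes U :: "'a::euclidean_space set"
  assumes U: "uniform_domain U" "\<not> bounded U"
  obtains c A :: real and z :: "nat \<Rightarrow> 'a" and \<gamma> :: "nat \<Rightarrow> real \<Rightarrow> 'a" where "c > 0" "A > 0"
    "\<And>k. path (\<gamma> k)" "\<And>k. pathstart (\<gamma> k) = z k" "\<And>k. pathfinish (\<gamma> k) = z (Suc k)"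
    "\<And>k. curve_length (\<gamma> k) \<le> ereal (A * 2 ^ k)"
    "\<And>k t. t \<in> {0..1} \<Longrightarrow> cball (\<gamma> k t) (2 * (c * 2 ^ k)) \<subseteq> U"
proof -
  obtain C0 where C0: "C0 > 0" "\<And>x y. x \<in> U \<Longrightarrow> y \<in> U \<Longrightarrow>
     \<exists>\<gamma>. path \<gamma> \<and> path_image \<gamma> \<subseteq> U \<and> pathstart \<gamma> = x \<and> pathfinish \<gamma> = y \<and>
        curve_length \<gamma> \<le> ereal (C0 * dist x y) \<and>
        (\<forall>z\<in>path_image \<gamma>. ereal (min (dist x z) (dist z y)) \<le> ereal C0 * set_distance z (- U))"
    using U(1) unfolding uniform_domain_def by blast
  define C where "C = max C0 1"
  have C: "C \<ge> 1" "C \<ge> C0" by (auto simp: C_def)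
  have curve: "\<exists>\<gamma>. path \<gamma> \<and> pathstart \<gamma> = x \<and> pathfinish \<gamma> = y \<and> curve_length \<gamma> \<le> ereal (C * dist x y) \<and>
     (\<forall>t\<in>{0..1}. \<forall>w. w \<notin> U \<longrightarrow> min (dist x (\<gamma> t)) (dist (\<gamma> t) y) \<le> C * dist (\<gamma> t) w)" if xy: "x \<in> U" "y \<in> U" for x y
  proof -
    obtain \<gamma> where g: "path \<gamma>" "pathstart \<gamma> = x" "pathfinish \<gamma> = y" "curve_length \<gamma> \<le> ereal (C0 * dist x y)"
        "\<And>z. z \<in> path_image \<gamma> \<Longrightarrow> ereal (min (dist x z) (dist z y)) \<le> ereal C0 * set_distance z (- U)"
      using C0(2)[OF xy] by blast
    have "curve_length \<gamma> \<le> ereal (C * dist x y)"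
      using g(4) C(2) by (meson ereal_less_eq(3) mult_right_mono order_trans zero_le_dist)
    moreover have "min (dist x (\<gamma> t)) (dist (\<gamma> t) y) \<le> C * dist (\<gamma> t) w" if t: "t \<in> {0..1}" and w: "w \<notin> U" for t w
    proof -
      have "set_distance (\<gamma> t) (- U) \<le> ereal (dist (\<gamma> t) w)"
        unfolding set_distance_def by (rule INF_lower) (use w in simp)
      then have "ereal C0 * set_distance (\<gamma> t) (- U) \<le> ereal C0 * ereal (dist (\<gamma> t) w)"
        using C0(1) by (intro ereal_mult_left_mono) auto
      moreover have "\<gamma> t \<in> path_image \<gamma>" using t unfolding path_image_def by blast
      ultimately have "ereal (min (dist x (\<gamma> t)) (dist (\<gamma> t) y)) \<le> ereal (C0 * dist (\<gamma> t) w)"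
        using g(5) by (metis order_trans times_ereal.simps(1))
      then have "min (dist x (\<gamma> t)) (dist (\<gamma> t) y) \<le> C0 * dist (\<gamma> t) w" by (simp only: ereal_less_eq(3))
      also have "\<dots> \<le> C * dist (\<gamma> t) w" using C(2) by (intro mult_right_mono) auto
      finally show ?thesis .
    qed
    ultimately show ?thesis using g(1-3) by blast
  qed
  obtain x0 where x0: "x0 \<in> U" using U(1) unfolding uniform_domain_def domain_set_def by blast
  (* A point at distance 2^k from x0 on a curve to a point far away is far from both ends,
     hence far from the complement of U. *)
  have "\<exists>z. dist x0 z = 2 ^ k \<and> (\<forall>w. w \<notin> U \<longrightarrow> 2 ^ k \<le> C * dist z w)" for k :: nat
  proof -
    obtain y where y: "y \<in> U" "dist x0 y > 2 * 2 ^ k"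
      using U(2) unfolding bounded_def by (metis not_le)
    obtain \<gamma> where g: "path \<gamma>" "pathstart \<gamma> = x0" "pathfinish \<gamma> = y"
      "\<And>t w. t \<in> {0..1} \<Longrightarrow> w \<notin> U \<Longrightarrow> min (dist x0 (\<gamma> t)) (dist (\<gamma> t) y) \<le> C * dist (\<gamma> t) w"
      using curve[OF x0 y(1)] by blast
    have "\<exists>t\<ge>0. t \<le> 1 \<and> dist x0 (\<gamma> t) = 2 ^ k"
    proof (rule IVT')
      show "continuous_on {0..1} (\<lambda>t. dist x0 (\<gamma> t))"
        using g(1) by (intro continuous_intros) (auto simp: path_def)
      have "(2::real) ^ k > 0" by simp
      then show "2 ^ k \<le> dist x0 (\<gamma> 1)"
        unfolding g(3)[unfolded pathfinish_def] using y(2) by linarith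
    qed (use g(2) in \<open>auto simp: pathstart_def\<close>)
    then obtain t where t: "t \<in> {0..1}" "dist x0 (\<gamma> t) = 2 ^ k" by auto
    have "dist x0 y \<le> dist x0 (\<gamma> t) + dist (\<gamma> t) y" by (rule dist_triangle)
    then have "min (dist x0 (\<gamma> t)) (dist (\<gamma> t) y) = 2 ^ k" using t(2) y(2) by simp
    then show ?thesis using t g(4)[OF t(1)] by (intro exI[of _ "\<gamma> t"]) auto
  qed
  then obtain z where z: "\<And>k::nat. dist x0 (z k) = 2 ^ k" "\<And>k w. w \<notin> U \<Longrightarrow> 2 ^ k \<le> C * dist (z k) w" by metis
  have zU: "z k \<in> U" for k
  proof (rule ccontr)
    assume "z k \<notin> U"
    from z(2)[OF this, of k] have "(2::real) ^ k \<le> 0" by simp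
    moreover have "(2::real) ^ k > 0" by simp
    ultimately show False by linarith
  qed
  have "\<exists>\<gamma>. path \<gamma> \<and> pathstart \<gamma> = z k \<and> pathfinish \<gamma> = z (Suc k) \<and> curve_length \<gamma> \<le> ereal (3 * C * 2 ^ k) \<and>
     (\<forall>t\<in>{0..1}. cball (\<gamma> t) (2 * (1 / (8 * C\<^sup>2) * 2 ^ k)) \<subseteq> U)" for k
  proof -
    obtain \<gamma> where g: "path \<gamma>" "pathstart \<gamma> = z k" "pathfinish \<gamma> = z (Suc k)"
      "curve_length \<gamma> \<le> ereal (C * dist (z k) (z (Suc k)))"
      "\<And>t w. t \<in> {0..1} \<Longrightarrow> w \<notin> U \<Longrightarrow> min (dist (z k) (\<gamma> t)) (dist (\<gamma> t) (z (Suc k))) \<le> C * dist (\<gamma> t) w"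
      using curve[OF zU zU, of k "Suc k"] by blast
    have "dist (z k) (z (Suc k)) \<le> 3 * 2 ^ k"
      using dist_triangle[of "z k" "z (Suc k)" x0] z(1)[of k] z(1)[of "Suc k"] by (simp add: dist_commute)
    then have "C * dist (z k) (z (Suc k)) \<le> 3 * C * 2 ^ k" using C(1) by simp
    then have "curve_length \<gamma> \<le> ereal (3 * C * 2 ^ k)" using g(4) by (meson ereal_less_eq(3) order_trans)
    moreover have "cball (\<gamma> t) (2 * (1 / (8 * C\<^sup>2) * 2 ^ k)) \<subseteq> U" if t: "t \<in> {0..1}" for t
    proof (rule ccontr)
      assume "\<not> cball (\<gamma> t) (2 * (1 / (8 * C\<^sup>2) * 2 ^ k)) \<subseteq> U"
      then obtain w where w: "w \<notin> U" "dist (\<gamma> t) w \<le> 2 * (1 / (8 * C\<^sup>2) * 2 ^ k)" by (auto simp: subset_eq)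
      define \<delta> where "\<delta> = C * dist (\<gamma> t) w"
      have d: "C * \<delta> \<le> 2 ^ k / 4"
      proof -
        have "C\<^sup>2 * dist (\<gamma> t) w \<le> C\<^sup>2 * (2 * (1 / (8 * C\<^sup>2) * 2 ^ k))" using w(2) by (rule mult_left_mono) simp
        also have "\<dots> = 2 ^ k / 4" using C(1) by simp
        finally show ?thesis by (simp add: \<delta>_def power2_eq_square mult.assoc)
      qed
      have d0: "0 \<le> \<delta>" "\<delta> \<le> C * \<delta>" "dist (\<gamma> t) w \<le> \<delta>"
        using C(1) mult_right_mono[of 1 C "\<delta>"] mult_right_mono[of 1 C "dist (\<gamma> t) w"] by (auto simp: \<delta>_def)
      have m: "min (dist (z k) (\<gamma> t)) (dist (\<gamma> t) (z (Suc k))) \<le> \<delta>"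
        unfolding \<delta>_def by (rule g(5)[OF t w(1)])
      have p: "(2::real) ^ k > 0" by simp
      show False
      proof (cases "dist (z k) (\<gamma> t) \<le> \<delta>")
        case True
        have "dist (z k) w \<le> \<delta> + dist (\<gamma> t) w" using dist_triangle[of "z k" w "\<gamma> t"] True by linarith
        then have "C * dist (z k) w \<le> C * (\<delta> + dist (\<gamma> t) w)" using C(1) by (intro mult_left_mono) auto
        also have "\<dots> = C * \<delta> + \<delta>" by (simp add: distrib_left \<delta>_def)
        finally show False using z(2)[OF w(1), of k] d d0 p by linarith
      next
        case False
        then have "dist (z (Suc k)) (\<gamma> t) \<le> \<delta>" using m by (simp add: dist_commute min_le_iff_disj)
        then have "dist (z (Suc k)) w \<le> \<delta> + dist (\<gamma> t) w" using dist_triangle[of "z (Suc k)" w "\<gamma> t"] by linarith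
        then have "C * dist (z (Suc k)) w \<le> C * (\<delta> + dist (\<gamma> t) w)" using C(1) by (intro mult_left_mono) auto
        also have "\<dots> = C * \<delta> + \<delta>" by (simp add: distrib_left \<delta>_def)
        finally have "2 ^ Suc k \<le> C * \<delta> + \<delta>" using z(2)[OF w(1), of "Suc k"] by linarith
        then show False using d d0 p by simp
      qed
    qed
    ultimately show ?thesis using g(1-3) by blast
  qed
  then have "\<forall>k. \<exists>\<gamma>. path \<gamma> \<and> pathstart \<gamma> = z k \<and> pathfinish \<gamma> = z (Suc k) \<and> curve_length \<gamma> \<le> ereal (3 * C * 2 ^ k) \<and>
     (\<forall>t\<in>{0..1}. cball (\<gamma> t) (2 * (1 / (8 * C\<^sup>2) * 2 ^ k)) \<subseteq> U)" by (rule allI)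
  from choice[OF this] obtain \<gamma> where
    g: "\<forall>k. path (\<gamma> k) \<and> pathstart (\<gamma> k) = z k \<and> pathfinish (\<gamma> k) = z (Suc k) \<and>
      curve_length (\<gamma> k) \<le> ereal (3 * C * 2 ^ k) \<and>
      (\<forall>t\<in>{0..1}. cball (\<gamma> k t) (2 * (1 / (8 * C\<^sup>2) * 2 ^ k)) \<subseteq> U)" by (rule exE)
  show ?thesis
  proof (rule that[of "1 / (8 * C\<^sup>2)" "3 * C" \<gamma> z])
    show "0 < 1 / (8 * C\<^sup>2)" "0 < 3 * C" using C(1) by auto
  qed (use g in blast)+
qed

section \<open>The Green bound\<close>

context open_domain
begin

text \<open>The smooth average with kernel \<open>avg_kernel z r\<close> is bounded in terms of the gradient alone. This says that
  the kernel is of finite energy, and it fails in recurrent situations.\<close>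

definition green_bound :: "'a \<Rightarrow> real \<Rightarrow> bool" where
  "green_bound z r \<longleftrightarrow> (\<exists>B. \<forall>(u, w)\<in>grad_graph D. \<bar>u \<bullet> cls (avg_kernel z r)\<bar> \<le> B * norm w)"

lemma average_along_curve:
  assumes uw: "(u, w) \<in> grad_graph D" and g: "path \<gamma>" "curve_length \<gamma> \<le> ereal L" and r: "r > 0"
    and sub: "\<And>t. t \<in> {0..1} \<Longrightarrow> cball (\<gamma> t) (2 * r) \<subseteq> D"
  shows "\<bar>u \<bullet> cls (avg_kernel (pathfinish \<gamma>) r) - u \<bullet> cls (avg_kernel (pathstart \<gamma>) r)\<bar>
    \<le> ball_const TYPE('a) / sqrt (r ^ DIM('a)) * L * norm w"
proof -
  define V where "V x = u \<bullet> cls (avg_kernel x r)" for x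
  define M where "M = ball_const TYPE('a) / sqrt (r ^ DIM('a)) * norm w"
  have M: "M \<ge> 0" using r ball_const_nonneg[where 'a='a] by (simp add: M_def)
  obtain n t where t: "t 0 = 0" "t n = 1" "\<And>k. t k \<in> {0..1}"
    "\<And>k. k < n \<Longrightarrow> dist (\<gamma> (t k)) (\<gamma> (t (Suc k))) < r"
    "(\<Sum>k<n. dist (\<gamma> (t k)) (\<gamma> (t (Suc k)))) \<le> L"
    by (rule path_chord_sums[OF g r]) blast
  have step: "\<bar>V (\<gamma> (t (Suc k))) - V (\<gamma> (t k))\<bar> \<le> M * dist (\<gamma> (t k)) (\<gamma> (t (Suc k)))" if k: "k < n" for k
  proof -
    define p where "p = \<gamma> (t (Suc k)) - \<gamma> (t k)"
    have np: "norm p = dist (\<gamma> (t k)) (\<gamma> (t (Suc k)))" by (simp add: p_def dist_norm norm_minus_commute)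
    have "\<bar>u \<bullet> cls (avg_kernel (\<gamma> (t k) + p) (r + 0)) - u \<bullet> cls (avg_kernel (\<gamma> (t k)) r)\<bar>
      \<le> ball_const TYPE('a) / sqrt (r ^ DIM('a)) * (norm p + \<bar>0\<bar>) * norm w"
    proof (rule average_along_segment[OF uw r])
      fix s :: real assume s: "s \<in> {0..1}"
      have "norm (s *\<^sub>R p) \<le> r" using s t(4)[OF k] np by (simp add: mult_le_one order_trans[OF mult_left_le_one_le])
      then have "cball (\<gamma> (t k) + s *\<^sub>R p) (r + s * 0) \<subseteq> cball (\<gamma> (t k)) (2 * r)"
        by (simp add: cball_subset_cball_iff dist_norm)
      then show "cball (\<gamma> (t k) + s *\<^sub>R p) (r + s * 0) \<subseteq> D" using sub[OF t(3)[of k]] by blast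
    qed auto
    then show ?thesis unfolding V_def M_def np[symmetric] by (simp add: p_def mult.commute mult.left_commute)
  qed
  have "V (\<gamma> 1) - V (\<gamma> 0) = (\<Sum>k<n. V (\<gamma> (t (Suc k))) - V (\<gamma> (t k)))"
    by (subst sum_lessThan_telescope[of "\<lambda>k. V (\<gamma> (t k))"]) (simp add: t)
  also have "\<bar>\<dots>\<bar> \<le> (\<Sum>k<n. \<bar>V (\<gamma> (t (Suc k))) - V (\<gamma> (t k))\<bar>)" by (rule sum_abs)
  also have "\<dots> \<le> (\<Sum>k<n. M * dist (\<gamma> (t k)) (\<gamma> (t (Suc k))))" by (rule sum_mono) (use step in auto)
  also have "\<dots> = M * (\<Sum>k<n. dist (\<gamma> (t k)) (\<gamma> (t (Suc k))))" by (rule sum_distrib_left[symmetric])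
  also have "\<dots> \<le> M * L" by (rule mult_left_mono[OF t(5) M])
  finally show ?thesis by (simp add: V_def M_def pathfinish_def pathstart_def mult.commute mult.left_commute)
qed

text \<open>Along the chain the averages of a square integrable function tend to 0, because the radii tend to
  infinity. The first average is hence at most the sum of the increments along the chain.\<close>

lemma green_bound_in_uniform_domain:
  assumes d3: "DIM('a) \<ge> 3" and U: "uniform_domain U" "\<not> bounded U" "U \<subseteq> D"
  obtains z r where "r > 0" "cball z (2 * r) \<subseteq> D" "green_bound z r"
proof (rule uniform_domain_chain[OF U(1,2)])
  fix c A :: real and z :: "nat \<Rightarrow> 'a" and \<gamma>
  assume c: "c > 0" and A: "A > 0" and g: "\<And>k. path (\<gamma> k)" "\<And>k. pathstart (\<gamma> k) = z k" "\<And>k. pathfinish (\<gamma> k) = z (Suc k)"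
    "\<And>k. curve_length (\<gamma> k) \<le> ereal (A * 2 ^ k)"
    and ball: "\<And>k t. t \<in> {0..1} \<Longrightarrow> cball (\<gamma> k t) (2 * (c * 2 ^ k)) \<subseteq> U"
  define \<rho> where "\<rho> k = c * 2 ^ k" for k :: nat
  have \<rho>: "\<rho> k > 0" "\<rho> (Suc k) = \<rho> k + \<rho> k" for k using c by (auto simp: \<rho>_def)
  have ballD: "cball (\<gamma> k t) (2 * \<rho> k) \<subseteq> D" if "t \<in> {0..1}" for k t using ball[OF that, of k] U(3) by (auto simp: \<rho>_def)
  define \<kappa> where "\<kappa> = ball_const TYPE('a)"
  have \<kappa>: "\<kappa> \<ge> 0" by (simp add: \<kappa>_def ball_const_nonneg)
  define q :: real where "q = 1 / sqrt 2"
  have q: "0 \<le> q" "q < 1" by (auto simp: q_def)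
  define B where "B = \<kappa> / sqrt (c ^ DIM('a)) * (A + c)"
  (* The step from scale 2^k to scale 2^(k + 1) costs 2^k (2^k)^(- d / 2), which is summable for d >= 3. *)
  have decay: "2 ^ k / sqrt ((2 ^ k) ^ DIM('a)) \<le> q ^ k" for k :: nat
  proof -
    have "((2::real) ^ k) ^ 3 \<le> (2 ^ k) ^ DIM('a)" using d3 by (intro power_increasing) auto
    then have "2 ^ k / sqrt ((2 ^ k) ^ DIM('a)) \<le> 2 ^ k / sqrt ((2 ^ k) ^ 3)"
      by (intro divide_left_mono real_sqrt_le_mono mult_pos_pos) auto
    also have "sqrt ((2 ^ k) ^ 3) = 2 ^ k * sqrt 2 ^ k"
    proof -
      have "((2::real) ^ k) ^ 3 = (2 ^ k)\<^sup>2 * 2 ^ k" by (simp add: power2_eq_square power3_eq_cube)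
      moreover have "sqrt ((2::real) ^ k) = sqrt 2 ^ k" by (rule real_sqrt_power)
      ultimately show ?thesis by (simp only: real_sqrt_mult) (simp add: real_sqrt_abs)
    qed
    also have "2 ^ k / (2 ^ k * sqrt 2 ^ k) = q ^ k" by (simp add: q_def power_one_over)
    finally show ?thesis .
  qed
  have "\<bar>u \<bullet> cls (avg_kernel (z 0) (\<rho> 0))\<bar> \<le> (B / (1 - q)) * norm w" if uw: "(u, w) \<in> grad_graph D" for u w
  proof -
    define v where "v k = u \<bullet> cls (avg_kernel (z k) (\<rho> k))" for k
    have sq: "sqrt (\<rho> k ^ DIM('a)) = sqrt (c ^ DIM('a)) * sqrt ((2 ^ k) ^ DIM('a))" for k
      by (simp add: \<rho>_def power_mult_distrib real_sqrt_mult)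
    have step: "\<bar>v (Suc k) - v k\<bar> \<le> (B * norm w) * q ^ k" for k
    proof -
      have 1: "\<bar>u \<bullet> cls (avg_kernel (z (Suc k)) (\<rho> k)) - u \<bullet> cls (avg_kernel (z k) (\<rho> k))\<bar>
          \<le> \<kappa> / sqrt (\<rho> k ^ DIM('a)) * (A * 2 ^ k) * norm w"
        using average_along_curve[OF uw g(1)[of k] g(4)[of k] \<rho>(1)[of k] ballD[of _ k]] by (simp add: g \<kappa>_def)
      have 2: "\<bar>u \<bullet> cls (avg_kernel (z (Suc k) + 0) (\<rho> k + \<rho> k)) - u \<bullet> cls (avg_kernel (z (Suc k)) (\<rho> k))\<bar>
          \<le> ball_const TYPE('a) / sqrt (\<rho> k ^ DIM('a)) * (norm (0::'a) + \<bar>\<rho> k\<bar>) * norm w"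
      proof (rule average_along_segment[OF uw \<rho>(1)])
        fix s :: real assume s: "s \<in> {0..1}"
        have "\<rho> k + s * \<rho> k \<le> 2 * \<rho> k" using s \<rho>(1)[of k] by (simp add: mult_left_le_one_le)
        then have "cball (z (Suc k) + s *\<^sub>R 0) (\<rho> k + s * \<rho> k) \<subseteq> cball (\<gamma> k 1) (2 * \<rho> k)"
          using g(3)[of k] by (simp add: pathfinish_def subset_cball)
        then show "cball (z (Suc k) + s *\<^sub>R 0) (\<rho> k + s * \<rho> k) \<subseteq> D" using ballD[of 1 k] by auto
      qed (use \<rho>(1)[of k] in auto)
      have "\<bar>v (Suc k) - v k\<bar> \<le> \<kappa> / sqrt (\<rho> k ^ DIM('a)) * (A * 2 ^ k) * norm w + \<kappa> / sqrt (\<rho> k ^ DIM('a)) * (c * 2 ^ k) * norm w"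
        using 1 2 \<rho>(1)[of k] unfolding v_def \<rho>(2) by (simp add: \<kappa>_def \<rho>_def)
      also have "\<dots> = B * norm w * (2 ^ k / sqrt ((2 ^ k) ^ DIM('a)))"
        unfolding sq B_def by (simp add: divide_inverse algebra_simps)
      also have "\<dots> \<le> B * norm w * q ^ k"
        using decay \<kappa> A c by (intro mult_left_mono) (auto simp: B_def)
      finally show ?thesis .
    qed
    have "v \<longlonglongrightarrow> 0"
    proof (rule Lim_null_comparison)
      show "\<forall>\<^sub>F k in sequentially. norm (v k) \<le> norm u * (\<kappa> / sqrt (c ^ DIM('a))) * q ^ k"
      proof (rule always_eventually, rule allI)
        fix k
        have "norm (v k) \<le> norm u * norm (cls (avg_kernel (z k) (\<rho> k)))"
          unfolding v_def real_norm_def by (rule Cauchy_Schwarz_ineq2)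
        also have "\<dots> \<le> norm u * (\<kappa> / sqrt (\<rho> k ^ DIM('a)))"
          unfolding \<kappa>_def by (intro mult_left_mono norm_avg_kernel \<rho>(1)) simp
        also have "\<dots> = norm u * (\<kappa> / sqrt (c ^ DIM('a))) * (1 / sqrt ((2 ^ k) ^ DIM('a)))"
          unfolding sq by simp
        also have "\<dots> \<le> norm u * (\<kappa> / sqrt (c ^ DIM('a))) * q ^ k"
        proof (intro mult_left_mono)
          have "1 / sqrt ((2 ^ k) ^ DIM('a)) \<le> 2 ^ k / sqrt ((2 ^ k) ^ DIM('a))" by (intro divide_right_mono) auto
          also have "\<dots> \<le> q ^ k" by (rule decay)
          finally show "1 / sqrt ((2 ^ k) ^ DIM('a)) \<le> q ^ k" .
        qed (use \<kappa> c in auto)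
        finally show "norm (v k) \<le> norm u * (\<kappa> / sqrt (c ^ DIM('a))) * q ^ k" .
      qed
      show "(\<lambda>k. norm u * (\<kappa> / sqrt (c ^ DIM('a))) * q ^ k) \<longlonglongrightarrow> 0"
        using q by (intro tendsto_mult_right_zero LIMSEQ_power_zero) auto
    qed
    from bound_by_geometric_increments[OF this q step] show ?thesis by (simp add: v_def)
  qed
  then have "green_bound (z 0) (\<rho> 0)" unfolding green_bound_def by blast
  moreover have "cball (z 0) (2 * \<rho> 0) \<subseteq> D" using ballD[of 0 0] g(2)[of 0] by (simp add: pathstart_def)
  ultimately show ?thesis using that \<rho>(1) by blast
qed

lemma green_bound_transfer:
  assumes "green_bound z r" and r: "r > 0" "r' > 0" and sub: "\<And>s. s \<in> {0..1} \<Longrightarrow> cball (z + s *\<^sub>R (z' - z)) (r + s * (r' - r)) \<subseteq> D"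
  shows "green_bound z' r'"
proof -
  obtain B where B: "\<And>u w. (u, w) \<in> grad_graph D \<Longrightarrow> \<bar>u \<bullet> cls (avg_kernel z r)\<bar> \<le> B * norm w"
    using assms(1) unfolding green_bound_def by blast
  define M where "M = ball_const TYPE('a) / sqrt (min r r' ^ DIM('a)) * (norm (z' - z) + \<bar>r' - r\<bar>)"
  have "\<bar>u \<bullet> cls (avg_kernel z' r')\<bar> \<le> (B + M) * norm w" if uw: "(u, w) \<in> grad_graph D" for u w
  proof -
    have "\<bar>u \<bullet> cls (avg_kernel (z + (z' - z)) (r + (r' - r))) - u \<bullet> cls (avg_kernel z r)\<bar> \<le> M * norm w"
      unfolding M_def by (rule average_along_segment[OF uw _ _ _ sub]) (use r in auto)
    then show ?thesis using B[OF uw] by (simp add: distrib_right)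
  qed
  then show ?thesis unfolding green_bound_def by blast
qed

text \<open>The bound is carried from one ball to another that overlaps it, so the set of centres of bounded
  averages is open and closed in \<open>D\<close>.\<close>

lemma green_bound_everywhere:
  assumes conn: "connected D" and start: "r0 > 0" "cball z0 r0 \<subseteq> D" "green_bound z0 r0"
    and r: "r > 0" and zr: "cball z r \<subseteq> D"
  shows "green_bound z r"
proof -
  define P where "P x \<longleftrightarrow> (\<forall>r>0. cball x r \<subseteq> D \<longrightarrow> green_bound x r)" for x
  have change_r: "green_bound x r'" if "green_bound x r" "r > 0" "r' > 0" "cball x r \<subseteq> D" "cball x r' \<subseteq> D" for x r r'
  proof (rule green_bound_transfer[OF that(1-3)])
    fix s :: real assume s: "s \<in> {0..1}"
    have "r + s * (r' - r) \<le> max r r'"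
    proof -
      have "r + s * (r' - r) = (1 - s) * r + s * r'" by (simp add: algebra_simps)
      also have "\<dots> \<le> (1 - s) * max r r' + s * max r r'" using s by (intro add_mono mult_left_mono) auto
      finally show ?thesis by (simp add: algebra_simps)
    qed
    then have "cball (x + s *\<^sub>R (x - x)) (r + s * (r' - r)) \<subseteq> cball x (max r r')" by (simp add: subset_cball)
    then show "cball (x + s *\<^sub>R (x - x)) (r + s * (r' - r)) \<subseteq> D" using that(4,5) by (auto simp: max_def split: if_splits)
  qed
  have "P z"
  proof (rule connected_induction_simple[OF conn])
    show "z0 \<in> D" "z \<in> D" using start r zr by auto
    show "P z0" unfolding P_def
    proof (intro allI impI)
      fix r' :: real assume "0 < r'" "cball z0 r' \<subseteq> D"
      then show "green_bound z0 r'" by (rule change_r[OF start(3,1) _ start(2)])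
    qed
    fix a assume "a \<in> D"
    then obtain e where e: "e > 0" "cball a e \<subseteq> D" using open_D open_contains_cball by blast
    have "P y" if xy: "x \<in> ball a (e / 4)" "y \<in> ball a (e / 4)" and Px: "P x" for x y
    proof -
      have dxy: "dist x y < e / 2" using xy dist_triangle[of x y a] by (simp add: dist_commute)
      have in_a: "cball v (e / 4) \<subseteq> cball a e" if "dist a v \<le> 3 * e / 4" for v
        using that e(1) by (simp add: cball_subset_cball_iff dist_commute)
      have bx: "cball x (e / 4) \<subseteq> D" using in_a[of x] e xy(1) by (intro order_trans[OF in_a e(2)]) simp
      have by': "cball y (e / 4) \<subseteq> D" using e xy(2) by (intro order_trans[OF in_a e(2)]) simp
      have e4: "e / 4 > 0" using e(1) by simp
      have "green_bound x (e / 4)" using Px[unfolded P_def, rule_format, OF e4 bx] .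
      then have gy: "green_bound y (e / 4)"
      proof (rule green_bound_transfer)
        fix s :: real assume s: "s \<in> {0..1}"
        have "dist a (x + s *\<^sub>R (y - x)) \<le> dist a x + dist x (x + s *\<^sub>R (y - x))" by (rule dist_triangle)
        moreover have "dist x (x + s *\<^sub>R (y - x)) \<le> dist x y"
          using s by (simp add: dist_norm norm_minus_commute mult_left_le_one_le)
        ultimately have "dist a (x + s *\<^sub>R (y - x)) \<le> 3 * e / 4" using dxy xy by simp
        then have "cball (x + s *\<^sub>R (y - x)) (e / 4) \<subseteq> D" by (rule order_trans[OF in_a e(2)])
        then show "cball (x + s *\<^sub>R (y - x)) (e / 4 + s * (e / 4 - e / 4)) \<subseteq> D" by simp
      qed (use e in auto)
      show "P y" unfolding P_def
      proof (intro allI impI)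
        fix r' :: real assume "0 < r'" "cball y r' \<subseteq> D"
        then show "green_bound y r'" by (rule change_r[OF gy e4 _ by'])
      qed
    qed
    then have "\<forall>x\<in>D \<inter> ball a (e / 4). \<forall>y\<in>D \<inter> ball a (e / 4). P x \<longrightarrow> P y" by blast
    moreover have "openin (top_of_set D) (D \<inter> ball a (e / 4))" by (simp add: openin_open_Int)
    moreover have "a \<in> D \<inter> ball a (e / 4)" using e(1) \<open>a \<in> D\<close> by simp
    ultimately show "\<exists>T. openin (top_of_set D) T \<and> a \<in> T \<and> (\<forall>x\<in>T. \<forall>y\<in>T. P x \<longrightarrow> P y)" by blast
  qed
  then show ?thesis using r zr unfolding P_def by blast
qed

end

section \<open>Transience\<close>

context open_domain
begin

lemma countable_ball_cover:
  assumes "D \<noteq> {}"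
  obtains z :: "nat \<Rightarrow> 'a" and r :: "nat \<Rightarrow> real"
  where "\<And>n. r n > 0" "\<And>n. cball (z n) (r n) \<subseteq> D" "D \<subseteq> (\<Union>n. ball (z n) (r n))"
proof -
  define F where "F = {ball z r | z r. r > 0 \<and> cball z r \<subseteq> D}"
  have "\<And>S. S \<in> F \<Longrightarrow> open S" by (auto simp: F_def)
  then obtain F' where F': "F' \<subseteq> F" "countable F'" "\<Union>F' = \<Union>F" by (rule Lindelof)
  have cover: "D \<subseteq> \<Union>F"
  proof
    fix x assume "x \<in> D"
    then obtain e where e: "e > 0" "cball x e \<subseteq> D" using open_D open_contains_cball by blast
    then have "ball x e \<in> F" by (auto simp: F_def)
    moreover have "x \<in> ball x e" using e(1) by simp
    ultimately show "x \<in> \<Union>F" by blast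
  qed
  then have "F' \<noteq> {}" using F'(3) assms by auto
  then have range: "range (from_nat_into F') = F'" by (rule range_from_nat_into[OF _ F'(2)])
  have "\<forall>n. \<exists>p. from_nat_into F' n = ball (fst p) (snd p) \<and> snd p > 0 \<and> cball (fst p) (snd p) \<subseteq> D"
  proof
    fix n
    have "from_nat_into F' n \<in> F" using range F'(1) by blast
    then show "\<exists>p. from_nat_into F' n = ball (fst p) (snd p) \<and> snd p > 0 \<and> cball (fst p) (snd p) \<subseteq> D"
      unfolding F_def by auto
  qed
  from choice[OF this] obtain p where p: "\<And>n. from_nat_into F' n = ball (fst (p n)) (snd (p n))"
    "\<And>n. snd (p n) > 0" "\<And>n. cball (fst (p n)) (snd (p n)) \<subseteq> D" by blast
  show ?thesis
  proof (rule that[of "\<lambda>n. snd (p n)" "\<lambda>n. fst (p n)"])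
    have "(\<Union>n. ball (fst (p n)) (snd (p n))) = \<Union>F'" using range p(1) by (metis (no_types, lifting) SUP_cong)
    then show "D \<subseteq> (\<Union>n. ball (fst (p n)) (snd (p n)))" using cover F'(3) by simp
  qed (use p in auto)
qed

text \<open>A weighted sum of kernels on countably many balls that cover \<open>D\<close>. The weights make the sum
  converge uniformly, in \<open>L\<^sup>1\<close> and in the Green bound.\<close>

lemma green_weight:
  assumes "D \<noteq> {}" and green: "\<And>z r. r > 0 \<Longrightarrow> cball z r \<subseteq> D \<Longrightarrow> green_bound z r"
  obtains f :: "'a \<Rightarrow> real" where "\<And>x. 0 \<le> f x" "\<And>x. x \<in> D \<Longrightarrow> 0 < f x" "\<And>x. x \<notin> D \<Longrightarrow> f x = 0"
    "integrable lebesgue f" "sq_integrable f"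
    "\<And>u w. (u, w) \<in> grad_graph D \<Longrightarrow> AE x in lebesgue. 0 \<le> rep u x \<Longrightarrow> u \<bullet> cls f \<le> norm w"
proof (rule countable_ball_cover[OF assms(1)])
  fix z :: "nat \<Rightarrow> 'a" and r :: "nat \<Rightarrow> real"
  assume r: "\<And>n. r n > 0" and zr: "\<And>n. cball (z n) (r n) \<subseteq> D" and cover: "D \<subseteq> (\<Union>n. ball (z n) (r n))"
  define K where "K n = avg_kernel (z n) (r n)" for n
  have "\<forall>n. \<exists>B\<ge>0. \<forall>u w. (u, w) \<in> grad_graph D \<longrightarrow> u \<bullet> cls (K n) \<le> B * norm w"
  proof
    fix n
    obtain B where B: "\<And>u w. (u, w) \<in> grad_graph D \<Longrightarrow> \<bar>u \<bullet> cls (K n)\<bar> \<le> B * norm w"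
      using green[OF r zr, of n] unfolding green_bound_def K_def by blast
    have "u \<bullet> cls (K n) \<le> max B 0 * norm w" if "(u, w) \<in> grad_graph D" for u w
    proof -
      have "u \<bullet> cls (K n) \<le> B * norm w" using B[OF that] by linarith
      also have "\<dots> \<le> max B 0 * norm w" by (intro mult_right_mono) auto
      finally show ?thesis .
    qed
    then show "\<exists>B\<ge>0. \<forall>u w. (u, w) \<in> grad_graph D \<longrightarrow> u \<bullet> cls (K n) \<le> B * norm w"
      by (intro exI[of _ "max B 0"]) auto
  qed
  from choice[OF this] obtain B where B: "\<And>n. B n \<ge> 0" "\<And>n u w. (u, w) \<in> grad_graph D \<Longrightarrow> u \<bullet> cls (K n) \<le> B n * norm w"
    by blast
  have K0: "0 \<le> K n x" for n x unfolding K_def by (rule avg_kernel_bounds(1)[OF r])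
  have Ksq: "sq_integrable (K n)" for n unfolding K_def by (rule avg_kernel_sq_integrable[OF r])
  have Kb: "\<bar>K n x\<bar> \<le> (1 / r n ^ DIM('a)) * indicator (cball (z n) (r n)) x" for n x
    unfolding K_def by (rule avg_kernel_bounds(2)[OF r])
  have Kint: "integrable lebesgue (K n)" for n
    by (rule integrable_bounded_support[OF _ Kb]) (use Ksq[of n] in \<open>auto simp: sq_integrable_def\<close>)
  have Kz: "K n x = 0" if "x \<notin> D" for n x
  proof -
    have "x \<notin> cball (z n) (r n)" using zr that by blast
    then show ?thesis using Kb[of n x] by simp
  qed
  define M where "M n = 1 + B n + 1 / r n ^ DIM('a) + (\<integral>x. K n x \<partial>lebesgue)" for n
  have I0: "0 \<le> (\<integral>x. K n x \<partial>lebesgue)" for n by (rule Bochner_Integration.integral_nonneg) (rule K0)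
  have M: "M n \<ge> 1" "B n \<le> M n" "1 / r n ^ DIM('a) \<le> M n" "(\<integral>x. K n x \<partial>lebesgue) \<le> M n" for n
    using B(1)[of n] I0[of n] r[of n] by (auto simp: M_def)
  define a where "a n = (1/2) ^ Suc n / M n" for n
  have a0: "a n > 0" for n using M(1)[of n] by (simp add: a_def)
  have aM: "a n * t \<le> (1/2) ^ Suc n" if "t \<le> M n" for n t
  proof -
    have "a n * t \<le> a n * M n" using that a0[of n] by (intro mult_left_mono) auto
    also have "\<dots> = (1/2) ^ Suc n" using M(1)[of n] by (simp add: a_def)
    finally show ?thesis .
  qed
  have geo: "summable (\<lambda>n. (1/2 :: real) ^ Suc n)" "(\<Sum>n. (1/2 :: real) ^ Suc n) = 1"
    using power_half_series by (auto simp: sums_iff)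
  have Ka: "a n * K n x \<le> (1/2) ^ Suc n" for n x
  proof (rule aM)
    have "K n x \<le> (1 / r n ^ DIM('a)) * indicator (cball (z n) (r n)) x" using Kb[of n x] by linarith
    also have "\<dots> \<le> 1 / r n ^ DIM('a)" using r[of n] by (simp add: indicator_def)
    finally show "K n x \<le> M n" using M(3)[of n] by linarith
  qed
  have aK0: "0 \<le> a n * K n x" for n x using a0[of n] K0[of n x] by simp
  have sumK: "summable (\<lambda>n. a n * K n x)" for x
    by (rule summable_comparison_test'[OF geo(1), of 0]) (use Ka aK0 in \<open>simp add: abs_of_nonneg\<close>)
  define f where "f x = (\<Sum>n. a n * K n x)" for x
  have f0: "0 \<le> f x" for x unfolding f_def by (rule suminf_nonneg[OF sumK aK0])
  have f1: "f x \<le> 1" for x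
    using suminf_le[OF Ka sumK geo(1), of x] unfolding f_def geo(2) .
  have fint: "integrable lebesgue f"
    unfolding f_def
  proof (rule integrable_suminf)
    show "integrable lebesgue (\<lambda>x. a n * K n x)" for n by (rule integrable_mult_right) (rule Kint)
    show "AE x in lebesgue. summable (\<lambda>n. norm (a n * K n x))" using sumK aK0 by (simp add: abs_of_nonneg)
    show "summable (\<lambda>n. \<integral>x. norm (a n * K n x) \<partial>lebesgue)"
      by (rule summable_comparison_test'[OF geo(1), of 0])
        (use aM[OF M(4)] aK0 I0 a0 in \<open>simp add: abs_of_nonneg less_imp_le\<close>)
  qed
  show ?thesis
  proof (rule that[of f])
    show "0 \<le> f x" for x by (rule f0)
    show "integrable lebesgue f" by (rule fint)
    show fsq: "sq_integrable f"
    proof (rule sq_integrable_bound[OF _ fint])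
      show "(norm (f x))\<^sup>2 \<le> f x" for x using f0[of x] f1[of x] by (simp add: power2_eq_square mult_left_le)
    qed (use fint in simp)
    show "0 < f x" if xD: "x \<in> D" for x
    proof -
      obtain n where n: "x \<in> ball (z n) (r n)" using xD cover by blast
      have "0 < K n x" using bump_pos[OF n] r[of n] by (simp add: K_def avg_kernel_def)
      then show ?thesis unfolding f_def using a0[of n] by (intro suminf_pos2[OF sumK aK0, of n]) simp
    qed
    show "f x = 0" if "x \<notin> D" for x using Kz[OF that] by (simp add: f_def)
    fix u w assume uw: "(u, w) \<in> grad_graph D" and pos: "AE x in lebesgue. 0 \<le> rep u x"
    have uK: "(\<integral>x. rep u x * K n x \<partial>lebesgue) \<le> B n * norm w" for n
      using B(2)[OF uw, of n] l2_inner_cls[OF Ksq, of u n] by simp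
    have uK0: "0 \<le> (\<integral>x. rep u x * K n x \<partial>lebesgue)" for n
      by (rule integral_nonneg_AE) (use pos in \<open>eventually_elim, simp add: K0\<close>)
    have summand: "a n * (\<integral>x. rep u x * K n x \<partial>lebesgue) \<le> (1/2) ^ Suc n * norm w" for n
    proof -
      have "a n * (\<integral>x. rep u x * K n x \<partial>lebesgue) \<le> a n * (B n * norm w)"
        using uK[of n] a0[of n] by (intro mult_left_mono) auto
      also have "\<dots> \<le> (1/2) ^ Suc n * norm w" using mult_right_mono[OF aM[OF M(2)], of "norm w" n] by (simp add: mult.assoc)
      finally show ?thesis .
    qed
    have t0: "0 \<le> a n * (\<integral>x. rep u x * K n x \<partial>lebesgue)" for n using a0[of n] uK0[of n] by simp
    have sumw: "summable (\<lambda>n. (1/2) ^ Suc n * norm w)" by (rule summable_mult2[OF geo(1)])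
    have sumt: "summable (\<lambda>n. a n * (\<integral>x. rep u x * K n x \<partial>lebesgue))"
      by (rule summable_comparison_test'[OF sumw, of 0]) (use summand t0 in \<open>simp add: abs_of_nonneg\<close>)
    have int: "integrable lebesgue (\<lambda>x. rep u x * (a n * K n x))" for n
      using integrable_mult_right[OF sq_integrable_mult[OF rep_sq_integrable[of u] Ksq[of n]], of "a n"]
      by (simp add: mult.left_commute)
    have val: "(\<integral>x. rep u x * (a n * K n x) \<partial>lebesgue) = a n * (\<integral>x. rep u x * K n x \<partial>lebesgue)" for n
      by (simp add: mult.left_commute)
    have "u \<bullet> cls f = (\<integral>x. (\<Sum>n. rep u x * (a n * K n x)) \<partial>lebesgue)"
      unfolding l2_inner_cls[OF fsq] by (simp add: f_def suminf_mult[OF sumK])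
    also have "\<dots> = (\<Sum>n. \<integral>x. rep u x * (a n * K n x) \<partial>lebesgue)"
    proof (rule integral_suminf[OF int])
      show "AE x in lebesgue. summable (\<lambda>n. norm (rep u x * (a n * K n x)))"
      proof (rule AE_I2)
        fix x
        have "summable (\<lambda>n. \<bar>rep u x\<bar> * (a n * K n x))" by (rule summable_mult[OF sumK])
        moreover have "norm (rep u x * (a n * K n x)) = \<bar>rep u x\<bar> * (a n * K n x)" for n
          unfolding real_norm_def abs_mult[of "rep u x"] by (simp only: abs_of_nonneg[OF aK0])
        ultimately show "summable (\<lambda>n. norm (rep u x * (a n * K n x)))" by (simp only:)
      qed
      have "(\<integral>x. norm (rep u x * (a n * K n x)) \<partial>lebesgue) = a n * (\<integral>x. rep u x * K n x \<partial>lebesgue)" for n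
        unfolding val[symmetric]
        by (rule integral_cong_AE)
          (use pos int[of n] less_imp_le[OF a0[of n]] K0 in \<open>auto elim!: eventually_mono intro!: abs_of_nonneg mult_nonneg_nonneg\<close>)
      then show "summable (\<lambda>n. \<integral>x. norm (rep u x * (a n * K n x)) \<partial>lebesgue)" using sumt by simp
    qed
    also have "\<dots> = (\<Sum>n. a n * (\<integral>x. rep u x * K n x \<partial>lebesgue))" unfolding val ..
    also have "\<dots> \<le> (\<Sum>n. (1/2) ^ Suc n * norm w)" by (rule suminf_le[OF summand sumt sumw])
    also have "\<dots> = norm w" using suminf_mult2[OF geo(1), of "norm w"] geo(2) by simp
    finally show "u \<bullet> cls f \<le> norm w" .
  qed
qed

definition nonneg :: "('a, real) l2 \<Rightarrow> bool" where
  "nonneg f \<longleftrightarrow> (AE x in lebesgue. 0 \<le> rep f x)"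

lemma nonneg_inner: "nonneg f \<Longrightarrow> nonneg g \<Longrightarrow> 0 \<le> f \<bullet> g"
  unfolding nonneg_def l2_inner_rep by (rule integral_nonneg_AE) (auto elim: eventually_elim2)

text \<open>Test with the negative part of \<open>f\<close>.\<close>

lemma nonneg_if_inner_nonneg:
  assumes "\<And>g. nonneg g \<Longrightarrow> 0 \<le> f \<bullet> g" shows "nonneg f"
proof -
  have sq: "sq_integrable (\<lambda>x. max 0 (- rep f x))"
  proof (rule sq_integrable_bound)
    show "integrable lebesgue (\<lambda>x. (norm (rep f x))\<^sup>2)" using rep_sq_integrable[of f] unfolding sq_integrable_def by blast
    show "(norm (max 0 (- rep f x)))\<^sup>2 \<le> (norm (rep f x))\<^sup>2" for x by (intro power_mono) (auto simp: max_def)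
  qed measurable
  define g where "g = cls (\<lambda>x. max 0 (- rep f x))"
  have g: "AE x in lebesgue. rep g x = max 0 (- rep f x)" unfolding g_def by (rule rep_cls[OF sq])
  have "nonneg g" unfolding nonneg_def using g by eventually_elim simp
  then have "0 \<le> f \<bullet> g" by (rule assms)
  also have "f \<bullet> g = - (g \<bullet> g)"
  proof -
    have "f \<bullet> g = (\<integral>x. - (rep g x \<bullet> rep g x) \<partial>lebesgue)"
      unfolding l2_inner_rep
      by (rule integral_cong_AE)
        (use g in \<open>auto elim!: eventually_mono simp: max_def intro!: borel_measurable_inner\<close>)
    then show ?thesis by (simp add: l2_inner_rep)
  qed
  finally have "g = 0" using inner_ge_zero[of g] by (metis inner_eq_zero_iff neg_0_le_iff_le order_antisym)
  then have "cls (\<lambda>x. max 0 (- rep f x)) = cls (\<lambda>_. 0)" by (simp add: g_def cls_zero)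
  then have "AE x in lebesgue. max 0 (- rep f x) = 0" by (simp add: cls_eq_iff[OF sq sq_integrable_0])
  then show ?thesis unfolding nonneg_def by eventually_elim (simp add: max_def split: if_splits)
qed

lemma T_nonneg: "nonneg f \<Longrightarrow> t \<ge> 0 \<Longrightarrow> nonneg (T t f)"
  using T_values[of "{0..}" f t] by (simp add: nonneg_def values_in_def)

lemma integral_T_nonneg:
  assumes f: "nonneg f" and a: "0 \<le> a" shows "nonneg (integral {a..b} (\<lambda>s. T s f))"
proof (rule nonneg_if_inner_nonneg)
  fix g assume g: "nonneg g"
  have "integral {a..b} (\<lambda>s. T s f) \<bullet> g = integral {a..b} (\<lambda>s. T s f \<bullet> g)"
    using integral_linear[OF T_integrable[OF a, of f b] bounded_linear_inner_left[of g]] by (simp add: o_def)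
  also have "\<dots> \<ge> 0"
    by (rule Henstock_Kurzweil_Integration.integral_nonneg[OF T_inner_integrable[OF a]])
      (use a f g in \<open>auto intro!: nonneg_inner T_nonneg\<close>)
  finally show "0 \<le> integral {a..b} (\<lambda>s. T s f) \<bullet> g" .
qed

lemma S_nonneg: "nonneg f \<Longrightarrow> nonneg (S N f)"
  unfolding S_def by (rule integral_T_nonneg) auto

lemma S_mono: 
  assumes f: "nonneg f" and MN: "0 \<le> M" "M \<le> N" shows "AE x in lebesgue. rep (S M f) x \<le> rep (S N f) x"
proof -
  have "S N f - S M f = integral {M..N} (\<lambda>s. T s f)" using S_split[OF MN] by simp
  then have "nonneg (S N f - S M f)" using integral_T_nonneg[OF f MN(1)] by simp
  then show ?thesis unfolding nonneg_def using rep_diff[of "S N f" "S M f"] by eventually_elim simp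
qed

text \<open>By symmetry and the Markov property, the semigroup does not increase the \<open>L\<^sup>1\<close> norm of
  nonnegative functions.\<close>

lemma S_integrable:
  assumes f: "integrable lebesgue f" "sq_integrable f" "\<And>x. 0 \<le> f x" and N: "0 \<le> N"
  shows "integrable lebesgue (rep (S N (cls f)))"
proof -
  let ?F = "cls f"
  have repF: "AE x in lebesgue. rep ?F x = f x" by (rule rep_cls[OF f(2)])
  have F: "nonneg ?F" unfolding nonneg_def using repF by eventually_elim (simp add: f(3))
  have SF: "AE x in lebesgue. 0 \<le> rep (S N ?F) x" using S_nonneg[OF F] by (simp add: nonneg_def)
  define C where "C = N * (\<integral>x. f x \<partial>lebesgue)"
  have bound: "(\<integral>x. rep (S N ?F) x * indicator (cball 0 (real n)) x \<partial>lebesgue) \<le> C" for n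
  proof -
    have sq: "sq_integrable (indicator (cball 0 (real n)) :: 'a \<Rightarrow> real)"
      by (rule sq_integrable_indicat_real) simp
    define g where "g = cls (indicator (cball 0 (real n)) :: 'a \<Rightarrow> real)"
    have "g \<in> values_in {0..1}"
      unfolding values_in_def g_def mem_Collect_eq using rep_cls[OF sq] by eventually_elim (simp add: indicator_def)
    then have g: "AE x in lebesgue. rep (T s g) x \<in> {0..1}" if "s \<ge> 0" for s
      using T_values[of "{0..1}" g s] that by (simp add: values_in_def)
    have "(\<integral>x. rep (S N ?F) x * indicator (cball 0 (real n)) x \<partial>lebesgue) = S N ?F \<bullet> g"
      unfolding g_def by (simp add: l2_inner_cls[OF sq])
    also have "\<dots> = integral {0..N} (\<lambda>s. T s ?F \<bullet> g)" by (rule S_inner[OF N])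
    also have "\<dots> \<le> integral {0..N} (\<lambda>s. \<integral>x. f x \<partial>lebesgue)"
    proof (rule integral_le[OF T_inner_integrable[OF order_refl] integrable_const_ivl])
      fix s assume s: "s \<in> {0..N}"
      have "T s ?F \<bullet> g = (\<integral>x. rep (T s g) x * f x \<partial>lebesgue)"
        using s T_sym[of s ?F g] l2_inner_cls[OF f(2), of "T s g"] by (simp add: inner_commute)
      also have "\<dots> \<le> (\<integral>x. f x \<partial>lebesgue)"
      proof (rule integral_mono_AE[OF sq_integrable_mult[OF rep_sq_integrable f(2)] f(1)])
        have "s \<ge> 0" using s by simp
        from g[OF this] show "AE x in lebesgue. rep (T s g) x * f x \<le> f x"
          by eventually_elim (use f(3) in \<open>simp add: mult_left_le_one_le\<close>)
      qed
      finally show "T s ?F \<bullet> g \<le> (\<integral>x. f x \<partial>lebesgue)" .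
    qed
    also have "\<dots> = C" using N by (simp add: C_def)
    finally show ?thesis .
  qed
  have meas: "(\<lambda>x. ennreal (rep (S N ?F) x * indicator (cball 0 (real n)) x)) \<in> borel_measurable lebesgue" for n
    by (intro measurable_compose[OF _ measurable_ennreal] borel_measurable_times rep_measurable borel_measurable_indicator) simp
  have "(\<integral>\<^sup>+x. ennreal (rep (S N ?F) x) \<partial>lebesgue) =
      (\<integral>\<^sup>+x. liminf (\<lambda>n. ennreal (rep (S N ?F) x * indicator (cball 0 (real n)) x)) \<partial>lebesgue)"
  proof (rule nn_integral_cong)
    fix x :: 'a
    obtain n0 where n0: "norm x \<le> real n0" using real_arch_simple by blast
    have "\<forall>\<^sub>F n in sequentially. ennreal (rep (S N ?F) x) = ennreal (rep (S N ?F) x * indicator (cball 0 (real n)) x)"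
      using eventually_ge_at_top[of n0] by eventually_elim (use n0 in \<open>simp add: indicator_def\<close>)
    then have "(\<lambda>n. ennreal (rep (S N ?F) x * indicator (cball 0 (real n)) x)) \<longlonglongrightarrow> ennreal (rep (S N ?F) x)"
      by (rule Lim_transform_eventually[OF tendsto_const])
    then show "ennreal (rep (S N ?F) x) = liminf (\<lambda>n. ennreal (rep (S N ?F) x * indicator (cball 0 (real n)) x))"
      by (rule lim_imp_Liminf[OF trivial_limit_sequentially, symmetric])
  qed
  also have "\<dots> \<le> liminf (\<lambda>n. \<integral>\<^sup>+x. ennreal (rep (S N ?F) x * indicator (cball 0 (real n)) x) \<partial>lebesgue)"
    by (rule nn_integral_liminf[OF meas])
  also have "\<dots> \<le> ennreal C"
  proof (rule Liminf_le)
    have "(\<integral>\<^sup>+x. ennreal (rep (S N ?F) x * indicator (cball 0 (real n)) x) \<partial>lebesgue) \<le> ennreal C" for n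
    proof -
      have sq: "sq_integrable (indicator (cball 0 (real n)) :: 'a \<Rightarrow> real)"
        by (rule sq_integrable_indicat_real) simp
      have "(\<integral>\<^sup>+x. ennreal (rep (S N ?F) x * indicator (cball 0 (real n)) x) \<partial>lebesgue) =
          ennreal (\<integral>x. rep (S N ?F) x * indicator (cball 0 (real n)) x \<partial>lebesgue)"
        by (rule nn_integral_eq_integral[OF sq_integrable_mult[OF rep_sq_integrable sq]])
          (use SF in \<open>eventually_elim, simp\<close>)
      then show ?thesis using bound[of n] by (simp add: ennreal_leI)
    qed
    then show "\<forall>\<^sub>F n in sequentially. (\<integral>\<^sup>+x. ennreal (rep (S N ?F) x * indicator (cball 0 (real n)) x) \<partial>lebesgue) \<le> ennreal C"
      by (intro always_eventually allI)
  qed simp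
  finally have fin: "(\<integral>\<^sup>+x. ennreal (rep (S N ?F) x) \<partial>lebesgue) \<le> ennreal C" .
  show ?thesis
  proof (rule integrableI_nonneg[OF rep_measurable SF])
    show "(\<integral>\<^sup>+x. ennreal (rep (S N ?F) x) \<partial>lebesgue) < \<infinity>" using fin by (rule le_less_trans) simp
  qed
qed

text \<open>The pairing of \<open>f\<close> with its partial potentials is at most 2: it bounds the energy of the partial
  potential, and the square root of the energy bounds it.\<close>

lemma S_pairing_bound:
  assumes F: "nonneg F" and N: "0 \<le> N"
    and green: "\<And>u w. (u, w) \<in> grad_graph D \<Longrightarrow> nonneg u \<Longrightarrow> u \<bullet> F \<le> norm w"
  shows "S N F \<bullet> F \<le> 2"
proof -
  obtain w where w: "(S N F, w) \<in> half_graph D" "(norm w)\<^sup>2 = (F - T N F) \<bullet> S N F"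
    by (rule S_energy[OF N, of F]) blast
  define p where "p = S N F \<bullet> F"
  have "0 \<le> T N F \<bullet> S N F" by (intro nonneg_inner T_nonneg S_nonneg F N)
  then have w2: "(norm w)\<^sup>2 \<le> p"
    using w(2) inner_diff_left[of F "T N F" "S N F"] inner_commute[of F "S N F"] unfolding p_def by linarith
  have "(S N F, sqrt 2 *\<^sub>R w) \<in> grad_graph D" using w(1) by (simp add: half_graph_def)
  from green[OF this S_nonneg[OF F]] have pw: "p \<le> sqrt 2 * norm w" by (simp add: p_def)
  have p0: "0 \<le> p" unfolding p_def by (intro nonneg_inner S_nonneg F)
  have "p * p \<le> (sqrt 2 * norm w) * (sqrt 2 * norm w)" by (rule mult_mono[OF pw pw]) (use p0 in auto)
  also have "\<dots> = 2 * (norm w)\<^sup>2" by (simp add: power2_eq_square)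
  also have "\<dots> \<le> 2 * p" using w2 by simp
  finally have "p * p \<le> 2 * p" .
  then show ?thesis unfolding p_def[symmetric] using p0 by (cases "p = 0") auto
qed

text \<open>The partial potentials of the weight \<open>f\<close> increase with \<open>N\<close>, and their integrals against \<open>f\<close> are at most 2. As
  \<open>f\<close> is positive, monotone convergence shows that their limit is finite almost everywhere.\<close>

lemma transient_if_green_bound:
  assumes "D \<noteq> {}" and green: "\<And>z r. r > 0 \<Longrightarrow> cball z r \<subseteq> D \<Longrightarrow> green_bound z r"
  shows "transient_form (lebesgue_on D) (\<lambda>u v. 1 / 2 * Dirichlet_int D u v) (W12 D)"
proof (rule green_weight[OF assms])
  fix f :: "'a \<Rightarrow> real"
  assume f: "\<And>x. 0 \<le> f x" "\<And>x. x \<in> D \<Longrightarrow> 0 < f x" "\<And>x. x \<notin> D \<Longrightarrow> f x = 0"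
    "integrable lebesgue f" "sq_integrable f"
    and fg: "\<And>u w. (u, w) \<in> grad_graph D \<Longrightarrow> AE x in lebesgue. 0 \<le> rep u x \<Longrightarrow> u \<bullet> cls f \<le> norm w"
  define F where "F = cls f"
  define h where "h N = rep (S (real N) F)" for N :: nat
  define G where "G x = (SUP N. ereal (h N x))" for x
  have Df: "(\<lambda>x. indicator D x *\<^sub>R f x) = f" using f(3) by (auto simp: fun_eq_iff indicator_def)
  have extf: "ext f = F" unfolding ext_def F_def Df ..
  have fL2: "f \<in> L2 (lebesgue_on D)" using f(5) by (simp add: L2_iff Df[unfolded real_scaleR_def])
  have F: "nonneg F" unfolding nonneg_def F_def using rep_cls[OF f(5)] by eventually_elim (simp add: f(1))
  have mono: "AE x in lebesgue. h N x \<le> h (Suc N) x" for N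
    unfolding h_def by (rule S_mono[OF F]) auto
  have h0: "AE x in lebesgue. 0 \<le> h N x" for N
    using S_nonneg[OF F] by (simp add: h_def nonneg_def)
  have int_on: "integrable (lebesgue_on D) k" if "integrable lebesgue k" for k :: "'a \<Rightarrow> real"
    using integrable_mult_indicator[OF D_sets(1) that] by (simp add: integrable_restrict_space[OF D_space])
  have potential: "semigroup_integral_L1 (lebesgue_on D) TD (real N) f (h N)" for N
    unfolding semigroup_integral_L1_def
  proof (intro conjI exI allI)
    show fi: "integrable (lebesgue_on D) f" by (rule int_on[OF f(4)])
    show "integrable (lebesgue_on D) (h N)"
      unfolding h_def F_def by (intro int_on S_integrable f) simp
    show "integrable (lebesgue_on D) ((\<lambda>_. f) n)" for n :: nat using fi by simp
    show "(\<lambda>_. f) n \<in> L2 (lebesgue_on D)" for n :: nat using fL2 by simp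
    show "semigroup_integral_L2 (lebesgue_on D) TD (real N) ((\<lambda>_. f) n) ((\<lambda>_. h N) n)" for n :: nat
      using semigroup_integral_L2_TD[OF fL2, of "real N"] by (simp add: extf h_def)
  qed simp_all
  have finite: "AE x in lebesgue. (SUP N. ennreal (f x * h N x)) \<noteq> \<infinity>"
  proof (rule nn_integral_PInf_AE)
    have meas: "(\<lambda>x. ennreal (f x * h N x)) \<in> borel_measurable lebesgue" for N
      unfolding h_def using f(4)
      by (intro measurable_compose[OF _ measurable_ennreal] borel_measurable_times rep_measurable) simp
    then show "(\<lambda>x. SUP N. ennreal (f x * h N x)) \<in> borel_measurable lebesgue" by (intro borel_measurable_SUP) auto
    have "(\<integral>\<^sup>+x. (SUP N. ennreal (f x * h N x)) \<partial>lebesgue) = (SUP N. \<integral>\<^sup>+x. ennreal (f x * h N x) \<partial>lebesgue)"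
    proof (rule nn_integral_monotone_convergence_SUP_AE[OF _ meas])
      show "AE x in lebesgue. ennreal (f x * h N x) \<le> ennreal (f x * h (Suc N) x)" for N
        using mono[of N] by eventually_elim (intro ennreal_leI mult_left_mono f(1))
    qed
    also have "\<dots> \<le> ennreal 2"
    proof (rule SUP_least)
      fix N :: nat
      have "(\<integral>\<^sup>+x. ennreal (f x * h N x) \<partial>lebesgue) = ennreal (\<integral>x. f x * h N x \<partial>lebesgue)"
      proof (rule nn_integral_eq_integral)
        show "integrable lebesgue (\<lambda>x. f x * h N x)" unfolding h_def by (intro sq_integrable_mult f(5) rep_sq_integrable)
        show "AE x in lebesgue. 0 \<le> f x * h N x" using h0[of N] by eventually_elim (simp add: f(1))
      qed
      also have "(\<integral>x. f x * h N x \<partial>lebesgue) = S (real N) F \<bullet> F"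
        unfolding h_def F_def using l2_inner_cls[OF f(5), of "S (real N) (cls f)"] by (simp add: mult.commute)
      also have "ennreal (S (real N) F \<bullet> F) \<le> ennreal 2"
        by (intro ennreal_leI S_pairing_bound[OF F]) (use fg in \<open>auto simp: F_def nonneg_def\<close>)
      finally show "(\<integral>\<^sup>+x. ennreal (f x * h N x) \<partial>lebesgue) \<le> ennreal 2" .
    qed
    finally show "(\<integral>\<^sup>+x. (SUP N. ennreal (f x * h N x)) \<partial>lebesgue) \<noteq> \<infinity>" by (auto simp: top_unique)
  qed
  have "AE x in lebesgue. x \<in> D \<longrightarrow> (\<lambda>N. ereal (h N x)) \<longlonglongrightarrow> G x \<and> G x < \<infinity>"
  proof -
    have "AE x in lebesgue. \<forall>N. h N x \<le> h (Suc N) x" using mono by (simp add: AE_all_countable)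
    then show ?thesis using finite
    proof eventually_elim
      fix x assume inc: "\<forall>N. h N x \<le> h (Suc N) x" and fin: "(SUP N. ennreal (f x * h N x)) \<noteq> \<infinity>"
      show "x \<in> D \<longrightarrow> (\<lambda>N. ereal (h N x)) \<longlonglongrightarrow> G x \<and> G x < \<infinity>"
      proof (intro impI conjI)
        have "incseq (\<lambda>N. ereal (h N x))" by (rule incseq_SucI) (use inc in simp)
        then show "(\<lambda>N. ereal (h N x)) \<longlonglongrightarrow> G x" unfolding G_def by (rule LIMSEQ_SUP)
        assume "x \<in> D"
        then have fx: "f x > 0" by (rule f(2))
        define c where "c = enn2real (SUP N. ennreal (f x * h N x))"
        have c: "(SUP N. ennreal (f x * h N x)) = ennreal c"
        proof -
          have "(SUP N. ennreal (f x * h N x)) < top"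
            using fin by (subst less_top[symmetric]) (simp only: infinity_ennreal_def not_False_eq_True)
          then show ?thesis unfolding c_def by (rule ennreal_enn2real[symmetric])
        qed
        have "h N x \<le> c / f x" for N
        proof -
          have "ennreal (f x * h N x) \<le> ennreal c" unfolding c[symmetric] by (rule SUP_upper) simp
          moreover have "0 \<le> c" by (simp add: c_def)
          ultimately have "f x * h N x \<le> c" by (simp add: ennreal_le_iff)
          then show ?thesis using fx by (simp add: field_simps)
        qed
        then have "G x \<le> ereal (c / f x)" unfolding G_def by (intro SUP_least) simp
        then show "G x < \<infinity>" by (rule le_less_trans) simp
      qed
    qed
  qed
  then have both: "AE x in lebesgue_on D. (\<lambda>N. ereal (h N x)) \<longlonglongrightarrow> G x \<and> G x < \<infinity>"
    unfolding AE_restrict_space_iff[OF D_space] .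
  have lim: "AE x in lebesgue_on D. (\<lambda>N. ereal (h N x)) \<longlonglongrightarrow> G x"
    using both by eventually_elim (rule conjunct1)
  have fin: "AE x in lebesgue_on D. G x < \<infinity>"
    using both by eventually_elim (rule conjunct2)
  have pot: "is_potential (lebesgue_on D) TD f G"
    unfolding is_potential_def using potential lim by blast
  have fpos: "AE x in lebesgue_on D. f x > 0"
    by (rule AE_I2) (use f(2) in \<open>simp add: space_restrict_space\<close>)
  show ?thesis
    unfolding transient_form_def
    using semigroup_of_form_TD int_on[OF f(4)] fpos pot fin by blast
qed

end

theorem theorem2p10:
  fixes D U :: "'a::euclidean_space set"
  assumes "DIM('a) \<ge> 3"
    and "class_D D"
    and "uniform_domain U" and "\<not> bounded U" and "U \<subseteq> D"
  shows "transient_form (lebesgue_on D) (\<lambda>u v. 1 / 2 * Dirichlet_int D u v) (W12 D)"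
proof -
  have D: "D \<noteq> {}" "open D" "connected D" using assms(2) by (auto simp: class_D_def domain_set_def)
  interpret open_domain D by standard (rule D(2))
  obtain z r where zr: "r > 0" "cball z (2 * r) \<subseteq> D" "green_bound z r"
    by (rule green_bound_in_uniform_domain[OF assms(1,3,4,5)])
  have "cball z r \<subseteq> cball z (2 * r)" using zr(1) by (intro subset_cball) simp
  then have "cball z r \<subseteq> D" using zr(2) by (rule order_trans)
  then have "green_bound y s" if "s > 0" "cball y s \<subseteq> D" for y s
    by (rule green_bound_everywhere[OF D(3) zr(1) _ zr(3) that])
  then show ?thesis by (rule transient_if_green_bound[OF D(1)])
qed

end
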